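(* Let $\beta>0$ and let $\Lambda\subset\mathbb Z^d$ be a finite box. Let $$P_\Lambda(m)=\int_{\Omega_{\beta,\Lambda}}\Big(\frac{1}{\beta|\Lambda|}\int_0^\beta\sum_{j\in\Lambda}\omega_j(\tau)\,d\tau\Big)^2\nu^{\rm per}_{\beta,\Lambda}(d\omega_\Lambda),\qquad Q_\Lambda=\int_{\mathbb R^\Lambda}\Big(\frac1{|\Lambda|}\sum_{j\in\Lambda}x_j\Big)^2\mu^{\rm per}_{\beta,\Lambda}(dx_\Lambda),$$ where $|\Lambda|$ is the cardinality of $\Lambda$ and $\nu^{\rm per}_{\beta,\Lambda}$ depends on the reduced mass $m>0$. Then $$\lim_{m\to+\infty}P_\Lambda(m)=Q_\Lambda.$$
   Context: Standing assumptions (translation-invariant model). $d\ge1$; $J:[0,\infty)\to\mathbb R$ vanishes when its argument exceeds some $r>0$; $c:=\sum_{k\in\mathbb Z^d}|J(|j-k|)|<\infty$ (independent of $j$; $|\cdot|$ Euclidean distance). $U:\mathbb R\to\mathbb R$ is continuous and even, and there are $b\in\mathbb R$ and $\tilde c>\max\{c-1,0\}$ with $U(x)\ge\frac12\tilde cx^2+b$ for all $x\in\mathbb R$. Box and periodic metric. $\Lambda=\{k\in\mathbb Z^d: k^{(0)}_l\le k_l\le k^{(1)}_l,\ l=1,\dots,d\}$ with integers $k^{(0)}_l<k^{(1)}_l$. For $j,k\in\Lambda$, $|j_l-k_l|_\Lambda=\min\{|j_l-k_l|;\ k^{(1)}_l-k^{(0)}_l+1-|j_l-k_l|\}$ and $|j-k|_\Lambda^2=\sum_{l=1}^d|j_l-k_l|_\Lambda^2$.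 Quantum periodic measure. $C_\beta=\{\omega\in C([0,\beta],\mathbb R):\omega(0)=\omega(\beta)\}$ with the sup norm; $\Omega_{\beta,\Lambda}=(C_\beta)^\Lambda$ with the product topology. For $m>0$, $\gamma^{(m)}_\beta$ is the centered Gaussian measure on $L^2([0,\beta])$ with covariance operator $(-m\Delta_\beta+1)^{-1}$, where $\Delta_\beta$ is the Laplacian on $[0,\beta]$ with periodic boundary conditions (covariance eigenvalues $(mq^2+1)^{-1}$, $q\in\frac{2\pi}{\beta}\mathbb Z$, on the trigonometric orthonormal basis $\beta^{-1/2}$, $\sqrt{2/\beta}\cos q\tau$ for $q>0$, $\sqrt{2/\beta}\sin q\tau$ for $q<0$). It satisfies $\gamma_\beta^{(m)}(C_\beta)=1$ and is regarded as a measure on $C_\beta$; $\gamma^{(m)}_{\beta,\Lambda}=\prod_{j\in\Lambda}\gamma^{(m)}_\beta$ on $\Omega_{\beta,\Lambda}$. With $$E^{\rm per}_{\beta,\Lambda}(\omega_\Lambda)=\sum_{j\in\Lambda}\int_0^\beta U(\omega_j(\tau))d\tau+\tfrac12\sum_{j,k\in\Lambda}J(|j-k|_\Lambda)\int_0^\beta\omega_j(\tau)\omega_k(\tau)d\tau,$$ $\nu^{\rm per}_{\beta,\Lambda}(d\omega_\Lambda)=\frac{1}{Z^{\rm per}}e^{-E^{\rm per}_{\beta,\Lambda}(\omega_\Lambda)}\gamma^{(m)}_{\beta,\Lambda}(d\omega_\Lambda)$, with $Z^{\rm per}$ the normalizing constant. Classical periodic measure. $I^{\rm per}_\Lambda(x_\Lambda)=\sum_{j\in\Lambda}U(x_j)+\frac12\sum_{j,k\in\Lambda}J(|j-k|_\Lambda)x_jx_k$;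 $\chi_{\beta,\Lambda}(dx_\Lambda)=\prod_{j\in\Lambda}\sqrt{\beta/2\pi}\,e^{-\beta x_j^2/2}dx_j$; $\mu^{\rm per}_{\beta,\Lambda}(dx_\Lambda)=\frac{1}{Y^{\rm per}}e^{-\beta I^{\rm per}_\Lambda(x_\Lambda)}\chi_{\beta,\Lambda}(dx_\Lambda)$, with $Y^{\rm per}$ the normalizing constant. *)

theory Defs
  imports "HOL-Probability.Probability"
begin

definition lattice_dist :: "int ^ 'd \<Rightarrow> int ^ 'd \<Rightarrow> real" where
  "lattice_dist j k = sqrt (\<Sum>l\<in>UNIV. (real_of_int \<bar>j $ l - k $ l\<bar>)\<^sup>2)"

definition box_lattice :: "int ^ 'd \<Rightarrow> int ^ 'd \<Rightarrow> (int ^ 'd) set" where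
  "box_lattice k0 k1 = {k. \<forall>l. k0 $ l \<le> k $ l \<and> k $ l \<le> k1 $ l}"

definition periodic_dist :: "int ^ 'd \<Rightarrow> int ^ 'd \<Rightarrow> int ^ 'd \<Rightarrow> int ^ 'd \<Rightarrow> real" where
  "periodic_dist k0 k1 j k =
     sqrt (\<Sum>l\<in>UNIV. (real_of_int
       (min \<bar>j $ l - k $ l\<bar> (k1 $ l - k0 $ l + 1 - \<bar>j $ l - k $ l\<bar>)))\<^sup>2)"

text \<open>The library metric on \<open>cfunspace\<close> is the sup metric; its points are functions on
  \<open>{0..\<beta>}\<close>, represented as extensional total functions.\<close>

definition loop_metric :: "real \<Rightarrow> (real \<Rightarrow> real) metric" where
  "loop_metric \<beta> =
     submetric (cfunspace (top_of_set {0..\<beta>}) euclidean_metric) {\<omega>. \<omega> 0 = \<omega> \<beta>}"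

definition loop_borel :: "real \<Rightarrow> (real \<Rightarrow> real) measure" where
  "loop_borel \<beta> =
     sigma (mspace (loop_metric \<beta>)) {A. openin (mtopology_of (loop_metric \<beta>)) A}"

text \<open>Elements of \<open>L\<^sup>2([0,\<beta>])\<close> are represented by Borel functions on the line, only
  their values on \<open>{0..\<beta>}\<close> being relevant.\<close>

definition L2_fun :: "real \<Rightarrow> (real \<Rightarrow> real) \<Rightarrow> bool" where
  "L2_fun \<beta> f \<longleftrightarrow> f \<in> borel_measurable borel \<and> set_integrable lborel {0..\<beta>} (\<lambda>\<tau>. (f \<tau>)\<^sup>2)"

definition L2_inner :: "real \<Rightarrow> (real \<Rightarrow> real) \<Rightarrow> (real \<Rightarrow> real) \<Rightarrow> real" where
  "L2_inner \<beta> f g = (LBINT \<tau>:{0..\<beta>}. f \<tau> * g \<tau>)"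

definition freq :: "real \<Rightarrow> int \<Rightarrow> real" where
  "freq \<beta> n = 2 * pi / \<beta> * real_of_int n"

definition trig_basis :: "real \<Rightarrow> int \<Rightarrow> real \<Rightarrow> real" where
  "trig_basis \<beta> n \<tau> =
     (if n = 0 then 1 / sqrt \<beta>
      else if n > 0 then sqrt (2 / \<beta>) * cos (freq \<beta> n * \<tau>)
      else sqrt (2 / \<beta>) * sin (freq \<beta> n * \<tau>))"

text \<open>The operator \<open>(-m \<Delta> + 1)\<inverse>\<close> on \<open>L\<^sup>2([0,\<beta>])\<close>, \<open>\<Delta>\<close> being the periodic Laplacian, given by its
  spectral decomposition. As the eigenvalues are summable and the coefficients and basis functions
  bounded, the \<open>L\<^sup>2\<close>-convergent series also converges absolutely at each point.\<close>

definition cov_op :: "real \<Rightarrow> real \<Rightarrow> (real \<Rightarrow> real) \<Rightarrow> real \<Rightarrow> real" where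
  "cov_op \<beta> m f \<tau> =
     (\<Sum>\<^sub>\<infinity>n. inverse (m * (freq \<beta> n)\<^sup>2 + 1) * L2_inner \<beta> f (trig_basis \<beta> n) * trig_basis \<beta> n \<tau>)"

text \<open>Centered Gaussian measures are specified by their characteristic functional: the law of
  \<open>\<omega> \<mapsto> \<langle>f, \<omega>\<rangle>\<close> is normal with mean \<open>0\<close> and variance \<open>\<langle>f, C f\<rangle>\<close> (degenerate if the latter vanishes)
  for every \<open>f\<close> in \<open>L\<^sup>2([0,\<beta>])\<close>.\<close>

definition gaussian_loop_measure :: "real \<Rightarrow> real \<Rightarrow> (real \<Rightarrow> real) measure \<Rightarrow> bool" where
  "gaussian_loop_measure \<beta> m \<gamma> \<longleftrightarrow>
     prob_space \<gamma> \<and> sets \<gamma> = sets (loop_borel \<beta>) \<and>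
     (\<forall>f. L2_fun \<beta> f \<longrightarrow>
        (LINT \<omega>|\<gamma>. iexp (L2_inner \<beta> f \<omega>)) =
          complex_of_real (exp (- (1/2) * L2_inner \<beta> f (cov_op \<beta> m f))))"

definition quantum_energy ::
  "(real \<Rightarrow> real) \<Rightarrow> (real \<Rightarrow> real) \<Rightarrow> int ^ 'd \<Rightarrow> int ^ 'd \<Rightarrow> real \<Rightarrow> (int ^ 'd \<Rightarrow> real \<Rightarrow> real) \<Rightarrow> real"
where
  "quantum_energy J U k0 k1 \<beta> \<omega> =
     (\<Sum>j\<in>box_lattice k0 k1. LBINT \<tau>:{0..\<beta>}. U (\<omega> j \<tau>)) +
     1/2 * (\<Sum>j\<in>box_lattice k0 k1. \<Sum>k\<in>box_lattice k0 k1.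
        J (periodic_dist k0 k1 j k) * (LBINT \<tau>:{0..\<beta>}. \<omega> j \<tau> * \<omega> k \<tau>))"

text \<open>The loop space being separable, the product of its Borel \<open>\<sigma>\<close>-algebras is the Borel
  \<open>\<sigma>\<close>-algebra of the product topology.\<close>

definition quantum_gibbs ::
  "(real \<Rightarrow> real) \<Rightarrow> (real \<Rightarrow> real) \<Rightarrow> int ^ 'd \<Rightarrow> int ^ 'd \<Rightarrow> real \<Rightarrow> (real \<Rightarrow> real) measure
     \<Rightarrow> (int ^ 'd \<Rightarrow> real \<Rightarrow> real) measure"
where
  "quantum_gibbs J U k0 k1 \<beta> \<gamma> =
     (let \<gamma>\<Lambda> = PiM (box_lattice k0 k1) (\<lambda>_. \<gamma>);
          Z = (LINT \<omega>|\<gamma>\<Lambda>. exp (- quantum_energy J U k0 k1 \<beta> \<omega>))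
      in density \<gamma>\<Lambda> (\<lambda>\<omega>. ennreal (1 / Z * exp (- quantum_energy J U k0 k1 \<beta> \<omega>))))"

definition classical_energy ::
  "(real \<Rightarrow> real) \<Rightarrow> (real \<Rightarrow> real) \<Rightarrow> int ^ 'd \<Rightarrow> int ^ 'd \<Rightarrow> (int ^ 'd \<Rightarrow> real) \<Rightarrow> real"
where
  "classical_energy J U k0 k1 x =
     (\<Sum>j\<in>box_lattice k0 k1. U (x j)) +
     1/2 * (\<Sum>j\<in>box_lattice k0 k1. \<Sum>k\<in>box_lattice k0 k1.
        J (periodic_dist k0 k1 j k) * x j * x k)"

definition classical_reference :: "int ^ 'd \<Rightarrow> int ^ 'd \<Rightarrow> real \<Rightarrow> (int ^ 'd \<Rightarrow> real) measure" where
  "classical_reference k0 k1 \<beta> =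
     PiM (box_lattice k0 k1)
       (\<lambda>_. density lborel (\<lambda>x. ennreal (sqrt (\<beta> / (2 * pi)) * exp (- \<beta> * x\<^sup>2 / 2))))"

definition classical_gibbs ::
  "(real \<Rightarrow> real) \<Rightarrow> (real \<Rightarrow> real) \<Rightarrow> int ^ 'd \<Rightarrow> int ^ 'd \<Rightarrow> real \<Rightarrow> (int ^ 'd \<Rightarrow> real) measure"
where
  "classical_gibbs J U k0 k1 \<beta> =
     (let R = classical_reference k0 k1 \<beta>;
          Y = (LINT x|R. exp (- \<beta> * classical_energy J U k0 k1 x))
      in density R (\<lambda>x. ennreal (1 / Y * exp (- \<beta> * classical_energy J U k0 k1 x))))"

definition quantum_order ::
  "(real \<Rightarrow> real) \<Rightarrow> (real \<Rightarrow> real) \<Rightarrow> int ^ 'd \<Rightarrow> int ^ 'd \<Rightarrow> real \<Rightarrow> (real \<Rightarrow> real) measure \<Rightarrow> real"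
where
  "quantum_order J U k0 k1 \<beta> \<gamma> =
     (LINT \<omega>|quantum_gibbs J U k0 k1 \<beta> \<gamma>.
        (1 / (\<beta> * real (card (box_lattice k0 k1))) *
         (LBINT \<tau>:{0..\<beta>}. \<Sum>j\<in>box_lattice k0 k1. \<omega> j \<tau>))\<^sup>2)"

definition classical_order ::
  "(real \<Rightarrow> real) \<Rightarrow> (real \<Rightarrow> real) \<Rightarrow> int ^ 'd \<Rightarrow> int ^ 'd \<Rightarrow> real \<Rightarrow> real"
where
  "classical_order J U k0 k1 \<beta> =
     (LINT x|classical_gibbs J U k0 k1 \<beta>.
        (1 / real (card (box_lattice k0 k1)) * (\<Sum>j\<in>box_lattice k0 k1. x j))\<^sup>2)"

end

theory Submission
  imports Defs
begin

text \<open>For every mass the time average of a loop is exactly \<open>N(0, 1 / \<beta>)\<close> distributed, which is the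
  one-site classical reference measure. The difference of two averages over nested dyadic intervals of
  length about \<open>l\<close> is a centered Gaussian of variance at most \<open>C * sqrt l / m\<close>; chaining over the dyadic scales shows
  that a loop is uniformly close to its average, with probability tending to \<open>1\<close> as \<open>m\<close> grows. The energy of
  a path is the time integral of the classical energy, so on this event the quantum weight is close to
  the classical weight of the vector of averages.

  On the complement, both weights are dominated by \<open>exp (\<kappa> / 2 * S)\<close> for some \<open>\<kappa> < 1\<close>, where \<open>S\<close> is the squared
  \<open>L\<^sup>2\<close> norm, because the periodised couplings at a site sum to at most \<open>c < ct + 1\<close>. By
  Jensen's inequality for Riemann sums and Fatou's lemma such moments are bounded uniformly in large \<open>m\<close>,
  since the variance of a loop at a point tends to \<open>1 / \<beta>\<close>.\<close>

subsection \<open>Loops and dyadic Riemann sums\<close>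

text \<open>The Gaussian measure is known only through the laws of single L2 functionals, and point
  evaluations are not among them. Probabilistic estimates are therefore made for interval averages,
  whose test functions are indicators, and carried to points by continuity of the loops. The mass
  enters through the spectrum alone: the constant mode has eigenvalue 1 for every \<open>m\<close>,
  every other mode \<open>q\<close> at most 1 / (m q^2). So the mean keeps its law, while bounded
  test functions orthogonal to the constants have variance of order 1 / m.

  As the vector of means has exactly the classical reference law, the classical integral can be
  pulled back to the loop space of the same \<open>m\<close>, and two integrands are compared on one
  probability space. \<open>U\<close> has no upper growth bound, so the energy has only local moduli
  of continuity. Hence the split by the size of S: for large S a slightly larger exponent absorbs
  both weights, for bounded S the energy is uniformly continuous on a ball. The squared order
  parameter and the partition function are two instances of the same limit.\<close>

lemma mspace_loop_metricD:
  assumes "\<omega> \<in> mspace (loop_metric \<beta>)"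
  shows "continuous_on {0..\<beta>} \<omega>" and "\<omega> 0 = \<omega> \<beta>"
  using assms by (auto simp: loop_metric_def)

lemma space_loop_borel: "space (loop_borel \<beta>) = mspace (loop_metric \<beta>)"
  unfolding loop_borel_def by (rule space_measure_of) (use openin_subset in fastforce)

text \<open>Evaluation at a time is 1-Lipschitz for the sup metric, so preimages of open sets are
  open. Measurability of averages and energies is later reduced to this.\<close>

lemma loop_eval_measurable:
  assumes "t \<in> {0..\<beta>}"
  shows "(\<lambda>\<omega>. \<omega> t) \<in> borel_measurable (loop_borel \<beta>)"
proof (rule borel_measurableI)
  fix S :: "real set" assume "open S"
  let ?m = "loop_metric \<beta>" and ?C = "cfunspace (top_of_set {0..\<beta>}) euclidean_metric :: (real \<Rightarrow> real) metric"
  have sets: "sets (loop_borel \<beta>) = sigma_sets (mspace ?m) {A. openin (mtopology_of ?m) A}"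
    unfolding loop_borel_def by (rule sets_measure_of) (use openin_subset in fastforce)
  let ?A = "(\<lambda>\<omega>. \<omega> t) -` S \<inter> mspace ?m"
  have "openin (mtopology_of ?m) ?A"
    unfolding mtopology_of_def
  proof (subst Metric_space.openin_mtopology[OF Metric_space_mspace_mdist], intro conjI allI impI)
    fix \<omega> assume w: "\<omega> \<in> ?A"
    then obtain e where e: "e > 0" "\<And>y. dist y (\<omega> t) < e \<Longrightarrow> y \<in> S"
      using \<open>open S\<close> unfolding open_dist by auto
    have "Metric_space.mball (mspace ?m) (mdist ?m) \<omega> e \<subseteq> ?A"
    proof
      fix \<eta> assume "\<eta> \<in> Metric_space.mball (mspace ?m) (mdist ?m) \<omega> e"
      then have \<eta>: "\<eta> \<in> mspace ?m" "mdist ?m \<omega> \<eta> < e"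
        by (auto simp: Metric_space.in_mball[OF Metric_space_mspace_mdist])
      have "dist (\<omega> t) (\<eta> t) \<le> mdist ?C \<omega> \<eta>"
        using mdist_cfunspace_imp_mdist_le[of \<omega> "top_of_set {0..\<beta>}" euclidean_metric \<eta> _ t] \<eta>(1) w assms
        by (auto simp: loop_metric_def)
      also have "\<dots> < e" using \<eta>(2) by (simp add: loop_metric_def)
      finally show "\<eta> \<in> ?A" using e(2)[of "\<eta> t"] \<eta>(1) by (simp add: dist_commute)
    qed
    then show "\<exists>r>0. Metric_space.mball (mspace ?m) (mdist ?m) \<omega> r \<subseteq> ?A" using e(1) by blast
  qed auto
  then show "(\<lambda>\<omega>. \<omega> t) -` S \<inter> space (loop_borel \<beta>) \<in> sets (loop_borel \<beta>)"
    unfolding space_loop_borel sets by (intro sigma_sets.Basic) simp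
qed

text \<open>Left-endpoint Riemann sums. They involve finitely many point evaluations, which makes
  integrals measurable in the path and gives Jensen's inequality something finite to act on. The
  sample points stay below \<open>b\<close> when \<open>a < b\<close>.\<close>

definition dyadic_sum :: "real \<Rightarrow> real \<Rightarrow> (real \<Rightarrow> real) \<Rightarrow> nat \<Rightarrow> real" where
  "dyadic_sum a b F k = (b - a) / 2 ^ k * (\<Sum>i<2 ^ k. F (a + real i * ((b - a) / 2 ^ k)))"

lemma integral_consecutive:
  fixes F :: "real \<Rightarrow> real"
  assumes "l \<ge> 0" "F integrable_on {a..a + real n * l}"
  shows "integral {a..a + real n * l} F = (\<Sum>i<n. integral {a + real i * l..a + real (Suc i) * l} F)"
  using assms
proof (induction n)
  case (Suc n)
  have "F integrable_on {a..a + real n * l}"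
    by (rule integrable_on_subinterval[OF Suc.prems(2)]) (use Suc.prems(1) in \<open>auto simp: algebra_simps\<close>)
  moreover have "integral {a..a + real n * l} F + integral {a + real n * l..a + real (Suc n) * l} F
      = integral {a..a + real (Suc n) * l} F"
    by (rule Henstock_Kurzweil_Integration.integral_combine) (use Suc.prems in \<open>auto simp: algebra_simps\<close>)
  ultimately show ?case using Suc by simp
qed simp

lemma dyadic_sum_LIMSEQ:
  fixes F :: "real \<Rightarrow> real"
  assumes "a < b" "continuous_on {a..b} F"
  shows "dyadic_sum a b F \<longlonglongrightarrow> integral {a..b} F"
proof (rule LIMSEQ_I)
  fix e :: real assume "e > 0"
  \<comment> \<open>The errors of the \<open>2 ^ k\<close> cells will add up to
    \<open>(b - a) * e'\<close>, that is \<open>e / 2\<close>.\<close>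
  define e' where "e' = e / (2 * (b - a))"
  have "e' > 0" using \<open>e > 0\<close> assms by (simp add: e'_def)
  have "uniformly_continuous_on {a..b} F"
    by (rule compact_uniformly_continuous) (use assms in auto)
  then obtain d where d: "d > 0" "\<And>x y. x \<in> {a..b} \<Longrightarrow> y \<in> {a..b} \<Longrightarrow> dist y x < d \<Longrightarrow> dist (F y) (F x) < e'"
    using \<open>e' > 0\<close> unfolding uniformly_continuous_on_def by metis
  have "(\<lambda>k. (b - a) / 2 ^ k) \<longlonglongrightarrow> 0" by real_asymp
  then obtain K where K: "\<And>k. k \<ge> K \<Longrightarrow> norm ((b - a) / 2 ^ k - 0) < d"
    using LIMSEQ_D[OF _ \<open>d > 0\<close>] by blast
  show "\<exists>no. \<forall>n\<ge>no. norm (dyadic_sum a b F n - integral {a..b} F) < e"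
  proof (intro exI allI impI)
    fix k assume "k \<ge> K"
    define l where "l = (b - a) / 2 ^ k"
    have l: "l > 0" "l < d" "real (2 ^ k) * l = b - a"
      using K[OF \<open>k \<ge> K\<close>] assms by (auto simp: l_def)
    have int: "F integrable_on {a..b}" by (rule integrable_continuous_real[OF assms(2)])
    have sub: "{a + real i * l..a + real (Suc i) * l} \<subseteq> {a..b}" if "i < 2 ^ k" for i
    proof -
      have "real (Suc i) * l \<le> real (2 ^ k) * l"
        using that l(1) by (intro mult_right_mono) (auto simp only: of_nat_le_iff Suc_le_eq less_imp_le)
      then have "a + real (Suc i) * l \<le> b" using l(3) by linarith
      then show ?thesis using l(1) by (auto simp del: of_nat_Suc)
    qed
    have "integral {a..b} F = (\<Sum>i<2 ^ k. integral {a + real i * l..a + real (Suc i) * l} F)"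
      using integral_consecutive[of l F a "2 ^ k"] int l by simp
    moreover have "dyadic_sum a b F k = (\<Sum>i<2 ^ k. integral {a + real i * l..a + real (Suc i) * l} (\<lambda>_. F (a + real i * l)))"
      using l(1) by (simp add: dyadic_sum_def sum_distrib_left l_def[symmetric] algebra_simps)
    ultimately have "\<bar>dyadic_sum a b F k - integral {a..b} F\<bar> =
      \<bar>\<Sum>i<2 ^ k. integral {a + real i * l..a + real (Suc i) * l} (\<lambda>_. F (a + real i * l)) -
        integral {a + real i * l..a + real (Suc i) * l} F\<bar>"
      by (simp add: sum_subtractf)
    also have "\<dots> \<le> (\<Sum>i<(2::nat) ^ k. l * e')"
    proof (rule sum_abs[THEN order_trans], rule sum_mono)
      fix i :: nat assume "i \<in> {..<2 ^ k}"
      then have i: "i < 2 ^ k" by simp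
      let ?I = "{a + real i * l..a + real (Suc i) * l}"
      have intI: "F integrable_on ?I" by (rule integrable_on_subinterval[OF int sub[OF i]])
      have "integral ?I (\<lambda>_. F (a + real i * l)) - integral ?I F = integral ?I (\<lambda>s. F (a + real i * l) - F s)"
        by (rule Henstock_Kurzweil_Integration.integral_diff[symmetric]) (use intI in auto)
      also have "norm \<dots> \<le> e' * (a + real (Suc i) * l - (a + real i * l))"
      proof (rule integral_bound)
        fix t assume t: "t \<in> ?I"
        have "dist (F (a + real i * l)) (F t) < e'"
        proof (rule d(2))
          show "t \<in> {a..b}" using t sub[OF i] by blast
          show "a + real i * l \<in> {a..b}" using sub[OF i] l(1) by (auto simp: algebra_simps)
          show "dist (a + real i * l) t < d" using t l by (auto simp: dist_real_def algebra_simps)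
        qed
        then show "norm (F (a + real i * l) - F t) \<le> e'" by (simp add: dist_norm)
      next
        show "continuous_on ?I (\<lambda>s. F (a + real i * l) - F s)"
          by (intro continuous_intros continuous_on_subset[OF assms(2) sub[OF i]])
      qed (use l in \<open>auto simp: algebra_simps\<close>)
      also have "\<dots> = l * e'" by (simp add: algebra_simps)
      finally show "\<bar>integral ?I (\<lambda>_. F (a + real i * l)) - integral ?I F\<bar> \<le> l * e'" by simp
    qed
    also have "\<dots> = (b - a) * e'" using l(3) by (simp add: mult.assoc[symmetric])
    also have "\<dots> < e" using \<open>e > 0\<close> assms(1) by (simp add: e'_def field_simps)
    finally show "norm (dyadic_sum a b F k - integral {a..b} F) < e" by simp
  qed
qed

lemma dyadic_point_in:
  assumes "i < 2 ^ k" "a \<le> b"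
  shows "a + real i * ((b - a) / 2 ^ k) \<in> {a..b}"
proof -
  have "real i \<le> real (2 ^ k)" using assms(1) by (simp only: of_nat_le_iff)
  then have "real i * ((b - a) / 2 ^ k) \<le> real (2 ^ k) * ((b - a) / 2 ^ k)"
    using assms by (intro mult_right_mono) auto
  then show ?thesis using assms by auto
qed

text \<open>Continuity of each path takes the place of joint measurability in path and time: the
  integral is a pointwise limit of measurable Riemann sums.\<close>

lemma borel_measurable_integral_eval:
  fixes G :: "'w \<Rightarrow> real \<Rightarrow> real"
  assumes "a < b"
    and "\<And>w. w \<in> space M \<Longrightarrow> continuous_on {a..b} (G w)"
    and "\<And>t. t \<in> {a..b} \<Longrightarrow> (\<lambda>w. G w t) \<in> borel_measurable M"
  shows "(\<lambda>w. integral {a..b} (G w)) \<in> borel_measurable M"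
proof (rule borel_measurable_LIMSEQ_real[where u = "\<lambda>k w. dyadic_sum a b (G w) k"])
  fix k
  show "(\<lambda>w. dyadic_sum a b (G w) k) \<in> borel_measurable M"
    unfolding dyadic_sum_def
    using dyadic_point_in[of _ k a b] assms(1)
    by (intro borel_measurable_times borel_measurable_const borel_measurable_sum assms(3)) auto
qed (use dyadic_sum_LIMSEQ assms in blast)

subsection \<open>Laws determined by a Gaussian characteristic functional\<close>

lemma char_scaled_std_normal:
  "char (distr std_normal_distribution borel (\<lambda>z. \<sigma> * z)) u = complex_of_real (exp (- (\<sigma>\<^sup>2 * u\<^sup>2) / 2))"
proof -
  have "char (distr std_normal_distribution borel (\<lambda>z. \<sigma> * z)) u = char std_normal_distribution (u * \<sigma>)"
    unfolding char_def by (subst integral_distr) (auto simp: mult.assoc)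
  then show ?thesis by (simp add: char_std_normal_distribution power_mult_distrib mult.commute)
qed

text \<open>Levy's uniqueness theorem. Writing the law as an image of the standard normal includes
  the degenerate case \<open>v = 0\<close>, which has no density.\<close>

lemma distr_eq_scaled_std_normal:
  assumes "prob_space M" and Y: "Y \<in> borel_measurable M" and "v \<ge> 0"
    and "\<And>u. (LINT \<omega>|M. iexp (u * Y \<omega>)) = complex_of_real (exp (- (1/2) * (u\<^sup>2 * v)))"
  shows "distr M borel Y = distr std_normal_distribution borel (\<lambda>z. sqrt v * z)"
proof (rule Levy_uniqueness)
  interpret prob_space M by fact
  interpret N: real_distribution std_normal_distribution by (rule real_dist_normal_dist)
  show "real_distribution (distr M borel Y)"
    using real_distribution_distr[OF Y] by simp
  have "(\<lambda>z. sqrt v * z) \<in> borel_measurable std_normal_distribution" by simp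
  from N.real_distribution_distr[OF this]
  show "real_distribution (distr std_normal_distribution borel (\<lambda>z. sqrt v * z))" .
  show "char (distr M borel Y) = char (distr std_normal_distribution borel (\<lambda>z. sqrt v * z))"
  proof
    fix u
    have "char (distr M borel Y) u = (LINT \<omega>|M. iexp (u * Y \<omega>))"
      unfolding char_def using Y by (subst integral_distr) auto
    then show "char (distr M borel Y) u = char (distr std_normal_distribution borel (\<lambda>z. sqrt v * z)) u"
      unfolding assms(4) char_scaled_std_normal using assms(3) by (simp add: mult.commute)
  qed
qed

lemma nn_integral_normal_density:
  assumes "\<sigma> > 0"
  shows "(\<integral>\<^sup>+x. ennreal (normal_density \<mu> \<sigma> x) \<partial>lborel) = 1"
  using prob_space.emeasure_space_1[OF prob_space_normal_density[OF assms, of \<mu>]]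
  by (simp add: emeasure_density)

text \<open>The exact moment is 1 / sqrt (1 - 2 a v) as long as 2 a v < 1; the parameter \<theta>
  makes the bound uniform in the variance. The integrand is dominated by a multiple of the normal
  density of variance 1 / (1 - \<theta>).\<close>

lemma nn_integral_exp_square_scaled_std_normal:
  assumes D: "distr M borel Y = distr std_normal_distribution borel (\<lambda>z. sqrt v * z)"
    and Y: "Y \<in> borel_measurable M" and "v \<ge> 0" and "2 * a * v \<le> \<theta>" and "\<theta> < 1"
  shows "(\<integral>\<^sup>+\<omega>. ennreal (exp (a * (Y \<omega>)\<^sup>2)) \<partial>M) \<le> ennreal (1 / sqrt (1 - \<theta>))"
proof -
  define s where "s = 1 / sqrt (1 - \<theta>)"
  have s: "s > 0" "s\<^sup>2 = 1 / (1 - \<theta>)" using assms by (auto simp: s_def power_divide)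
  have "(\<integral>\<^sup>+\<omega>. ennreal (exp (a * (Y \<omega>)\<^sup>2)) \<partial>M) = (\<integral>\<^sup>+y. ennreal (exp (a * y\<^sup>2)) \<partial>distr M borel Y)"
    using Y by (subst nn_integral_distr) auto
  also have "\<dots> = (\<integral>\<^sup>+z. ennreal (std_normal_density z) * ennreal (exp (a * (sqrt v * z)\<^sup>2)) \<partial>lborel)"
    unfolding D by (subst nn_integral_distr) (auto simp: nn_integral_density)
  also have "\<dots> \<le> (\<integral>\<^sup>+z. ennreal s * ennreal (normal_density 0 s z) \<partial>lborel)"
  proof (rule nn_integral_mono)
    fix z :: real
    have "a * v * z\<^sup>2 \<le> \<theta> / 2 * z\<^sup>2" using assms by (intro mult_right_mono) auto
    then have "exp (- z\<^sup>2 / 2 + a * v * z\<^sup>2) \<le> exp (- (1 - \<theta>) * z\<^sup>2 / 2)" by (simp add: algebra_simps)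
    then have "std_normal_density z * exp (a * (sqrt v * z)\<^sup>2) \<le> 1 / sqrt (2 * pi) * exp (- (1 - \<theta>) * z\<^sup>2 / 2)"
      using assms(3) by (simp add: std_normal_density_def exp_add[symmetric] power_mult_distrib
          mult.assoc divide_right_mono)
    also have "\<dots> = s * normal_density 0 s z"
    proof -
      have "sqrt (2 * pi * s\<^sup>2) = sqrt (2 * pi) * s" using s(1) by (simp add: real_sqrt_mult)
      moreover have "- z\<^sup>2 / (2 * s\<^sup>2) = - (1 - \<theta>) * z\<^sup>2 / 2" using assms(5) by (simp add: s(2) field_simps)
      ultimately show ?thesis using s(1) by (simp add: normal_density_def)
    qed
    finally show "ennreal (std_normal_density z) * ennreal (exp (a * (sqrt v * z)\<^sup>2))
        \<le> ennreal s * ennreal (normal_density 0 s z)"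
      using s by (simp add: ennreal_mult'[symmetric] ennreal_leI)
  qed
  also have "\<dots> = ennreal s" using s by (simp add: nn_integral_cmult nn_integral_normal_density)
  finally show ?thesis by (simp add: s_def)
qed

text \<open>Exponential Chebyshev inequality for the square. The bound is in terms of some positive
  \<open>V\<close> above the variance, since \<open>v\<close> itself may vanish.\<close>

lemma scaled_std_normal_tail:
  assumes "prob_space M" and D: "distr M borel Y = distr std_normal_distribution borel (\<lambda>z. sqrt v * z)"
    and Y: "Y \<in> borel_measurable M" and "v \<ge> 0" and "v \<le> V" and "V > 0" and "\<delta> \<ge> 0"
  shows "measure M {\<omega> \<in> space M. \<delta> < \<bar>Y \<omega>\<bar>} \<le> sqrt 2 * exp (- \<delta>\<^sup>2 / (4 * V))"
proof -
  interpret prob_space M by fact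
  \<comment> \<open>With this rate 2 a v is at most 1/2, so the exponential moment is at most sqrt
    2.\<close>
  let ?a = "1 / (4 * V)"
  have "emeasure M {\<omega> \<in> space M. \<delta> < \<bar>Y \<omega>\<bar>} = (\<integral>\<^sup>+\<omega>. indicator {\<omega> \<in> space M. \<delta> < \<bar>Y \<omega>\<bar>} \<omega> \<partial>M)"
    using Y by (intro nn_integral_indicator[symmetric]) measurable
  also have "\<dots> \<le> (\<integral>\<^sup>+\<omega>. ennreal (exp (- ?a * \<delta>\<^sup>2)) * ennreal (exp (?a * (Y \<omega>)\<^sup>2)) \<partial>M)"
  proof (rule nn_integral_mono)
    fix \<omega>
    have "1 \<le> exp (- ?a * \<delta>\<^sup>2) * exp (?a * (Y \<omega>)\<^sup>2)" if "\<delta> < \<bar>Y \<omega>\<bar>"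
    proof -
      have "\<delta>\<^sup>2 \<le> (Y \<omega>)\<^sup>2" using power_mono[of \<delta> "\<bar>Y \<omega>\<bar>" 2] that assms by simp
      then have "0 \<le> ?a * ((Y \<omega>)\<^sup>2 - \<delta>\<^sup>2)" using assms by simp
      then have "1 \<le> exp (?a * ((Y \<omega>)\<^sup>2 - \<delta>\<^sup>2))" by simp
      then show ?thesis by (simp add: exp_add[symmetric] algebra_simps)
    qed
    then show "indicator {\<omega> \<in> space M. \<delta> < \<bar>Y \<omega>\<bar>} \<omega> \<le> ennreal (exp (- ?a * \<delta>\<^sup>2)) * ennreal (exp (?a * (Y \<omega>)\<^sup>2))"
      by (auto simp: indicator_def ennreal_mult'[symmetric] simp del: ennreal_1 intro!: ennreal_leI simp: ennreal_1[symmetric])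
  qed
  also have "\<dots> = ennreal (exp (- ?a * \<delta>\<^sup>2)) * (\<integral>\<^sup>+\<omega>. ennreal (exp (?a * (Y \<omega>)\<^sup>2)) \<partial>M)"
    using Y by (intro nn_integral_cmult) measurable
  also have "\<dots> \<le> ennreal (exp (- ?a * \<delta>\<^sup>2)) * ennreal (1 / sqrt (1 - 1 / 2))"
    by (intro mult_left_mono nn_integral_exp_square_scaled_std_normal[OF D Y \<open>v \<ge> 0\<close>])
      (use assms in \<open>auto simp: field_simps\<close>)
  also have "\<dots> = ennreal (sqrt 2 * exp (- \<delta>\<^sup>2 / (4 * V)))"
    by (simp add: ennreal_mult'[symmetric] real_sqrt_divide mult.commute)
  finally show ?thesis by (simp add: emeasure_eq_measure)
qed

subsection \<open>The covariance form\<close>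

text \<open>Spectral majorants depend on the frequency only through its absolute value. This turns
  sums over all integers into series, with the zero mode kept apart.\<close>

lemma has_sum_int_nat_abs:
  fixes g :: "nat \<Rightarrow> real"
  assumes "summable (\<lambda>n. g (Suc n))" and "\<And>n. g (Suc n) \<ge> 0"
  shows "((\<lambda>n::int. g (nat \<bar>n\<bar>)) has_sum (g 0 + 2 * (\<Sum>n. g (Suc n)))) UNIV"
proof -
  let ?G = "\<lambda>n::int. g (nat \<bar>n\<bar>)" and ?S = "\<Sum>n. g (Suc n)"
  have [simp]: "nat (1 + int n) = Suc n" "nat (int n + 1) = Suc n" for n by simp_all
  have h: "((\<lambda>n. g (Suc n)) has_sum ?S) (UNIV::nat set)"
    using assms by (intro norm_summable_imp_has_sum) (auto simp: summable_sums)
  have "(?G has_sum ?S) (range (\<lambda>n. int (Suc n)))"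
    by (subst has_sum_reindex) (use h in \<open>auto simp: inj_def o_def\<close>)
  moreover have "(?G has_sum ?S) (range (\<lambda>n. - int (Suc n)))"
    by (subst has_sum_reindex) (use h in \<open>auto simp: inj_def o_def\<close>)
  moreover have "range (\<lambda>n. int (Suc n)) \<inter> range (\<lambda>n. - int (Suc n)) = {}" by auto
  ultimately have 1: "(?G has_sum (?S + ?S)) (range (\<lambda>n. int (Suc n)) \<union> range (\<lambda>n. - int (Suc n)))"
    by (rule has_sum_Un_disjoint)
  have 2: "(?G has_sum (g 0)) {0}" by (rule has_sum_finiteI) auto
  have 3: "UNIV = {0} \<union> (range (\<lambda>n. int (Suc n)) \<union> range (\<lambda>n. - int (Suc n)))"
  proof -
    have "n \<in> range (\<lambda>n. - int (Suc n))" if "n < 0" for n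
      using that by (intro image_eqI[where x = "nat (- n - 1)"]) auto
    moreover have "n \<in> range (\<lambda>n. int (Suc n))" if "n > 0" for n
      using that by (intro image_eqI[where x = "nat (n - 1)"]) auto
    ultimately show ?thesis by (auto simp: image_iff) (metis linorder_neqE_linordered_idom rangeE)
  qed
  have "(?G has_sum (g 0 + (?S + ?S))) ({0} \<union> (range (\<lambda>n. int (Suc n)) \<union> range (\<lambda>n. - int (Suc n))))"
    by (rule has_sum_Un_disjoint[OF 2 1]) auto
  then show ?thesis unfolding 3[symmetric] by simp
qed

lemma trig_basis_measurable [measurable]: "trig_basis \<beta> n \<in> borel_measurable borel"
proof -
  have "trig_basis \<beta> n = (\<lambda>\<tau>. if n = 0 then 1 / sqrt \<beta>
      else if n > 0 then sqrt (2 / \<beta>) * cos (freq \<beta> n * \<tau>) else sqrt (2 / \<beta>) * sin (freq \<beta> n * \<tau>))"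
    by (rule ext) (rule trig_basis_def)
  then show ?thesis by simp
qed

lemma abs_trig_basis_le:
  assumes "\<beta> > 0"
  shows "\<bar>trig_basis \<beta> n \<tau>\<bar> \<le> sqrt (2 / \<beta>)"
proof -
  have "sqrt (2 / \<beta>) * \<bar>sin x\<bar> \<le> sqrt (2 / \<beta>)" "sqrt (2 / \<beta>) * \<bar>cos x\<bar> \<le> sqrt (2 / \<beta>)" for x :: real
    using assms by (auto intro!: mult_left_le)
  moreover have "1 / sqrt \<beta> \<le> sqrt (2 / \<beta>)"
    using assms by (simp add: real_sqrt_divide divide_right_mono)
  ultimately show ?thesis using assms by (auto simp: trig_basis_def abs_mult)
qed

lemma integrable_mult_indicator_Icc: "integrable lborel (\<lambda>\<tau>::real. K * indicator {a..b} \<tau> :: real)"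
  by (intro integrable_mult_right integrable_real_indicator) (auto simp: emeasure_lborel_Icc_eq)

lemma set_integrable_bounded:
  fixes h :: "real \<Rightarrow> real"
  assumes "h \<in> borel_measurable borel" and "\<And>\<tau>. \<tau> \<in> {a..b} \<Longrightarrow> \<bar>h \<tau>\<bar> \<le> K"
  shows "set_integrable lborel {a..b} h"
proof -
  have "integrable lborel (\<lambda>\<tau>. K * indicator {a..b} \<tau>)" by (rule integrable_mult_indicator_Icc)
  then show ?thesis unfolding set_integrable_def
    by (rule Bochner_Integration.integrable_bound) (use assms in \<open>auto simp: indicator_def\<close>, fastforce)
qed

lemma abs_set_integral_le:
  fixes h :: "real \<Rightarrow> real"
  assumes "h \<in> borel_measurable borel" and "\<And>\<tau>. \<tau> \<in> {a..b} \<Longrightarrow> \<bar>h \<tau>\<bar> \<le> K" and "a \<le> b"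
  shows "\<bar>LBINT \<tau>:{a..b}. h \<tau>\<bar> \<le> K * (b - a)"
proof -
  have "\<bar>LBINT \<tau>:{a..b}. h \<tau>\<bar> \<le> (LBINT \<tau>:{a..b}. \<bar>h \<tau>\<bar>)"
    using set_integral_norm_bound[OF set_integrable_bounded[OF assms(1,2)]] by simp
  also have "\<dots> \<le> (LBINT \<tau>:{a..b}. K)"
    using assms by (intro set_integral_mono set_integrable_bounded[where K = K] set_integrable_bounded[where K = "\<bar>K\<bar>"]) auto
  also have "\<dots> = K * (b - a)" using assms(3) by (simp add: set_lebesgue_integral_def)
  finally show ?thesis .
qed

text \<open>Dropping the 1 exposes the factor 1 / m, the source of all concentration. It is possible
  only away from the zero mode.\<close>

lemma eigenvalue_le:
  assumes "m > 0" "\<beta> > 0" "n \<noteq> 0"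
  shows "inverse (m * (freq \<beta> n)\<^sup>2 + 1) \<le> 1 / (m * (freq \<beta> n)\<^sup>2)"
  using assms by (auto simp: freq_def inverse_eq_divide intro!: divide_left_mono mult_pos_pos add_pos_pos)

lemma freq_square: "(freq \<beta> n)\<^sup>2 = (2 * pi / \<beta>)\<^sup>2 * (real (nat \<bar>n\<bar>))\<^sup>2"
  by (simp add: freq_def power_mult_distrib power_divide)

lemma eigenvalue_summable:
  assumes "m > 0" "\<beta> > 0"
  shows "(\<lambda>n. inverse (m * (freq \<beta> n)\<^sup>2 + 1)) summable_on UNIV"
proof (rule summable_on_comparison_test[OF has_sum_imp_summable[OF has_sum_int_nat_abs]])
  let ?g = "\<lambda>n. if n = 0 then 1 else \<beta>\<^sup>2 / ((2 * pi)\<^sup>2 * m) * (1 / (real n)\<^sup>2)"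
  have "summable (\<lambda>n. \<beta>\<^sup>2 / ((2 * pi)\<^sup>2 * m) * (1 / (real (Suc n))\<^sup>2))"
    by (intro summable_mult summable_Suc_iff[THEN iffD2]) (use inverse_power_summable[of 2, where 'a = real] in \<open>simp add: inverse_eq_divide\<close>)
  then show "summable (\<lambda>n. ?g (Suc n))" by simp
  show "inverse (m * (freq \<beta> n)\<^sup>2 + 1) \<le> ?g (nat \<bar>n\<bar>)" for n
    using eigenvalue_le[OF assms, of n] by (auto simp: freq_square freq_def power_divide field_simps)
qed (use assms in \<open>auto simp: freq_square\<close>)

text \<open>The quadratic form of the covariance is diagonal in the trigonometric basis. Sum and
  integral may be exchanged because the eigenvalues are summable while the coefficients and the
  basis functions are uniformly bounded.\<close>

lemma variance_eq_infsum:
  assumes "\<beta> > 0" "m > 0" and f [measurable]: "f \<in> borel_measurable borel" and B: "\<And>\<tau>. \<bar>f \<tau>\<bar> \<le> B"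
  shows "L2_inner \<beta> f (cov_op \<beta> m f) =
      (\<Sum>\<^sub>\<infinity>n. inverse (m * (freq \<beta> n)\<^sup>2 + 1) * (L2_inner \<beta> f (trig_basis \<beta> n))\<^sup>2)"
    and "(\<lambda>n. inverse (m * (freq \<beta> n)\<^sup>2 + 1) * (L2_inner \<beta> f (trig_basis \<beta> n))\<^sup>2) summable_on UNIV"
proof -
  define lam where "lam n = inverse (m * (freq \<beta> n)\<^sup>2 + 1)" for n
  define c where "c n = L2_inner \<beta> f (trig_basis \<beta> n)" for n
  define s where "s = sqrt (2 / \<beta>)"
  have s: "s \<ge> 0" "\<And>n \<tau>. \<bar>trig_basis \<beta> n \<tau>\<bar> \<le> s"
    using abs_trig_basis_le[OF assms(1)] assms by (auto simp: s_def)
  have "B \<ge> 0" using B[of 0] by simp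
  have lam0: "lam n \<ge> 0" for n using assms by (simp add: lam_def)
  have fphi: "\<bar>f \<tau> * trig_basis \<beta> n \<tau>\<bar> \<le> B * s" for \<tau> n
    unfolding abs_mult using s B \<open>B \<ge> 0\<close> by (intro mult_mono) auto
  have c: "\<bar>c n\<bar> \<le> B * s * \<beta>" for n
    unfolding c_def L2_inner_def
    using abs_set_integral_le[of "\<lambda>\<tau>. f \<tau> * trig_basis \<beta> n \<tau>" 0 \<beta> "B * s"] fphi assms by simp
  have sum_lam: "lam summable_on UNIV"
    unfolding lam_def by (rule eigenvalue_summable) fact+
  \<comment> \<open>The exchange theorem concerns series, so the integers are enumerated; absolute
    summability allows any enumeration.\<close>
  note bij = bij_int_decode
  have "(\<lambda>k. lam (int_decode k)) summable_on UNIV"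
    using summable_on_reindex_bij_betw[OF bij, of lam] sum_lam by simp
  then have lsum: "summable (\<lambda>k. lam (int_decode k))"
    using has_sum_imp_sums[OF has_sum_infsum] sums_summable by blast
  define g where "g k \<tau> = lam (int_decode k) * c (int_decode k) * trig_basis \<beta> (int_decode k) \<tau>" for k \<tau>
  have gb: "\<bar>g k \<tau>\<bar> \<le> lam (int_decode k) * (B * s * \<beta> * s)" for k \<tau>
  proof -
    have "\<bar>g k \<tau>\<bar> = lam (int_decode k) * (\<bar>c (int_decode k)\<bar> * \<bar>trig_basis \<beta> (int_decode k) \<tau>\<bar>)"
      using lam0 by (simp add: g_def abs_mult mult.assoc)
    also have "\<dots> \<le> lam (int_decode k) * (B * s * \<beta> * s)"
      using lam0 c s by (intro mult_left_mono mult_mono) (auto intro: order_trans[OF abs_ge_zero])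
    finally show ?thesis .
  qed
  have gsum: "summable (\<lambda>k. norm (g k \<tau>))" for \<tau>
    by (rule summable_comparison_test'[OF summable_mult2[OF lsum, of "B * s * \<beta> * s"]]) (use gb in auto)
  have cov: "cov_op \<beta> m f \<tau> = (\<Sum>k. g k \<tau>)" for \<tau>
  proof -
    have "cov_op \<beta> m f \<tau> = (\<Sum>\<^sub>\<infinity>k. g k \<tau>)"
      unfolding cov_op_def g_def lam_def c_def
      by (subst infsum_reindex_bij_betw[OF bij, symmetric]) simp
    also have "\<dots> = (\<Sum>k. g k \<tau>)"
      by (intro infsumI norm_summable_imp_has_sum gsum summable_sums summable_norm_cancel)
    finally show ?thesis .
  qed
  define t where "t n = lam n * (c n)\<^sup>2" for n
  have tsum: "summable (\<lambda>k. norm (t (int_decode k)))"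
  proof (rule summable_comparison_test'[OF summable_mult2[OF lsum, of "(B * s * \<beta>)\<^sup>2"]])
    fix k :: nat
    have "(c (int_decode k))\<^sup>2 \<le> (B * s * \<beta>)\<^sup>2"
      using power_mono[OF c, of "int_decode k" 2] by simp
    then show "norm (norm (t (int_decode k))) \<le> lam (int_decode k) * (B * s * \<beta>)\<^sup>2"
      using lam0 by (simp add: t_def mult_left_mono)
  qed
  have thas: "((\<lambda>k. t (int_decode k)) has_sum (\<Sum>k. t (int_decode k))) UNIV"
    by (intro norm_summable_imp_has_sum tsum summable_sums summable_norm_cancel)
  then have thas': "(t has_sum (\<Sum>k. t (int_decode k))) UNIV"
    using has_sum_reindex_bij_betw[OF bij, of t] by simp
  then show "(\<lambda>n. inverse (m * (freq \<beta> n)\<^sup>2 + 1) * (L2_inner \<beta> f (trig_basis \<beta> n))\<^sup>2) summable_on UNIV"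
    unfolding t_def lam_def c_def by (rule has_sum_imp_summable)
  let ?h = "\<lambda>k \<tau>. indicator {0..\<beta>} \<tau> * (f \<tau> * g k \<tau>) :: real"
  have [measurable]: "g k \<in> borel_measurable borel" for k unfolding g_def by measurable
  have hb: "norm (?h k \<tau>) \<le> lam (int_decode k) * (B * s * \<beta> * s) * B * indicator {0..\<beta>} \<tau>" for k \<tau>
  proof -
    have "\<bar>f \<tau>\<bar> * \<bar>g k \<tau>\<bar> \<le> B * (lam (int_decode k) * (B * s * \<beta> * s))"
      using B gb \<open>B \<ge> 0\<close> by (intro mult_mono) auto
    then show ?thesis by (auto simp: indicator_def abs_mult mult_ac)
  qed
  have hint: "integrable lborel (?h k)" for k
  proof (rule Bochner_Integration.integrable_bound)
    show "integrable lborel (\<lambda>\<tau>. lam (int_decode k) * (B * s * \<beta> * s) * B * indicator {0..\<beta>} \<tau> :: real)"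
      by (rule integrable_mult_indicator_Icc)
    show "AE \<tau> in lborel. norm (?h k \<tau>) \<le> norm (lam (int_decode k) * (B * s * \<beta> * s) * B * indicator {0..\<beta>} \<tau> :: real)"
      using hb by (intro AE_I2) (metis abs_ge_self order_trans real_norm_def)
  qed measurable
  have "L2_inner \<beta> f (cov_op \<beta> m f) = (\<integral>\<tau>. (\<Sum>k. ?h k \<tau>) \<partial>lborel)"
    unfolding L2_inner_def set_lebesgue_integral_def
  proof (rule Bochner_Integration.integral_cong[OF refl])
    fix \<tau>
    have "(\<Sum>k. ?h k \<tau>) = indicator {0..\<beta>} \<tau> * (f \<tau> * (\<Sum>k. g k \<tau>))"
      using gsum by (simp add: suminf_mult summable_mult summable_norm_cancel)
    then show "indicator {0..\<beta>} \<tau> *\<^sub>R (f \<tau> * cov_op \<beta> m f \<tau>) = (\<Sum>k. ?h k \<tau>)" by (simp add: cov)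
  qed
  also have "\<dots> = (\<Sum>k. \<integral>\<tau>. ?h k \<tau> \<partial>lborel)"
  proof (rule integral_suminf[OF hint])
    show "AE \<tau> in lborel. summable (\<lambda>k. norm (?h k \<tau>))"
      using gsum by (intro AE_I2) (simp add: abs_mult summable_mult)
    show "summable (\<lambda>k. \<integral>\<tau>. norm (?h k \<tau>) \<partial>lborel)"
    proof (rule summable_comparison_test'[OF summable_mult2[OF lsum, of "B * s * \<beta> * s * B * \<beta>"]])
      fix k :: nat
      have "(\<integral>\<tau>. norm (?h k \<tau>) \<partial>lborel) \<le> (\<integral>\<tau>. lam (int_decode k) * (B * s * \<beta> * s) * B * indicator {0..\<beta>} \<tau> \<partial>lborel)"
        by (intro integral_mono integrable_norm hint hb integrable_mult_indicator_Icc)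
      also have "\<dots> = lam (int_decode k) * (B * s * \<beta> * s * B * \<beta>)" using assms by simp
      finally show "norm (\<integral>\<tau>. norm (?h k \<tau>) \<partial>lborel) \<le> lam (int_decode k) * (B * s * \<beta> * s * B * \<beta>)" by simp
    qed
  qed
  also have "(\<lambda>k. \<integral>\<tau>. ?h k \<tau> \<partial>lborel) = (\<lambda>k. t (int_decode k))"
  proof
    fix k
    have "(\<integral>\<tau>. ?h k \<tau> \<partial>lborel) = (\<integral>\<tau>. lam (int_decode k) * c (int_decode k) *
        (indicator {0..\<beta>} \<tau> * (f \<tau> * trig_basis \<beta> (int_decode k) \<tau>)) \<partial>lborel)"
      by (intro Bochner_Integration.integral_cong) (auto simp: g_def mult_ac)
    also have "\<dots> = lam (int_decode k) * c (int_decode k) * c (int_decode k)"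
      by (simp add: c_def L2_inner_def set_lebesgue_integral_def)
    finally show "(\<integral>\<tau>. ?h k \<tau> \<partial>lborel) = t (int_decode k)" by (simp add: t_def power2_eq_square mult.assoc)
  qed
  also have "(\<Sum>k. t (int_decode k)) = infsum t UNIV" using infsumI[OF thas'] by simp
  finally show "L2_inner \<beta> f (cov_op \<beta> m f) =
      (\<Sum>\<^sub>\<infinity>n. inverse (m * (freq \<beta> n)\<^sup>2 + 1) * (L2_inner \<beta> f (trig_basis \<beta> n))\<^sup>2)"
    by (simp add: t_def[abs_def] lam_def c_def)
qed

subsection \<open>Interval averages\<close>

text \<open>Inner product with a normalised indicator, hence a functional whose law is known.
  Averages over short intervals stand in for point evaluations wherever a Gaussian law is
  required.\<close>

definition avg :: "real \<Rightarrow> real \<Rightarrow> (real \<Rightarrow> real) \<Rightarrow> real" where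
  "avg a b F = integral {a..b} F / (b - a)"

lemma L2_inner_indicator:
  assumes "0 \<le> a" "a < b" "b \<le> \<beta>" and g: "continuous_on {0..\<beta>} g"
  shows "L2_inner \<beta> (\<lambda>\<tau>. indicator {a..<b} \<tau> / (b - a)) g = avg a b g"
    and "set_integrable lborel {0..\<beta>} (\<lambda>\<tau>. indicator {a..<b} \<tau> / (b - a) * g \<tau>)"
proof -
  have sub: "{a..b} \<subseteq> {0..\<beta>}" using assms by auto
  have gi: "set_integrable lborel {a..b} g"
    by (rule borel_integrable_atLeastAtMost') (rule continuous_on_subset[OF g sub])
  then have gi': "set_integrable lborel {a..<b} g" by (rule set_integrable_subset) auto
  have eq: "indicator {0..\<beta>} \<tau> *\<^sub>R (indicator {a..<b} \<tau> / (b - a) * g \<tau>) = indicator {a..<b} \<tau> *\<^sub>R g \<tau> / (b - a)" for \<tau>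
    using assms by (auto simp: indicator_def)
  show "set_integrable lborel {0..\<beta>} (\<lambda>\<tau>. indicator {a..<b} \<tau> / (b - a) * g \<tau>)"
    using gi' unfolding set_integrable_def eq by simp
  have "L2_inner \<beta> (\<lambda>\<tau>. indicator {a..<b} \<tau> / (b - a)) g = (LBINT \<tau>:{a..<b}. g \<tau>) / (b - a)"
    unfolding L2_inner_def set_lebesgue_integral_def eq by simp
  also have "(LBINT \<tau>:{a..<b}. g \<tau>) = (LBINT \<tau>:{a..b}. g \<tau>)"
  proof (rule set_integral_cong_set)
    have "AE \<tau> in lborel. \<tau> \<noteq> b" by (rule AE_lborel_singleton)
    then show "AE \<tau> in lborel. (\<tau> \<in> {a..b}) = (\<tau> \<in> {a..<b})" by eventually_elim auto
  qed (use gi gi' in \<open>auto simp: set_borel_measurable_def set_integrable_def\<close>)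
  also have "\<dots> = integral {a..b} g" by (rule set_borel_integral_eq_integral(2)[OF gi])
  finally show "L2_inner \<beta> (\<lambda>\<tau>. indicator {a..<b} \<tau> / (b - a)) g = avg a b g" by (simp add: avg_def)
qed

lemma continuous_on_trig_basis: "continuous_on A (trig_basis \<beta> n)"
proof -
  have "trig_basis \<beta> n = (\<lambda>\<tau>. if n = 0 then 1 / sqrt \<beta>
      else if n > 0 then sqrt (2 / \<beta>) * cos (freq \<beta> n * \<tau>) else sqrt (2 / \<beta>) * sin (freq \<beta> n * \<tau>))"
    by (rule ext) (rule trig_basis_def)
  then show ?thesis by (cases "n = 0"; cases "n > 0") (auto intro!: continuous_intros)
qed

lemma avg_bound:
  assumes "a < b" "continuous_on {a..b} F" "\<And>t. t \<in> {a..b} \<Longrightarrow> \<bar>F t - y\<bar> \<le> e"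
  shows "\<bar>avg a b F - y\<bar> \<le> e"
proof -
  have int: "F integrable_on {a..b}" by (rule integrable_continuous_real[OF assms(2)])
  have "integral {a..b} (\<lambda>t. F t - y) = integral {a..b} F - (b - a) * y"
    using assms(1) int by (subst Henstock_Kurzweil_Integration.integral_diff) auto
  moreover have "norm (integral {a..b} (\<lambda>t. F t - y)) \<le> e * (b - a)"
    using assms by (intro integral_bound continuous_intros) auto
  moreover have "avg a b F - y = (integral {a..b} F - (b - a) * y) / (b - a)"
    using assms(1) by (simp add: avg_def field_simps)
  ultimately show ?thesis using assms(1) by (simp add: abs_divide divide_le_eq)
qed

lemma trig_basis_Lipschitz:
  assumes "\<beta> > 0"
  shows "\<bar>trig_basis \<beta> n t - trig_basis \<beta> n s\<bar> \<le> sqrt (2 / \<beta>) * (\<bar>freq \<beta> n\<bar> * \<bar>t - s\<bar>)"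
proof -
  have cos: "\<bar>cos x - cos y\<bar> \<le> \<bar>x - y\<bar>" for x y :: real
  proof -
    have "\<bar>cos x - cos y\<bar> = 2 * (\<bar>sin ((x + y) / 2)\<bar> * \<bar>sin ((y - x) / 2)\<bar>)"
      by (simp add: cos_diff_cos abs_mult)
    also have "\<dots> \<le> 2 * (1 * \<bar>(y - x) / 2\<bar>)"
      by (intro mult_left_mono mult_mono abs_sin_x_le_abs_x) auto
    finally show ?thesis by simp
  qed
  have sin: "\<bar>sin x - sin y\<bar> \<le> \<bar>x - y\<bar>" for x y :: real
    using cos[of "pi / 2 - x" "pi / 2 - y"] by (simp add: cos_diff)
  have *: "sqrt (2 / \<beta>) * \<bar>freq \<beta> n * t - freq \<beta> n * s\<bar> = sqrt (2 / \<beta>) * (\<bar>freq \<beta> n\<bar> * \<bar>t - s\<bar>)"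
    by (simp add: abs_mult[symmetric] right_diff_distrib)
  have "sqrt (2 / \<beta>) \<ge> 0" using assms by simp
  then show ?thesis
    using mult_left_mono[OF cos, of "sqrt (2 / \<beta>)" "freq \<beta> n * t" "freq \<beta> n * s"]
      mult_left_mono[OF sin, of "sqrt (2 / \<beta>)" "freq \<beta> n * t" "freq \<beta> n * s"] assms
    unfolding * by (auto simp: trig_basis_def abs_mult right_diff_distrib[symmetric])
qed

text \<open>Testing with \<open>u * f\<close> for all real \<open>u\<close> turns the characteristic
  functional into the characteristic function of one real variable, the variance being quadratic in
  \<open>u\<close>. \<open>Y\<close> is a convenient form of the functional, agreeing with it on
  loops.\<close>

lemma distr_gaussian_functional:
  assumes G: "gaussian_loop_measure \<beta> m \<gamma>" and "\<beta> > 0" "m > 0"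
    and f [measurable]: "f \<in> borel_measurable borel" and B: "\<And>\<tau>. \<bar>f \<tau>\<bar> \<le> B"
    and Y: "Y \<in> borel_measurable (loop_borel \<beta>)"
    and fY: "\<And>\<omega>. \<omega> \<in> mspace (loop_metric \<beta>) \<Longrightarrow> L2_inner \<beta> f \<omega> = Y \<omega>"
  defines "v \<equiv> \<Sum>\<^sub>\<infinity>n. inverse (m * (freq \<beta> n)\<^sup>2 + 1) * (L2_inner \<beta> f (trig_basis \<beta> n))\<^sup>2"
  shows "distr \<gamma> borel Y = distr std_normal_distribution borel (\<lambda>z. sqrt v * z)" and "v \<ge> 0"
proof -
  have sets: "sets \<gamma> = sets (loop_borel \<beta>)" and "prob_space \<gamma>"
    and char: "\<And>f. L2_fun \<beta> f \<Longrightarrow> (LINT \<omega>|\<gamma>. iexp (L2_inner \<beta> f \<omega>)) =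
        complex_of_real (exp (- (1/2) * L2_inner \<beta> f (cov_op \<beta> m f)))"
    using G by (auto simp: gaussian_loop_measure_def)
  have sp: "space \<gamma> = mspace (loop_metric \<beta>)"
    using sets_eq_imp_space_eq[OF sets] by (simp add: space_loop_borel)
  show v0: "v \<ge> 0" unfolding v_def using assms(3) by (intro infsum_nonneg) auto
  show "distr \<gamma> borel Y = distr std_normal_distribution borel (\<lambda>z. sqrt v * z)"
  proof (rule distr_eq_scaled_std_normal[OF \<open>prob_space \<gamma>\<close> _ v0])
    show "Y \<in> borel_measurable \<gamma>" using Y measurable_cong_sets[OF sets refl] by blast
    fix u :: real
    have uB: "\<bar>u * f \<tau>\<bar> \<le> \<bar>u\<bar> * B" for \<tau> using B by (simp add: abs_mult mult_left_mono)
    have "L2_fun \<beta> (\<lambda>\<tau>. u * f \<tau>)"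
      unfolding L2_fun_def
    proof (intro conjI set_integrable_bounded)
      show "\<bar>(u * f \<tau>)\<^sup>2\<bar> \<le> (\<bar>u\<bar> * B)\<^sup>2" for \<tau>
        using power_mono[OF uB[of \<tau>] abs_ge_zero, of 2] by simp
    qed measurable
    note char = char[OF this]
    have lin: "L2_inner \<beta> (\<lambda>\<tau>. u * f \<tau>) g = u * L2_inner \<beta> f g" for g
      by (simp add: L2_inner_def mult.assoc)
    have "L2_inner \<beta> (\<lambda>\<tau>. u * f \<tau>) (cov_op \<beta> m (\<lambda>\<tau>. u * f \<tau>)) = (\<Sum>\<^sub>\<infinity>n. u\<^sup>2 * (inverse (m * (freq \<beta> n)\<^sup>2 + 1) * (L2_inner \<beta> f (trig_basis \<beta> n))\<^sup>2))"
      by (subst variance_eq_infsum(1)[where B = "\<bar>u\<bar> * B"])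
         (use assms uB in \<open>auto simp: lin power_mult_distrib intro!: infsum_cong\<close>)
    also have "\<dots> = u\<^sup>2 * v"
      unfolding v_def by (rule infsum_cmult_right) (rule variance_eq_infsum(2)[OF assms(2,3) f B])
    finally have var: "L2_inner \<beta> (\<lambda>\<tau>. u * f \<tau>) (cov_op \<beta> m (\<lambda>\<tau>. u * f \<tau>)) = u\<^sup>2 * v" .
    have "(LINT \<omega>|\<gamma>. iexp (u * Y \<omega>)) = (LINT \<omega>|\<gamma>. iexp (L2_inner \<beta> (\<lambda>\<tau>. u * f \<tau>) \<omega>))"
      by (intro Bochner_Integration.integral_cong refl) (simp add: lin fY sp)
    then show "(LINT \<omega>|\<gamma>. iexp (u * Y \<omega>)) = complex_of_real (exp (- (1/2) * (u\<^sup>2 * v)))"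
      unfolding char var .
  qed
qed

text \<open>The zero mode has eigenvalue exactly 1 and is kept as it is; only the other modes are
  estimated, by a majorant in the absolute frequency index.\<close>

lemma variance_infsum_le:
  fixes c :: "int \<Rightarrow> real"
  assumes "\<beta> > 0" "m > 0"
    and "summable (\<lambda>n. g (Suc n))" and "\<And>n. g (Suc n) \<ge> 0"
    and "\<And>n. n \<noteq> 0 \<Longrightarrow> (c n)\<^sup>2 / (m * (freq \<beta> n)\<^sup>2) \<le> g (nat \<bar>n\<bar>)"
  shows "(\<Sum>\<^sub>\<infinity>n. inverse (m * (freq \<beta> n)\<^sup>2 + 1) * (c n)\<^sup>2) \<le> (c 0)\<^sup>2 + 2 * (\<Sum>n. g (Suc n))"
proof -
  let ?g = "\<lambda>n. if n = 0 then (c 0)\<^sup>2 else g n"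
  have S: "((\<lambda>n::int. ?g (nat \<bar>n\<bar>)) has_sum (?g 0 + 2 * (\<Sum>n. ?g (Suc n)))) UNIV"
    by (rule has_sum_int_nat_abs) (use assms in auto)
  have le: "inverse (m * (freq \<beta> n)\<^sup>2 + 1) * (c n)\<^sup>2 \<le> ?g (nat \<bar>n\<bar>)" for n
  proof (cases "n = 0")
    case False
    then have "inverse (m * (freq \<beta> n)\<^sup>2 + 1) * (c n)\<^sup>2 \<le> 1 / (m * (freq \<beta> n)\<^sup>2) * (c n)\<^sup>2"
      using eigenvalue_le[OF assms(2,1)] by (intro mult_right_mono) auto
    with assms(5)[OF False] False show ?thesis by simp
  qed (simp add: freq_def)
  have "(\<lambda>n. inverse (m * (freq \<beta> n)\<^sup>2 + 1) * (c n)\<^sup>2) summable_on UNIV"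
    by (rule summable_on_comparison_test[OF has_sum_imp_summable[OF S] le]) (use assms in auto)
  then have "(\<Sum>\<^sub>\<infinity>n. inverse (m * (freq \<beta> n)\<^sup>2 + 1) * (c n)\<^sup>2) \<le> (\<Sum>\<^sub>\<infinity>n::int. ?g (nat \<bar>n\<bar>))"
    by (intro infsum_mono le has_sum_imp_summable[OF S])
  then show ?thesis using infsumI[OF S] by simp
qed

lemma avg_measurable:
  assumes "0 \<le> a" "a < b" "b \<le> \<beta>"
  shows "avg a b \<in> borel_measurable (loop_borel \<beta>)"
proof -
  have "(\<lambda>\<omega>. integral {a..b} \<omega>) \<in> borel_measurable (loop_borel \<beta>)"
    by (intro borel_measurable_integral_eval loop_eval_measurable)
       (use assms continuous_on_subset[OF mspace_loop_metricD(1), of _ \<beta> "{a..b}"] in \<open>auto simp: space_loop_borel\<close>)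
  then show ?thesis unfolding avg_def[abs_def] by measurable
qed

lemma distr_avg:
  assumes G: "gaussian_loop_measure \<beta> m \<gamma>" and "\<beta> > 0" "m > 0" "0 \<le> a" "a < b" "b \<le> \<beta>"
  defines "v \<equiv> \<Sum>\<^sub>\<infinity>n. inverse (m * (freq \<beta> n)\<^sup>2 + 1) * (avg a b (trig_basis \<beta> n))\<^sup>2"
  shows "distr \<gamma> borel (avg a b) = distr std_normal_distribution borel (\<lambda>z. sqrt v * z)" and "v \<ge> 0"
proof -
  let ?f = "\<lambda>\<tau>. indicator {a..<b} \<tau> / (b - a)"
  have v: "v = (\<Sum>\<^sub>\<infinity>n. inverse (m * (freq \<beta> n)\<^sup>2 + 1) * (L2_inner \<beta> ?f (trig_basis \<beta> n))\<^sup>2)"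
    using assms by (simp add: L2_inner_indicator continuous_on_trig_basis)
  have "\<bar>?f \<tau>\<bar> \<le> 1 / (b - a)" for \<tau> using assms by (auto simp: indicator_def)
  note * = distr_gaussian_functional[OF G \<open>\<beta> > 0\<close> \<open>m > 0\<close>, of ?f "1 / (b - a)" "avg a b", folded v,
      OF _ this avg_measurable[OF \<open>0 \<le> a\<close> \<open>a < b\<close> \<open>b \<le> \<beta>\<close>]]
  show "distr \<gamma> borel (avg a b) = distr std_normal_distribution borel (\<lambda>z. sqrt v * z)" "v \<ge> 0"
    using * L2_inner_indicator(1)[OF assms(4,5,6)] mspace_loop_metricD(1) by auto
qed

text \<open>The difference of two averages is again a single functional, tested by a difference of
  indicators, so its law follows without any joint law.\<close>

lemma distr_avg_diff:
  assumes G: "gaussian_loop_measure \<beta> m \<gamma>" and "\<beta> > 0" "m > 0"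
    and "0 \<le> a" "a < b" "b \<le> \<beta>" "a \<le> a'" "a' < b'" "b' \<le> b"
  defines "v \<equiv> \<Sum>\<^sub>\<infinity>n. inverse (m * (freq \<beta> n)\<^sup>2 + 1) * (avg a' b' (trig_basis \<beta> n) - avg a b (trig_basis \<beta> n))\<^sup>2"
  shows "distr \<gamma> borel (\<lambda>\<omega>. avg a' b' \<omega> - avg a b \<omega>) = distr std_normal_distribution borel (\<lambda>z. sqrt v * z)"
    and "v \<ge> 0"
proof -
  let ?f = "\<lambda>\<tau>. indicator {a'..<b'} \<tau> / (b' - a') - indicator {a..<b} \<tau> / (b - a)"
  have f: "L2_inner \<beta> ?f g = avg a' b' g - avg a b g" if "continuous_on {0..\<beta>} g" for g
  proof -
    have "L2_inner \<beta> ?f g = L2_inner \<beta> (\<lambda>\<tau>. indicator {a'..<b'} \<tau> / (b' - a')) g - L2_inner \<beta> (\<lambda>\<tau>. indicator {a..<b} \<tau> / (b - a)) g"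
      unfolding L2_inner_def left_diff_distrib
      by (rule set_integral_diff(2); rule L2_inner_indicator(2)) (use assms that in auto)
    then show ?thesis using assms that by (simp add: L2_inner_indicator(1))
  qed
  have v: "v = (\<Sum>\<^sub>\<infinity>n. inverse (m * (freq \<beta> n)\<^sup>2 + 1) * (L2_inner \<beta> ?f (trig_basis \<beta> n))\<^sup>2)"
    using assms by (simp add: f continuous_on_trig_basis)
  have "\<bar>?f \<tau>\<bar> \<le> 1 / (b' - a') + 1 / (b - a)" for \<tau>
    using assms by (intro order_trans[OF abs_triangle_ineq4] add_mono) (auto simp: indicator_def)
  moreover have "(\<lambda>\<omega>. avg a' b' \<omega> - avg a b \<omega>) \<in> borel_measurable (loop_borel \<beta>)"
    using assms by (intro borel_measurable_diff avg_measurable) auto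
  ultimately show "distr \<gamma> borel (\<lambda>\<omega>. avg a' b' \<omega> - avg a b \<omega>) = distr std_normal_distribution borel (\<lambda>z. sqrt v * z)" "v \<ge> 0"
    using distr_gaussian_functional[OF G \<open>\<beta> > 0\<close> \<open>m > 0\<close>, of ?f _ "\<lambda>\<omega>. avg a' b' \<omega> - avg a b \<omega>", folded v]
      f mspace_loop_metricD(1) by auto
qed

section \<open>The mean over a period and variance bounds for averages\<close>

lemma avg_trig_basis_period:
  assumes "\<beta> > 0"
  shows "avg 0 \<beta> (trig_basis \<beta> n) = (if n = 0 then 1 / sqrt \<beta> else 0)"
proof (cases "n = 0")
  case True
  then show ?thesis using assms by (simp add: avg_def trig_basis_def[abs_def])
next
  case False
  let ?q = "freq \<beta> n"
  have q: "?q \<noteq> 0" "?q * \<beta> = 2 * pi * of_int n" using assms False by (auto simp: freq_def)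
  have "((\<lambda>\<tau>. cos (?q * \<tau>)) has_integral (sin (?q * \<beta>) / ?q - sin (?q * 0) / ?q)) {0..\<beta>}"
    by (rule fundamental_theorem_of_calculus)
       (use assms q in \<open>auto intro!: derivative_eq_intros simp: has_real_derivative_iff_has_vector_derivative[symmetric]\<close>)
  moreover have "((\<lambda>\<tau>. sin (?q * \<tau>)) has_integral (- cos (?q * \<beta>) / ?q - (- cos (?q * 0) / ?q))) {0..\<beta>}"
    by (rule fundamental_theorem_of_calculus)
       (use assms q in \<open>auto intro!: derivative_eq_intros simp: has_real_derivative_iff_has_vector_derivative[symmetric]\<close>)
  moreover have "sin (?q * \<beta>) = 0" "cos (?q * \<beta>) = 1"
    unfolding q using sin_int_2pin cos_int_2pin by (auto simp: mult.commute)
  ultimately have "integral {0..\<beta>} (\<lambda>\<tau>. cos (?q * \<tau>)) = 0" "integral {0..\<beta>} (\<lambda>\<tau>. sin (?q * \<tau>)) = 0"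
    by (auto dest: integral_unique)
  then show ?thesis using False by (cases "n > 0") (auto simp: avg_def trig_basis_def[abs_def])
qed

text \<open>Averaging over a full period kills every mode but the constant one. Constants lie in the
  kernel of the Laplacian, so the mass drops out of the law.\<close>

lemma distr_mean:
  assumes G: "gaussian_loop_measure \<beta> m \<gamma>" and "\<beta> > 0" "m > 0"
  shows "distr \<gamma> borel (avg 0 \<beta>) = distr std_normal_distribution borel (\<lambda>z. sqrt (1 / \<beta>) * z)"
proof -
  have "(\<Sum>\<^sub>\<infinity>n. inverse (m * (freq \<beta> n)\<^sup>2 + 1) * (avg 0 \<beta> (trig_basis \<beta> n))\<^sup>2)
      = (\<Sum>\<^sub>\<infinity>n\<in>{0}. inverse (m * (freq \<beta> n)\<^sup>2 + 1) * (avg 0 \<beta> (trig_basis \<beta> n))\<^sup>2)"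
    by (rule infsum_cong_neutral) (use assms in \<open>auto simp: avg_trig_basis_period\<close>)
  also have "\<dots> = 1 / \<beta>" using assms by (simp add: avg_trig_basis_period freq_def power_divide)
  finally show ?thesis using distr_avg(1)[OF assms, of 0 \<beta>] assms by simp
qed

lemma abs_avg_trig_basis_le:
  assumes "\<beta> > 0" "a < b"
  shows "\<bar>avg a b (trig_basis \<beta> n)\<bar> \<le> sqrt (2 / \<beta>)"
  using avg_bound[OF assms(2) continuous_on_trig_basis, of \<beta> n 0 "sqrt (2 / \<beta>)"] abs_trig_basis_le[OF assms(1)]
  by simp

text \<open>1 / \<beta> is the share of the zero mode, C / m that of all others. As \<open>C\<close>
  does not depend on the interval, the bound survives when the interval shrinks to a point.\<close>

lemma avg_variance_le:
  assumes "\<beta> > 0"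
  obtains C where "C > 0" and "\<And>m a b. m > 0 \<Longrightarrow> a < b \<Longrightarrow>
    (\<Sum>\<^sub>\<infinity>n. inverse (m * (freq \<beta> n)\<^sup>2 + 1) * (avg a b (trig_basis \<beta> n))\<^sup>2) \<le> 1 / \<beta> + C / m"
proof
  define D where "D = 2 / \<beta> / (2 * pi / \<beta>)\<^sup>2"
  define S where "S = (\<Sum>n. 1 / (real (Suc n))\<^sup>2)"
  have D: "D > 0" using assms by (simp add: D_def)
  have sm: "summable (\<lambda>n. 1 / (real (Suc n))\<^sup>2)"
    by (intro summable_Suc_iff[THEN iffD2]) (use inverse_power_summable[of 2, where 'a = real] in \<open>simp add: inverse_eq_divide\<close>)
  then have "S > 0" unfolding S_def by (intro suminf_pos) auto
  then show "2 * D * S > 0" using D by simp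
  fix m a b :: real assume m: "m > 0" "a < b"
  let ?g = "\<lambda>n. D / m * (1 / (real n)\<^sup>2)"
  have "(\<Sum>\<^sub>\<infinity>n. inverse (m * (freq \<beta> n)\<^sup>2 + 1) * (avg a b (trig_basis \<beta> n))\<^sup>2) \<le>
      (avg a b (trig_basis \<beta> 0))\<^sup>2 + 2 * (\<Sum>n. ?g (Suc n))"
  proof (rule variance_infsum_le[OF assms m(1), where g = ?g])
    show "summable (\<lambda>n. ?g (Suc n))" by (rule summable_mult[OF sm])
    fix n :: int assume "n \<noteq> 0"
    have "(avg a b (trig_basis \<beta> n))\<^sup>2 \<le> 2 / \<beta>"
      using power_mono[OF abs_avg_trig_basis_le[OF assms m(2), of n] abs_ge_zero, of 2] assms by simp
    then have "(avg a b (trig_basis \<beta> n))\<^sup>2 / (m * (freq \<beta> n)\<^sup>2) \<le> 2 / \<beta> / (m * (freq \<beta> n)\<^sup>2)"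
      using m by (intro divide_right_mono) auto
    then show "(avg a b (trig_basis \<beta> n))\<^sup>2 / (m * (freq \<beta> n)\<^sup>2) \<le> ?g (nat \<bar>n\<bar>)"
      unfolding freq_square D_def by (simp add: field_simps)
  qed (use D m in auto)
  also have "avg a b (trig_basis \<beta> 0) = 1 / sqrt \<beta>"
    using m by (simp add: avg_def trig_basis_def[abs_def])
  also have "(\<Sum>n. ?g (Suc n)) = D / m * S" unfolding S_def by (rule suminf_mult[OF sm])
  finally show "(\<Sum>\<^sub>\<infinity>n. inverse (m * (freq \<beta> n)\<^sup>2 + 1) * (avg a b (trig_basis \<beta> n))\<^sup>2) \<le> 1 / \<beta> + 2 * D * S / m"
    using assms by (simp add: power_divide)
qed

text \<open>The weight \<open>min 1 (q l)\<^sup>2\<close> that a Haar function of length \<open>l\<close> puts on the frequency \<open>q\<close> is bounded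
  by \<open>sqrt (q l)\<close>, the power being chosen so that the sum over \<open>q\<close> with weights \<open>1 / q\<^sup>2\<close> still converges.\<close>

lemma avg_diff_variance_le:
  assumes "\<beta> > 0"
  obtains C where "C > 0" and "\<And>m a b a' b'. m > 0 \<Longrightarrow> a < b \<Longrightarrow> a \<le> a' \<Longrightarrow> a' < b' \<Longrightarrow> b' \<le> b \<Longrightarrow>
    (\<Sum>\<^sub>\<infinity>n. inverse (m * (freq \<beta> n)\<^sup>2 + 1) * (avg a' b' (trig_basis \<beta> n) - avg a b (trig_basis \<beta> n))\<^sup>2)
      \<le> C * sqrt (b - a) / m"
proof
  define w where "w = 2 * pi / \<beta>"
  \<comment> \<open>8 / \<beta> is the square of the bound \<open>2 * sqrt (2 / \<beta>)\<close> on
    the coefficients of the difference; the rest comes from sqrt (q l) / q^2 with q a multiple of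
    \<open>w\<close>.\<close>
  define D where "D = 8 / \<beta> * sqrt w / w\<^sup>2"
  define S where "S = (\<Sum>n. sqrt (real (Suc n)) / (real (Suc n))\<^sup>2)"
  have w: "w > 0" using assms by (simp add: w_def)
  then have D: "D > 0" using assms by (simp add: D_def)
  have eq: "sqrt (real (Suc n)) / (real (Suc n))\<^sup>2 = real (Suc n) powr (-3/2)" for n
  proof -
    have "real (Suc n) powr (1/2 - 2) = real (Suc n) powr (1/2) / real (Suc n) powr 2" by (rule powr_diff)
    then show ?thesis by (simp add: powr_half_sqrt)
  qed
  have sm: "summable (\<lambda>n. sqrt (real (Suc n)) / (real (Suc n))\<^sup>2)"
    unfolding eq by (intro summable_Suc_iff[THEN iffD2]) (simp add: summable_real_powr_iff)
  then have "S > 0" unfolding S_def by (intro suminf_pos) auto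
  then show "2 * D * S > 0" using D by simp
  fix m a b a' b' :: real assume m: "m > 0" and ab: "a < b" "a \<le> a'" "a' < b'" "b' \<le> b"
  let ?c = "\<lambda>n. avg a' b' (trig_basis \<beta> n) - avg a b (trig_basis \<beta> n)"
  let ?g = "\<lambda>n. D * sqrt (b - a) / m * (sqrt (real n) / (real n)\<^sup>2)"
  have "(\<Sum>\<^sub>\<infinity>n. inverse (m * (freq \<beta> n)\<^sup>2 + 1) * (?c n)\<^sup>2) \<le> (?c 0)\<^sup>2 + 2 * (\<Sum>n. ?g (Suc n))"
  proof (rule variance_infsum_le[OF assms m, where g = ?g])
    show "summable (\<lambda>n. ?g (Suc n))" by (rule summable_mult[OF sm])
    fix n :: int assume "n \<noteq> 0"
    define s where "s = sqrt (2 / \<beta>)"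
    define x where "x = \<bar>freq \<beta> n\<bar> * (b - a)"
    have s: "s > 0" "s\<^sup>2 = 2 / \<beta>" and x: "x > 0" using assms ab \<open>n \<noteq> 0\<close> by (auto simp: s_def x_def freq_def)
    \<comment> \<open>Both averages are compared with the value at the common reference point
      \<open>a\<close>: each interval lies in \<open>{a..b}\<close>, so each average is within
      \<open>s * x\<close> of it.\<close>
    have lip: "\<bar>trig_basis \<beta> n t - trig_basis \<beta> n a\<bar> \<le> s * x" if "t \<in> {a..b}" for t
      unfolding s_def x_def
      by (rule order_trans[OF trig_basis_Lipschitz[OF assms]]) (use assms that in \<open>auto intro!: mult_left_mono\<close>)
    have "\<bar>avg a' b' (trig_basis \<beta> n) - trig_basis \<beta> n a\<bar> \<le> s * x" "\<bar>avg a b (trig_basis \<beta> n) - trig_basis \<beta> n a\<bar> \<le> s * x"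
      using ab by (auto intro!: avg_bound continuous_on_trig_basis lip)
    then have c1: "\<bar>?c n\<bar> \<le> 2 * s * x" by linarith
    have c2: "\<bar>?c n\<bar> \<le> 2 * s"
      using abs_avg_trig_basis_le[OF assms ab(1), of n] abs_avg_trig_basis_le[OF assms ab(3), of n] by (simp add: s_def)
    have "(?c n)\<^sup>2 \<le> (2 * s)\<^sup>2 * sqrt x"
    proof (cases "x \<ge> 1")
      case True
      have "(?c n)\<^sup>2 \<le> (2 * s)\<^sup>2 * 1" using power_mono[OF c2 abs_ge_zero, of 2] by simp
      also have "\<dots> \<le> (2 * s)\<^sup>2 * sqrt x" using True by (intro mult_left_mono) auto
      finally show ?thesis .
    next
      case False
      have "(?c n)\<^sup>2 \<le> (2 * s)\<^sup>2 * x\<^sup>2"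
        using power_mono[OF c1 abs_ge_zero, of 2] by (simp add: power_mult_distrib)
      moreover have "x\<^sup>2 \<le> sqrt x"
      proof (rule real_le_rsqrt)
        have "(x\<^sup>2)\<^sup>2 = x * x ^ 3" by (simp add: eval_nat_numeral)
        also have "\<dots> \<le> x * 1" using x False by (intro mult_left_mono power_le_one) auto
        finally show "(x\<^sup>2)\<^sup>2 \<le> x" by simp
      qed
      ultimately show ?thesis by (meson mult_left_mono order_trans zero_le_power2)
    qed
    also have "\<dots> = 8 / \<beta> * (sqrt w * sqrt (real (nat \<bar>n\<bar>)) * sqrt (b - a))"
    proof -
      have "x = w * real (nat \<bar>n\<bar>) * (b - a)" using assms by (simp add: x_def freq_def w_def abs_mult)
      then show ?thesis by (simp add: power_mult_distrib s(2) real_sqrt_mult)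
    qed
    finally have "(?c n)\<^sup>2 / (m * (freq \<beta> n)\<^sup>2) \<le> 8 / \<beta> * (sqrt w * sqrt (real (nat \<bar>n\<bar>)) * sqrt (b - a)) / (m * (freq \<beta> n)\<^sup>2)"
      using m by (intro divide_right_mono) auto
    then show "(?c n)\<^sup>2 / (m * (freq \<beta> n)\<^sup>2) \<le> ?g (nat \<bar>n\<bar>)"
      unfolding freq_square w_def[symmetric] D_def by (simp add: mult_ac)
  qed (use D m ab in auto)
  \<comment> \<open>Constants have equal averages, so the only mode without a factor 1 / m
    disappears.\<close>
  also have "?c 0 = 0"
    using ab by (simp add: avg_def trig_basis_def[abs_def])
  also have "(\<Sum>n. ?g (Suc n)) = D * sqrt (b - a) / m * S" unfolding S_def by (rule suminf_mult[OF sm])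
  finally show "(\<Sum>\<^sub>\<infinity>n. inverse (m * (freq \<beta> n)\<^sup>2 + 1) * (?c n)\<^sup>2) \<le> 2 * D * S * sqrt (b - a) / m"
    by (simp add: mult_ac)
qed

subsection \<open>Concentration of heavy loops around their mean\<close>

definition dyadic_avg :: "real \<Rightarrow> nat \<Rightarrow> nat \<Rightarrow> (real \<Rightarrow> real) \<Rightarrow> real" where
  "dyadic_avg \<beta> k i = avg (\<beta> * real i / 2 ^ k) (\<beta> * (real i + 1) / 2 ^ k)"

definition dyadic_index :: "real \<Rightarrow> real \<Rightarrow> nat \<Rightarrow> nat" where
  "dyadic_index \<beta> t k = nat \<lfloor>t * 2 ^ k / \<beta>\<rfloor>"

text \<open>The cells containing \<open>t\<close> form a branch of the binary tree, since the floor
  of 2 x is twice the floor of x or one more. Cells are half-open on the right, so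
  \<open>t = \<beta>\<close> has none.\<close>

lemma dyadic_index:
  assumes "0 \<le> t" "t < \<beta>"
  shows "\<beta> * real (dyadic_index \<beta> t k) / 2 ^ k \<le> t" and "t < \<beta> * (real (dyadic_index \<beta> t k) + 1) / 2 ^ k"
    and "dyadic_index \<beta> t k < 2 ^ k"
    and "dyadic_index \<beta> t (Suc k) \<in> {2 * dyadic_index \<beta> t k, 2 * dyadic_index \<beta> t k + 1}"
proof -
  let ?x = "t * 2 ^ k / \<beta>"
  have x: "0 \<le> ?x" "?x < 2 ^ k" using assms by (auto simp: field_simps)
  have i: "real (dyadic_index \<beta> t k) = of_int \<lfloor>?x\<rfloor>" using x by (simp add: dyadic_index_def)
  have "of_int \<lfloor>?x\<rfloor> \<le> ?x" "?x < of_int \<lfloor>?x\<rfloor> + 1" by linarith+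
  then have *: "real (dyadic_index \<beta> t k) \<le> ?x" "?x < real (dyadic_index \<beta> t k) + 1" unfolding i .
  then show "\<beta> * real (dyadic_index \<beta> t k) / 2 ^ k \<le> t" "t < \<beta> * (real (dyadic_index \<beta> t k) + 1) / 2 ^ k"
    using assms by (simp_all add: field_simps)
  have "real (dyadic_index \<beta> t k) < real (2 ^ k)" using *(1) x(2) by (simp only: of_nat_power of_nat_numeral)
  then show "dyadic_index \<beta> t k < 2 ^ k" by (simp only: of_nat_less_iff)
  have "t * 2 ^ Suc k / \<beta> = 2 * ?x" by simp
  then have "dyadic_index \<beta> t (Suc k) = nat \<lfloor>2 * ?x\<rfloor>" by (simp only: dyadic_index_def)
  moreover have "\<lfloor>2 * ?x\<rfloor> = 2 * \<lfloor>?x\<rfloor> \<or> \<lfloor>2 * ?x\<rfloor> = 2 * \<lfloor>?x\<rfloor> + 1" by linarith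
  moreover have "\<lfloor>?x\<rfloor> \<ge> 0" using x by simp
  ultimately show "dyadic_index \<beta> t (Suc k) \<in> {2 * dyadic_index \<beta> t k, 2 * dyadic_index \<beta> t k + 1}"
    by (auto simp: dyadic_index_def nat_mult_distrib nat_add_distrib)
qed

lemma dyadic_interval_subset:
  assumes "\<beta> > 0" "i < 2 ^ k"
  shows "0 \<le> \<beta> * real i / 2 ^ k" "\<beta> * real i / 2 ^ k < \<beta> * (real i + 1) / 2 ^ k" "\<beta> * (real i + 1) / 2 ^ k \<le> \<beta>"
proof -
  have "real (Suc i) \<le> real (2 ^ k)" using assms by (simp only: of_nat_le_iff Suc_le_eq)
  then have "real i + 1 \<le> 2 ^ k" by simp
  then have "\<beta> * (real i + 1) \<le> \<beta> * 2 ^ k" using assms by (intro mult_left_mono) auto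
  then show "\<beta> * (real i + 1) / 2 ^ k \<le> \<beta>" by (simp add: divide_le_eq)
qed (use assms in \<open>auto simp: divide_strict_right_mono\<close>)

lemma dyadic_avg_LIMSEQ:
  assumes "0 \<le> t" "t < \<beta>" and w: "continuous_on {0..\<beta>} \<omega>"
  shows "(\<lambda>k. dyadic_avg \<beta> k (dyadic_index \<beta> t k) \<omega>) \<longlonglongrightarrow> \<omega> t"
proof (rule LIMSEQ_I)
  fix e :: real assume "e > 0"
  then obtain d where d: "d > 0" "\<And>s. s \<in> {0..\<beta>} \<Longrightarrow> dist s t < d \<Longrightarrow> dist (\<omega> s) (\<omega> t) < e / 2"
    using w assms unfolding continuous_on_iff by (metis atLeastAtMost_iff half_gt_zero less_imp_le)
  have "(\<lambda>k. \<beta> / 2 ^ k) \<longlonglongrightarrow> 0" by real_asymp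
  then obtain K where K: "\<And>k. k \<ge> K \<Longrightarrow> norm (\<beta> / 2 ^ k - 0) < d"
    using LIMSEQ_D[OF _ \<open>d > 0\<close>] by blast
  show "\<exists>no. \<forall>k\<ge>no. norm (dyadic_avg \<beta> k (dyadic_index \<beta> t k) \<omega> - \<omega> t) < e"
  proof (intro exI allI impI)
    fix k assume "k \<ge> K"
    let ?a = "\<beta> * real (dyadic_index \<beta> t k) / 2 ^ k" and ?b = "\<beta> * (real (dyadic_index \<beta> t k) + 1) / 2 ^ k"
    note ti = dyadic_index[OF assms(1,2), of k]
    have "\<beta> > 0" using assms by linarith
    note sub = dyadic_interval_subset[OF this ti(3)]
    have len: "?b - ?a < d" using K[OF \<open>k \<ge> K\<close>] assms by (simp add: field_simps)
    have "\<bar>avg ?a ?b \<omega> - \<omega> t\<bar> \<le> e / 2"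
    proof (rule avg_bound)
      fix s assume s: "s \<in> {?a..?b}"
      have "dist s t < d" using s ti(1,2) len by (auto simp: dist_real_def)
      moreover have "s \<in> {0..\<beta>}" using s sub(1,3) unfolding atLeastAtMost_iff by linarith
      ultimately show "\<bar>\<omega> s - \<omega> t\<bar> \<le> e / 2" using d(2)[of s] by (simp add: dist_real_def)
    next
      show "continuous_on {?a..?b} \<omega>"
        by (rule continuous_on_subset[OF w]) (use sub(1,3) in \<open>simp only: atLeastatMost_subset_iff simp_thms\<close>)
    qed (use sub in simp)
    then show "norm (dyadic_avg \<beta> k (dyadic_index \<beta> t k) \<omega> - \<omega> t) < e"
      using \<open>e > 0\<close> by (simp add: dyadic_avg_def)
  qed
qed

text \<open>Telescoping along the branch of cells that shrink to \<open>t\<close>: at level 0 the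
  average is the mean over the period, in the limit it is the value at \<open>t\<close>.\<close>

lemma dyadic_chaining:
  assumes "\<beta> > 0" and w: "continuous_on {0..\<beta>} \<omega>" "\<omega> 0 = \<omega> \<beta>"
    and step: "\<And>k i j. i < 2 ^ k \<Longrightarrow> j \<in> {2 * i, 2 * i + 1} \<Longrightarrow> \<bar>dyadic_avg \<beta> (Suc k) j \<omega> - dyadic_avg \<beta> k i \<omega>\<bar> \<le> d k"
    and sum: "\<And>n. (\<Sum>k<n. d k) \<le> \<delta>" and t: "t \<in> {0..\<beta>}"
  shows "\<bar>\<omega> t - avg 0 \<beta> \<omega>\<bar> \<le> \<delta>"
proof -
  have *: "\<bar>\<omega> t - avg 0 \<beta> \<omega>\<bar> \<le> \<delta>" if t: "0 \<le> t" "t < \<beta>" for t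
  proof -
    let ?A = "\<lambda>k. dyadic_avg \<beta> k (dyadic_index \<beta> t k) \<omega>"
    have A0: "?A 0 = avg 0 \<beta> \<omega>"
      using dyadic_index(3)[OF t, of 0] by (simp add: dyadic_avg_def)
    have "\<bar>?A n - avg 0 \<beta> \<omega>\<bar> \<le> (\<Sum>k<n. d k)" for n
    proof (induction n)
      case (Suc n)
      have "\<bar>?A (Suc n) - ?A n\<bar> \<le> d n" by (intro step dyadic_index t)
      with Suc show ?case by simp
    qed (simp add: A0)
    then have "\<bar>?A n - avg 0 \<beta> \<omega>\<bar> \<le> \<delta>" for n using sum order_trans by blast
    moreover have "(\<lambda>n. \<bar>?A n - avg 0 \<beta> \<omega>\<bar>) \<longlonglongrightarrow> \<bar>\<omega> t - avg 0 \<beta> \<omega>\<bar>"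
      by (intro tendsto_intros dyadic_avg_LIMSEQ t w)
    ultimately show ?thesis by (intro LIMSEQ_le_const2[where a = \<delta>]) auto
  qed
  show ?thesis
  proof (cases "t = \<beta>")
    \<comment> \<open>The right endpoint lies in no half-open cell; periodicity moves it to
      0.\<close>
    case True
    then show ?thesis using *[of 0] assms by simp
  qed (use * t in auto)
qed

text \<open>A power bound is weaker than the Gaussian tail but turns the sum over dyadic levels into
  a geometric series.\<close>

lemma exp_minus_le_power:
  fixes y :: real
  assumes "y > 0" "n > 0"
  shows "exp (- y) \<le> (real n / y) ^ n"
proof -
  have "y / real n \<le> exp (y / real n)" using exp_ge_add_one_self[of "y / real n"] by linarith
  then have "(y / real n) ^ n \<le> exp (y / real n) ^ n" using assms by (intro power_mono) auto
  also have "\<dots> = exp y" using assms by (simp add: exp_of_nat_mult[symmetric])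
  finally have "inverse (exp y) \<le> inverse ((y / real n) ^ n)" using assms by (intro le_imp_inverse_le) auto
  then show ?thesis by (simp add: exp_minus power_inverse[symmetric])
qed

lemma dyadic_avg_measurable:
  assumes "\<beta> > 0" "i < 2 ^ k" "sets \<gamma> = sets (loop_borel \<beta>)"
  shows "dyadic_avg \<beta> k i \<in> borel_measurable \<gamma>"
  unfolding measurable_cong_sets[OF assms(3) refl] dyadic_avg_def
  by (intro avg_measurable dyadic_interval_subset assms)

lemma dyadic_increment_tail:
  assumes "\<beta> > 0"
  obtains C where "C > 0" and "\<And>m \<gamma> k i j d. m > 0 \<Longrightarrow> gaussian_loop_measure \<beta> m \<gamma> \<Longrightarrow> i < 2 ^ k \<Longrightarrow>
      j \<in> {2 * i, 2 * i + 1} \<Longrightarrow> d \<ge> 0 \<Longrightarrow>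
      measure \<gamma> {\<omega> \<in> space \<gamma>. d < \<bar>dyadic_avg \<beta> (Suc k) j \<omega> - dyadic_avg \<beta> k i \<omega>\<bar>}
        \<le> sqrt 2 * exp (- (m * d\<^sup>2 * sqrt (2 ^ k) / (4 * C)))"
proof -
  obtain C where C: "C > 0" "\<And>m a b a' b'. m > 0 \<Longrightarrow> a < b \<Longrightarrow> a \<le> a' \<Longrightarrow> a' < b' \<Longrightarrow> b' \<le> b \<Longrightarrow>
    (\<Sum>\<^sub>\<infinity>n. inverse (m * (freq \<beta> n)\<^sup>2 + 1) * (avg a' b' (trig_basis \<beta> n) - avg a b (trig_basis \<beta> n))\<^sup>2)
      \<le> C * sqrt (b - a) / m"
    using avg_diff_variance_le[OF assms] by blast
  show thesis
  proof (rule that)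
    \<comment> \<open>A cell of level k has length \<beta> / 2^k; the factor sqrt \<beta> of its
      square root goes into the constant, and sqrt (2^k) stays in the exponent.\<close>
    show "C * sqrt \<beta> > 0" using C assms by simp
    fix m d :: real and \<gamma> and k i j :: nat
    assume m: "m > 0" and G: "gaussian_loop_measure \<beta> m \<gamma>" and i: "i < 2 ^ k" and j: "j \<in> {2 * i, 2 * i + 1}" and d: "d \<ge> 0"
    have sets: "sets \<gamma> = sets (loop_borel \<beta>)" and ps: "prob_space \<gamma>" using G by (auto simp: gaussian_loop_measure_def)
    have jk: "j < 2 ^ Suc k" using i j by auto
    let ?a = "\<beta> * real i / 2 ^ k" and ?b = "\<beta> * (real i + 1) / 2 ^ k"
      and ?a' = "\<beta> * real j / 2 ^ Suc k" and ?b' = "\<beta> * (real j + 1) / 2 ^ Suc k"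
    note sub = dyadic_interval_subset[OF assms i] dyadic_interval_subset[OF assms jk]
    have sub': "?a \<le> ?a'" "?b' \<le> ?b" using j assms by (auto simp: field_simps)
    have ba: "?b - ?a = \<beta> / 2 ^ k" by (simp add: field_simps)
    note D = distr_avg_diff[OF G assms m sub(1-3) sub'(1) sub(5) sub'(2)]
    have "measure \<gamma> {\<omega> \<in> space \<gamma>. d < \<bar>dyadic_avg \<beta> (Suc k) j \<omega> - dyadic_avg \<beta> k i \<omega>\<bar>}
        \<le> sqrt 2 * exp (- d\<^sup>2 / (4 * (C * sqrt (\<beta> / 2 ^ k) / m)))"
      unfolding dyadic_avg_def
    proof (rule scaled_std_normal_tail[OF ps D(1) _ D(2)])
      show "(\<Sum>\<^sub>\<infinity>n. inverse (m * (freq \<beta> n)\<^sup>2 + 1) * (avg ?a' ?b' (trig_basis \<beta> n) - avg ?a ?b (trig_basis \<beta> n))\<^sup>2)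
          \<le> C * sqrt (\<beta> / 2 ^ k) / m"
        using C(2)[OF m sub(2) sub'(1) sub(5) sub'(2)] unfolding ba .
      show "(\<lambda>\<omega>. avg ?a' ?b' \<omega> - avg ?a ?b \<omega>) \<in> borel_measurable \<gamma>"
        using dyadic_avg_measurable[OF assms i sets] dyadic_avg_measurable[OF assms jk sets]
        unfolding dyadic_avg_def by (rule borel_measurable_diff[rotated])
    qed (use C m d assms in auto)
    also have "d\<^sup>2 / (4 * (C * sqrt (\<beta> / 2 ^ k) / m)) = m * d\<^sup>2 * sqrt (2 ^ k) / (4 * (C * sqrt \<beta>))"
      using m C by (simp add: real_sqrt_divide)
    then have "- d\<^sup>2 / (4 * (C * sqrt (\<beta> / 2 ^ k) / m)) = - (m * d\<^sup>2 * sqrt (2 ^ k) / (4 * (C * sqrt \<beta>)))"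
      by (simp only: minus_divide_left)
    finally show "measure \<gamma> {\<omega> \<in> space \<gamma>. d < \<bar>dyadic_avg \<beta> (Suc k) j \<omega> - dyadic_avg \<beta> k i \<omega>\<bar>}
        \<le> sqrt 2 * exp (- (m * d\<^sup>2 * sqrt (2 ^ k) / (4 * (C * sqrt \<beta>))))" .
  qed
qed

text \<open>The thresholds \<open>d k\<close> decay like \<open>2 powr (- k / 8)\<close>: summably, but slowly enough that the Gaussian
  tails at scale \<open>2 powr (- k / 4)\<close> beat the number \<open>2 ^ k\<close> of increments.\<close>

lemma loop_close_to_mean:
  assumes "\<beta> > 0" "\<delta> > 0" "e > 0"
  shows "\<forall>\<^sub>F m in at_top. \<forall>\<gamma>. gaussian_loop_measure \<beta> m \<gamma> \<longrightarrow>
    (\<exists>B\<in>sets \<gamma>. measure \<gamma> B \<le> e \<and> (\<forall>\<omega>\<in>space \<gamma> - B. \<forall>t\<in>{0..\<beta>}. \<bar>\<omega> t - avg 0 \<beta> \<omega>\<bar> \<le> \<delta>))"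
proof -
  obtain C where C: "C > 0" "\<And>m \<gamma> k i j d. m > 0 \<Longrightarrow> gaussian_loop_measure \<beta> m \<gamma> \<Longrightarrow> i < 2 ^ k \<Longrightarrow>
      j \<in> {2 * i, 2 * i + 1} \<Longrightarrow> d \<ge> 0 \<Longrightarrow>
      measure \<gamma> {\<omega> \<in> space \<gamma>. d < \<bar>dyadic_avg \<beta> (Suc k) j \<omega> - dyadic_avg \<beta> k i \<omega>\<bar>}
        \<le> sqrt 2 * exp (- (m * d\<^sup>2 * sqrt (2 ^ k) / (4 * C)))"
    using dyadic_increment_tail[OF assms(1)] by blast
  \<comment> \<open>\<open>s\<close> is 2 to the power -1/8, handled through
    \<open>s ^ 8 = 1/2\<close> so that only integer powers occur below.\<close>
  define s :: real where "s = root 8 (1/2)"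
  have s: "0 < s" "s < 1" "s ^ 8 = 1/2" by (auto simp: s_def)
  \<comment> \<open>The factor \<open>1 - s\<close> normalises the geometric series, so that the
    thresholds add up to at most \<delta>.\<close>
  define d where "d k = \<delta> * (1 - s) * s ^ k" for k
  have d0: "d k > 0" for k using s assms by (simp add: d_def)
  have dsum: "(\<Sum>k<n. d k) \<le> \<delta>" for n
  proof -
    have "(\<Sum>k<n. d k) = \<delta> * ((1 - s) * (\<Sum>k<n. s ^ k))" by (simp add: d_def sum_distrib_left mult.assoc)
    also have "(1 - s) * (\<Sum>k<n. s ^ k) = 1 - s ^ n" by (rule one_diff_power_eq[symmetric])
    finally show ?thesis using s assms by simp
  qed
  define A where "A m = m * (\<delta> * (1 - s))\<^sup>2 / (4 * C)" for m
  \<comment> \<open>The exponent equals \<open>A m\<close> times 2 to the power k/4. Its inverse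
    eighth power is of order 4^-k, which still leaves 2^-k after a union over 2^k cells.\<close>
  have tbound: "exp (- (m * (d k)\<^sup>2 * sqrt (2 ^ k) / (4 * C))) \<le> (8 / A m) ^ 8 * (1/4) ^ k" if "m > 0" for m k
  proof -
    have A: "A m > 0" using that s assms C by (simp add: A_def)
    have sq: "sqrt (2 ^ k) = 1 / s ^ (4 * k)"
    proof (rule real_sqrt_unique)
      have "(s ^ (4 * k))\<^sup>2 = (s ^ 8) ^ k" by (simp only: power_mult[symmetric]) (simp add: mult.commute)
      then show "(1 / s ^ (4 * k))\<^sup>2 = 2 ^ k" using s by (simp add: power_divide power_one_over)
    qed (use s in simp)
    have "m * (d k)\<^sup>2 * sqrt (2 ^ k) / (4 * C) = A m * ((s ^ k)\<^sup>2 / s ^ (4 * k))"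
      unfolding sq by (simp add: A_def d_def power_mult_distrib mult_ac)
    also have "(s ^ k)\<^sup>2 / s ^ (4 * k) = 1 / s ^ (2 * k)"
    proof -
      have "s ^ (4 * k) = (s ^ k)\<^sup>2 * s ^ (2 * k)"
        by (simp only: power_mult[symmetric] power_add[symmetric]) simp
      then show ?thesis using s by simp
    qed
    finally have "exp (- (m * (d k)\<^sup>2 * sqrt (2 ^ k) / (4 * C))) \<le> (real 8 / (A m * (1 / s ^ (2 * k)))) ^ 8"
      using A s by (simp only:) (intro exp_minus_le_power, auto)
    also have "\<dots> = (8 / A m) ^ 8 * (s ^ (2 * k)) ^ 8" by (simp add: power_mult_distrib power_divide)
    also have "(s ^ (2 * k)) ^ 8 = ((s ^ 8)\<^sup>2) ^ k" by (simp only: power_mult[symmetric]) (simp add: mult.commute)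
    also have "\<dots> = (1/4) ^ k" by (simp add: s(3) power_divide)
    finally show ?thesis .
  qed
  define D where "D \<gamma> k i j = {\<omega> \<in> space \<gamma>. d k < \<bar>dyadic_avg \<beta> (Suc k) j \<omega> - dyadic_avg \<beta> k i \<omega>\<bar>}" for \<gamma> k i j
  \<comment> \<open>The bad event of level k concerns both children of each cell, hence twice 2^k
    increments. The union over all levels has probability of order (1 / m)^8.\<close>
  define Bk where "Bk \<gamma> k = (\<Union>i\<in>{..<2 ^ k}. D \<gamma> k i (2 * i) \<union> D \<gamma> k i (2 * i + 1))" for \<gamma> k
  have main: "(\<Union>k. Bk \<gamma> k) \<in> sets \<gamma> \<and> measure \<gamma> (\<Union>k. Bk \<gamma> k) \<le> 4 * sqrt 2 * (8 / A m) ^ 8"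
    if m: "m > 0" and G: "gaussian_loop_measure \<beta> m \<gamma>" for m \<gamma>
  proof -
    have sets: "sets \<gamma> = sets (loop_borel \<beta>)" and ps: "prob_space \<gamma>" using G by (auto simp: gaussian_loop_measure_def)
    interpret prob_space \<gamma> by fact
    have Ds: "D \<gamma> k i j \<in> sets \<gamma>" if "i < 2 ^ k" "j \<in> {2 * i, 2 * i + 1}" for k i j
    proof -
      have "j < 2 ^ Suc k" using that by auto
      then have [measurable]: "dyadic_avg \<beta> (Suc k) j \<in> borel_measurable \<gamma>" "dyadic_avg \<beta> k i \<in> borel_measurable \<gamma>"
        using that by (auto intro!: dyadic_avg_measurable assms sets)
      show ?thesis unfolding D_def by measurable
    qed
    then have Bs: "Bk \<gamma> k \<in> sets \<gamma>" for k unfolding Bk_def by (intro sets.finite_UN sets.Un) auto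
    define T where "T k = sqrt 2 * ((8 / A m) ^ 8 * (1/4) ^ k)" for k
    have Dm: "measure \<gamma> (D \<gamma> k i j) \<le> T k" if "i < 2 ^ k" "j \<in> {2 * i, 2 * i + 1}" for k i j
      unfolding D_def T_def
      by (rule order_trans[OF C(2)[OF m G that]]) (use d0[of k] tbound[OF m, of k] in auto)
    have Bm: "measure \<gamma> (Bk \<gamma> k) \<le> 2 * sqrt 2 * (8 / A m) ^ 8 * (1/2) ^ k" for k
    proof -
      have "measure \<gamma> (Bk \<gamma> k) \<le> (\<Sum>i\<in>{..<2 ^ k}. measure \<gamma> (D \<gamma> k i (2 * i) \<union> D \<gamma> k i (2 * i + 1)))"
        unfolding Bk_def using Ds by (intro finite_measure_subadditive_finite) auto
      also have "\<dots> \<le> (\<Sum>i\<in>{..<(2::nat) ^ k}. 2 * T k)"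
      proof (rule sum_mono)
        fix i :: nat assume "i \<in> {..<2 ^ k}"
        then have "measure \<gamma> (D \<gamma> k i (2 * i)) \<le> T k" "measure \<gamma> (D \<gamma> k i (2 * i + 1)) \<le> T k"
          "D \<gamma> k i (2 * i) \<in> sets \<gamma>" "D \<gamma> k i (2 * i + 1) \<in> sets \<gamma>"
          by (auto intro!: Dm Ds)
        then show "measure \<gamma> (D \<gamma> k i (2 * i) \<union> D \<gamma> k i (2 * i + 1)) \<le> 2 * T k"
          using measure_Un_le[of "D \<gamma> k i (2 * i)" \<gamma> "D \<gamma> k i (2 * i + 1)"] by linarith
      qed
      also have "\<dots> = 2 ^ k * (2 * T k)" by simp
      also have "\<dots> = 2 * sqrt 2 * (8 / A m) ^ 8 * (2 ^ k * (1/4) ^ k)" by (simp add: T_def)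
      also have "(2 ^ k * (1/4) ^ k :: real) = (1/2) ^ k" by (simp add: power_mult_distrib[symmetric])
      finally show ?thesis .
    qed
    have S: "(\<lambda>k. 2 * sqrt 2 * (8 / A m) ^ 8 * (1/2) ^ k) sums (2 * sqrt 2 * (8 / A m) ^ 8 * (1 / (1 - 1/2)))"
      by (intro sums_mult geometric_sums) simp
    have sm: "summable (\<lambda>k. measure \<gamma> (Bk \<gamma> k))"
      by (rule summable_comparison_test'[OF sums_summable[OF S]]) (use Bm in auto)
    have "measure \<gamma> (\<Union>k. Bk \<gamma> k) \<le> (\<Sum>k. measure \<gamma> (Bk \<gamma> k))"
      by (rule finite_measure_subadditive_countably) (use Bs sm in auto)
    also have "\<dots> \<le> (\<Sum>k. 2 * sqrt 2 * (8 / A m) ^ 8 * (1/2) ^ k)"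
      by (rule suminf_le[OF Bm sm sums_summable[OF S]])
    also have "\<dots> = 4 * sqrt 2 * (8 / A m) ^ 8" using sums_unique[OF S] by simp
    finally show ?thesis using Bs by auto
  qed
  have close: "\<bar>\<omega> t - avg 0 \<beta> \<omega>\<bar> \<le> \<delta>"
    if G: "gaussian_loop_measure \<beta> m \<gamma>" and w: "\<omega> \<in> space \<gamma> - (\<Union>k. Bk \<gamma> k)" and t: "t \<in> {0..\<beta>}" for m \<gamma> \<omega> t
  proof -
    have "space \<gamma> = mspace (loop_metric \<beta>)"
      using G sets_eq_imp_space_eq[of \<gamma> "loop_borel \<beta>"] by (simp add: gaussian_loop_measure_def space_loop_borel)
    then have "\<omega> \<in> mspace (loop_metric \<beta>)" using w by auto
    note w' = mspace_loop_metricD[OF this]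
    show ?thesis
    proof (rule dyadic_chaining[OF assms(1) w' _ dsum t])
      fix k i j :: nat assume "i < 2 ^ k" "j \<in> {2 * i, 2 * i + 1}"
      then have "\<omega> \<notin> D \<gamma> k i j" using w by (auto simp: Bk_def)
      then show "\<bar>dyadic_avg \<beta> (Suc k) j \<omega> - dyadic_avg \<beta> k i \<omega>\<bar> \<le> d k" using w by (auto simp: D_def)
    qed
  qed
  have "\<forall>\<^sub>F m in at_top. 4 * sqrt 2 * (8 / A m) ^ 8 < e"
  proof (rule order_tendstoD(2)[OF _ \<open>e > 0\<close>])
    define c where "c = (\<delta> * (1 - s))\<^sup>2 / (4 * C)"
    have "c > 0" using s assms C by (simp add: c_def)
    have "A = (\<lambda>m. m * c)" by (rule ext) (simp add: A_def c_def)
    then show "((\<lambda>m. 4 * sqrt 2 * (8 / A m) ^ 8) \<longlongrightarrow> 0) at_top" using \<open>c > 0\<close> by simp real_asymp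
  qed
  with eventually_gt_at_top[of "0 :: real"] show ?thesis
  proof eventually_elim
    case (elim m)
    show ?case
    proof (intro allI impI)
      fix \<gamma> assume G: "gaussian_loop_measure \<beta> m \<gamma>"
      show "\<exists>B\<in>sets \<gamma>. measure \<gamma> B \<le> e \<and> (\<forall>\<omega>\<in>space \<gamma> - B. \<forall>t\<in>{0..\<beta>}. \<bar>\<omega> t - avg 0 \<beta> \<omega>\<bar> \<le> \<delta>)"
        using main[OF _ G] elim close[OF G] by (intro bexI[of _ "\<Union>k. Bk \<gamma> k"] conjI ballI) auto
    qed
  qed
qed

subsection \<open>Exponential moments\<close>

lemma nn_integral_le_LIMSEQ:
  fixes u :: "nat \<Rightarrow> 'w \<Rightarrow> real"
  assumes "\<And>k. u k \<in> borel_measurable M"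
    and lim: "\<And>w. w \<in> space M \<Longrightarrow> (\<lambda>k. u k w) \<longlonglongrightarrow> v w"
    and le: "\<And>k. (\<integral>\<^sup>+w. ennreal (u k w) \<partial>M) \<le> K"
  shows "(\<integral>\<^sup>+w. ennreal (v w) \<partial>M) \<le> K"
proof -
  have "(\<integral>\<^sup>+w. ennreal (v w) \<partial>M) = (\<integral>\<^sup>+w. liminf (\<lambda>k. ennreal (u k w)) \<partial>M)"
    by (intro nn_integral_cong lim_imp_Liminf[symmetric] tendsto_ennrealI lim) auto
  also have "\<dots> \<le> liminf (\<lambda>k. \<integral>\<^sup>+w. ennreal (u k w) \<partial>M)"
    using assms(1) by (intro nn_integral_liminf) auto
  also have "\<dots> \<le> liminf (\<lambda>k::nat. K)" by (intro Liminf_mono always_eventually allI le)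
  finally show ?thesis by (simp add: Liminf_const)
qed

text \<open>The Riemann sum is the equally weighted mean of \<beta> times the sampled values;
  convexity of exp reduces the path functional to single times.\<close>

lemma exp_dyadic_sum_le:
  assumes "\<beta> > 0"
  shows "exp (dyadic_sum 0 \<beta> F k) \<le> (\<Sum>i<2 ^ k. 1 / 2 ^ k * exp (\<beta> * F (real i * (\<beta> / 2 ^ k))))"
proof -
  have "exp (\<Sum>i<2 ^ k. (1 / 2 ^ k) *\<^sub>R (\<beta> * F (real i * (\<beta> / 2 ^ k)))) \<le> (\<Sum>i<2 ^ k. 1 / 2 ^ k * exp (\<beta> * F (real i * (\<beta> / 2 ^ k))))"
    by (rule convex_on_sum[OF _ _ exp_convex]) (auto simp: lessThan_empty_iff)
  then show ?thesis by (simp add: dyadic_sum_def sum_distrib_left)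
qed

text \<open>After Jensen's inequality the exponent at one time is \<kappa> \<beta> / 2 times a
  squared Gaussian of variance at most 1 / \<beta> + C / m. The moment is finite if \<kappa> \<beta>
  times the variance is below 1, so \<kappa> < 1 leaves room for the correction C / m once
  \<open>m\<close> is large; \<theta> is the midpoint between \<kappa> and 1.\<close>

lemma exp_square_moment:
  assumes "\<beta> > 0" "0 < \<kappa>" "\<kappa> < 1"
  shows "\<exists>K::real. \<forall>\<^sub>F m in at_top. \<forall>\<gamma>. gaussian_loop_measure \<beta> m \<gamma> \<longrightarrow>
    (\<integral>\<^sup>+\<omega>. ennreal (exp (\<kappa> / 2 * integral {0..\<beta>} (\<lambda>\<tau>. (\<omega> \<tau>)\<^sup>2))) \<partial>\<gamma>) \<le> ennreal K"
proof -
  obtain C where C: "C > 0" "\<And>m a b. m > 0 \<Longrightarrow> a < b \<Longrightarrow>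
    (\<Sum>\<^sub>\<infinity>n. inverse (m * (freq \<beta> n)\<^sup>2 + 1) * (avg a b (trig_basis \<beta> n))\<^sup>2) \<le> 1 / \<beta> + C / m"
    using avg_variance_le[OF assms(1)] by blast
  define \<theta> where "\<theta> = (1 + \<kappa>) / 2"
  have \<theta>: "\<kappa> < \<theta>" "\<theta> < 1" using assms by (auto simp: \<theta>_def)
  have "((\<lambda>m. \<kappa> * \<beta> * (1 / \<beta> + C / m)) \<longlongrightarrow> \<kappa> * \<beta> * (1 / \<beta> + 0)) at_top"
    by (intro tendsto_intros real_tendsto_divide_at_top[OF tendsto_const filterlim_ident])
  then have ev: "\<forall>\<^sub>F m in at_top. \<kappa> * \<beta> * (1 / \<beta> + C / m) < \<theta>"
    by (rule order_tendstoD(2)) (use \<theta> assms in auto)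
  define K where "K = 1 / sqrt (1 - \<theta>)"
  show ?thesis
  proof (rule exI[of _ K], use ev eventually_gt_at_top[of 0] in eventually_elim, intro allI impI)
    fix m \<gamma> assume m: "\<kappa> * \<beta> * (1 / \<beta> + C / m) < \<theta>" "m > 0" and G: "gaussian_loop_measure \<beta> m \<gamma>"
    have sets: "sets \<gamma> = sets (loop_borel \<beta>)" and ps: "prob_space \<gamma>" using G by (auto simp: gaussian_loop_measure_def)
    have sp: "space \<gamma> = mspace (loop_metric \<beta>)"
      using sets_eq_imp_space_eq[OF sets] by (simp add: space_loop_borel)
    have eval: "(\<lambda>\<omega>. \<omega> t) \<in> borel_measurable \<gamma>" if "t \<in> {0..\<beta>}" for t
      unfolding measurable_cong_sets[OF sets refl] by (rule loop_eval_measurable[OF that])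
    \<comment> \<open>The value at a single time is the limit of the dyadic averages around it, and
      Fatou's lemma passes their uniform bound on.\<close>
    have point: "(\<integral>\<^sup>+\<omega>. ennreal (exp (\<kappa> * \<beta> / 2 * (\<omega> t)\<^sup>2)) \<partial>\<gamma>) \<le> ennreal K" if t: "0 \<le> t" "t < \<beta>" for t
    proof (rule nn_integral_le_LIMSEQ)
      let ?A = "\<lambda>k. dyadic_avg \<beta> k (dyadic_index \<beta> t k)"
      have A[measurable]: "?A k \<in> borel_measurable \<gamma>" for k
        by (intro dyadic_avg_measurable assms dyadic_index t sets)
      show "(\<lambda>\<omega>. exp (\<kappa> * \<beta> / 2 * (?A k \<omega>)\<^sup>2)) \<in> borel_measurable \<gamma>" for k by measurable
      show "(\<lambda>k. exp (\<kappa> * \<beta> / 2 * (?A k \<omega>)\<^sup>2)) \<longlonglongrightarrow> exp (\<kappa> * \<beta> / 2 * (\<omega> t)\<^sup>2)" if "\<omega> \<in> space \<gamma>" for \<omega>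
        using that by (intro tendsto_intros dyadic_avg_LIMSEQ t) (auto simp: sp mspace_loop_metricD)
      fix k
      note sub = dyadic_interval_subset[OF assms(1) dyadic_index(3)[OF t, of k]]
      note D = distr_avg[OF G assms(1) m(2) sub, folded dyadic_avg_def]
      show "(\<integral>\<^sup>+\<omega>. ennreal (exp (\<kappa> * \<beta> / 2 * (?A k \<omega>)\<^sup>2)) \<partial>\<gamma>) \<le> ennreal K"
        unfolding K_def
      proof (rule nn_integral_exp_square_scaled_std_normal[OF D(1) A D(2) _ \<theta>(2)])
        let ?v = "\<Sum>\<^sub>\<infinity>n. inverse (m * (freq \<beta> n)\<^sup>2 + 1) * (dyadic_avg \<beta> k (dyadic_index \<beta> t k) (trig_basis \<beta> n))\<^sup>2"
        have "\<kappa> * \<beta> * ?v \<le> \<kappa> * \<beta> * (1 / \<beta> + C / m)"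
          using C(2)[OF m(2) sub(2)] assms by (intro mult_left_mono) (auto simp: dyadic_avg_def)
        then show "2 * (\<kappa> * \<beta> / 2) * ?v \<le> \<theta>" using m(1) by simp
      qed
    qed
    show "(\<integral>\<^sup>+\<omega>. ennreal (exp (\<kappa> / 2 * integral {0..\<beta>} (\<lambda>\<tau>. (\<omega> \<tau>)\<^sup>2))) \<partial>\<gamma>) \<le> ennreal K"
    proof (rule nn_integral_le_LIMSEQ)
      let ?F = "\<lambda>\<omega> \<tau>. \<kappa> / 2 * (\<omega> \<tau> :: real)\<^sup>2"
      \<comment> \<open>Sampling at left endpoints keeps the times strictly below \<beta>, as
        \<open>point\<close> requires.\<close>
      have ti: "real i * (\<beta> / 2 ^ k) \<in> {0..<\<beta>}" if "i < 2 ^ k" for i k :: nat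
        using dyadic_interval_subset[OF assms(1) that] by (simp add: mult.commute)
      have [measurable]: "(\<lambda>\<omega>. \<omega> (real i * (\<beta> / 2 ^ k))) \<in> borel_measurable \<gamma>" if "i < 2 ^ k" for i k
        by (rule eval) (use ti[OF that] in auto)
      have ds: "dyadic_sum 0 \<beta> F k = \<beta> / 2 ^ k * (\<Sum>i<2 ^ k. F (real i * (\<beta> / 2 ^ k)))" for F k
        by (simp add: dyadic_sum_def)
      show "(\<lambda>\<omega>. exp (dyadic_sum 0 \<beta> (?F \<omega>) k)) \<in> borel_measurable \<gamma>" for k
        unfolding ds by measurable
      show "(\<lambda>k. exp (dyadic_sum 0 \<beta> (?F \<omega>) k)) \<longlonglongrightarrow> exp (\<kappa> / 2 * integral {0..\<beta>} (\<lambda>\<tau>. (\<omega> \<tau>)\<^sup>2))"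
        if "\<omega> \<in> space \<gamma>" for \<omega>
      proof (intro tendsto_intros)
        have "dyadic_sum 0 \<beta> (?F \<omega>) \<longlonglongrightarrow> integral {0..\<beta>} (?F \<omega>)"
          using that assms by (intro dyadic_sum_LIMSEQ continuous_intros) (auto simp: sp mspace_loop_metricD)
        then show "dyadic_sum 0 \<beta> (?F \<omega>) \<longlonglongrightarrow> \<kappa> / 2 * integral {0..\<beta>} (\<lambda>\<tau>. (\<omega> \<tau>)\<^sup>2)" by simp
      qed
      fix k
      have "(\<integral>\<^sup>+\<omega>. ennreal (exp (dyadic_sum 0 \<beta> (?F \<omega>) k)) \<partial>\<gamma>)
          \<le> (\<integral>\<^sup>+\<omega>. (\<Sum>i<2 ^ k. ennreal (1 / 2 ^ k) * ennreal (exp (\<kappa> * \<beta> / 2 * (\<omega> (real i * (\<beta> / 2 ^ k)))\<^sup>2))) \<partial>\<gamma>)"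
      proof (rule nn_integral_mono)
        fix \<omega> :: "real \<Rightarrow> real"
        have "ennreal (exp (dyadic_sum 0 \<beta> (?F \<omega>) k)) \<le> ennreal (\<Sum>i<2 ^ k. 1 / 2 ^ k * exp (\<beta> * ?F \<omega> (real i * (\<beta> / 2 ^ k))))"
          by (intro ennreal_leI exp_dyadic_sum_le assms)
        also have "\<dots> = (\<Sum>i<2 ^ k. ennreal (1 / 2 ^ k) * ennreal (exp (\<kappa> * \<beta> / 2 * (\<omega> (real i * (\<beta> / 2 ^ k)))\<^sup>2)))"
          by (subst sum_ennreal[symmetric]) (auto simp: ennreal_mult'[symmetric] mult_ac)
        finally show "ennreal (exp (dyadic_sum 0 \<beta> (?F \<omega>) k)) \<le> \<dots>" .
      qed
      also have "\<dots> = (\<Sum>i<2 ^ k. ennreal (1 / 2 ^ k) * (\<integral>\<^sup>+\<omega>. ennreal (exp (\<kappa> * \<beta> / 2 * (\<omega> (real i * (\<beta> / 2 ^ k)))\<^sup>2)) \<partial>\<gamma>))"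
      proof -
        have m: "(\<lambda>\<omega>. ennreal (exp (\<kappa> * \<beta> / 2 * (\<omega> (real i * (\<beta> / 2 ^ k)))\<^sup>2))) \<in> borel_measurable \<gamma>" if "i \<in> {..<2 ^ k}" for i
          using that by (intro measurable_compose[OF _ measurable_ennreal] borel_measurable_exp[THEN measurable_compose[rotated]]
              borel_measurable_times borel_measurable_const borel_measurable_power eval) (use ti in force)
        show ?thesis
          using m by (subst nn_integral_sum) (auto intro!: sum.cong nn_integral_cmult simp del: times_divide_eq_right times_divide_eq_left)
      qed
      also have "\<dots> \<le> (\<Sum>i<(2::nat) ^ k. ennreal (1 / 2 ^ k) * ennreal K)"
        using ti by (intro sum_mono mult_left_mono point) auto
      also have "\<dots> = ennreal K"
      proof -
        have "(\<Sum>i<(2::nat) ^ k. ennreal (1 / 2 ^ k) * ennreal K) = (\<Sum>i<(2::nat) ^ k. ennreal (1 / 2 ^ k * K))"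
          by (intro sum.cong refl ennreal_mult'[symmetric]) simp
        also have "\<dots> = ennreal (\<Sum>i<(2::nat) ^ k. 1 / 2 ^ k * K)"
          using \<theta> by (intro sum_ennreal) (auto simp: K_def)
        finally show ?thesis by simp
      qed
      finally show "(\<integral>\<^sup>+\<omega>. ennreal (exp (dyadic_sum 0 \<beta> (?F \<omega>) k)) \<partial>\<gamma>) \<le> ennreal K" .
    qed
  qed
qed

subsection \<open>Path integrals for large mass\<close>

text \<open>The time variance of a path, the integral of its squared deviation from the mean, is
  nonnegative. This lets the squared L2 norm control weights evaluated at the mean.\<close>

lemma mean_square_le:
  assumes "\<beta> > 0" and w: "continuous_on {0..\<beta>} \<omega>"
  shows "\<beta> * (avg 0 \<beta> \<omega>)\<^sup>2 \<le> integral {0..\<beta>} (\<lambda>\<tau>. (\<omega> \<tau>)\<^sup>2)"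
proof -
  let ?x = "avg 0 \<beta> \<omega>"
  let ?I2 = "integral {0..\<beta>} (\<lambda>\<tau>. (\<omega> \<tau>)\<^sup>2)"
  have "((\<lambda>\<tau>. (\<omega> \<tau>)\<^sup>2) has_integral ?I2) {0..\<beta>}" "(\<omega> has_integral integral {0..\<beta>} \<omega>) {0..\<beta>}"
    using w by (auto intro!: integrable_integral integrable_continuous_real continuous_intros)
  then have h: "((\<lambda>\<tau>. (\<omega> \<tau>)\<^sup>2 - 2 * ?x * \<omega> \<tau> + ?x\<^sup>2) has_integral (?I2 - 2 * ?x * integral {0..\<beta>} \<omega> + (\<beta> - 0) * ?x\<^sup>2)) {0..\<beta>}"
    using has_integral_const_real[of "?x\<^sup>2" 0 \<beta>] assms(1)
    by (intro has_integral_add has_integral_diff has_integral_mult_right) auto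
  have sq: "(\<omega> \<tau>)\<^sup>2 - 2 * ?x * \<omega> \<tau> + ?x\<^sup>2 = (\<omega> \<tau> - ?x)\<^sup>2" for \<tau>
    by (simp add: power2_eq_square algebra_simps)
  have nn: "0 \<le> ?I2 - 2 * ?x * integral {0..\<beta>} \<omega> + (\<beta> - 0) * ?x\<^sup>2"
    by (rule has_integral_nonneg[OF h]) (simp only: sq zero_le_power2)
  have I: "integral {0..\<beta>} \<omega> = \<beta> * ?x" using assms(1) by (simp add: avg_def)
  have "2 * ?x * (\<beta> * ?x) = 2 * (\<beta> * ?x\<^sup>2)" by (simp add: power2_eq_square)
  then show ?thesis using nn unfolding I diff_zero by linarith
qed

lemma abs_exp_minus_one_le: "\<bar>exp u - 1\<bar> \<le> exp \<bar>u\<bar> - (1::real)"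
proof (cases "u \<ge> 0")
  case False
  \<comment> \<open>For negative \<open>u\<close> the claim is exactly that the hyperbolic cosine is
    at least 1.\<close>
  have "1 \<le> (exp u + exp (- u)) / 2" using cosh_real_ge_1[of u] by (simp add: cosh_def)
  then show ?thesis using False by simp
qed simp

text \<open>Isolates what the comparison uses of the lattice energy. \<open>V\<close> may tend to
  minus infinity quadratically; \<open>\<kappa>0 < 1\<close> is the margin left by the factor exp
  (-\<beta> x^2 / 2) of the reference measure. Continuity is uniform only around bounded
  \<open>x\<close>, as \<open>V\<close> may grow at any rate.\<close>

locale local_energy =
  fixes \<Lambda> :: "'i set" and V :: "('i \<Rightarrow> real) \<Rightarrow> real" and \<beta> \<kappa>0 b0 :: real
  assumes fin: "finite \<Lambda>" and beta: "\<beta> > 0" and kappa0: "0 \<le> \<kappa>0" "\<kappa>0 < 1"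
    and V_measurable: "V \<in> borel_measurable (PiM \<Lambda> (\<lambda>_. borel))"
    and V_ucont: "\<And>R e. e > 0 \<Longrightarrow> \<exists>\<delta>>0. \<forall>x y. (\<forall>j\<in>\<Lambda>. \<bar>x j\<bar> \<le> R \<and> \<bar>y j - x j\<bar> \<le> \<delta>) \<longrightarrow> \<bar>V y - V x\<bar> \<le> e"
    and V_lower: "\<And>x. V x \<ge> - \<kappa>0 / 2 * (\<Sum>j\<in>\<Lambda>. (x j)\<^sup>2) - b0"
begin

section \<open>Deterministic bounds for the weight of a path\<close>

definition path_energy :: "('i \<Rightarrow> real \<Rightarrow> real) \<Rightarrow> real" where
  "path_energy \<omega> = integral {0..\<beta>} (\<lambda>\<tau>. V (\<lambda>j\<in>\<Lambda>. \<omega> j \<tau>))"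

definition mean :: "('i \<Rightarrow> real \<Rightarrow> real) \<Rightarrow> 'i \<Rightarrow> real" where
  "mean \<omega> = (\<lambda>j\<in>\<Lambda>. avg 0 \<beta> (\<omega> j))"

definition L2_norm2 :: "('i \<Rightarrow> real \<Rightarrow> real) \<Rightarrow> real" where
  "L2_norm2 \<omega> = (\<Sum>j\<in>\<Lambda>. integral {0..\<beta>} (\<lambda>\<tau>. (\<omega> j \<tau>)\<^sup>2))"

lemma continuous_on_V_path:
  assumes "\<And>j. j \<in> \<Lambda> \<Longrightarrow> continuous_on {0..\<beta>} (\<omega> j)"
  shows "continuous_on {0..\<beta>} (\<lambda>\<tau>. V (\<lambda>j\<in>\<Lambda>. \<omega> j \<tau>))"
  unfolding continuous_on
proof
  fix t assume t: "t \<in> {0..\<beta>}"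
  show "((\<lambda>\<tau>. V (\<lambda>j\<in>\<Lambda>. \<omega> j \<tau>)) \<longlongrightarrow> V (\<lambda>j\<in>\<Lambda>. \<omega> j t)) (at t within {0..\<beta>})"
  proof (rule tendstoI)
    fix e :: real assume "e > 0"
    define R where "R = (\<Sum>j\<in>\<Lambda>. \<bar>\<omega> j t\<bar>)"
    have R: "\<bar>\<omega> j t\<bar> \<le> R" if "j \<in> \<Lambda>" for j
      unfolding R_def by (rule member_le_sum) (use fin that in auto)
    obtain \<delta> where \<delta>: "\<delta> > 0"
      "\<And>x y. (\<And>j. j \<in> \<Lambda> \<Longrightarrow> \<bar>x j\<bar> \<le> R \<and> \<bar>y j - x j\<bar> \<le> \<delta>) \<Longrightarrow> \<bar>V y - V x\<bar> \<le> e / 2"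
      using V_ucont[of "e / 2" R] \<open>e > 0\<close> by (metis half_gt_zero)
    have "\<forall>\<^sub>F \<tau> in at t within {0..\<beta>}. \<forall>j\<in>\<Lambda>. dist (\<omega> j \<tau>) (\<omega> j t) < \<delta>"
      using assms t \<delta>(1) by (intro eventually_ball_finite[OF fin] ballI tendstoD) (auto simp: continuous_on)
    then show "\<forall>\<^sub>F \<tau> in at t within {0..\<beta>}. dist (V (\<lambda>j\<in>\<Lambda>. \<omega> j \<tau>)) (V (\<lambda>j\<in>\<Lambda>. \<omega> j t)) < e"
    proof eventually_elim
      case (elim \<tau>)
      have "\<bar>V (\<lambda>j\<in>\<Lambda>. \<omega> j \<tau>) - V (\<lambda>j\<in>\<Lambda>. \<omega> j t)\<bar> \<le> e / 2"
        by (rule \<delta>(2)) (use elim R in \<open>auto simp: dist_real_def less_imp_le\<close>)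
      then show ?case using \<open>e > 0\<close> by (simp add: dist_real_def)
    qed
  qed
qed

lemma mean_norm_le:
  assumes "\<And>j. j \<in> \<Lambda> \<Longrightarrow> continuous_on {0..\<beta>} (\<omega> j)"
  shows "\<beta> * (\<Sum>j\<in>\<Lambda>. (mean \<omega> j)\<^sup>2) \<le> L2_norm2 \<omega>"
  unfolding L2_norm2_def sum_distrib_left
  by (rule sum_mono) (use assms beta in \<open>auto simp: mean_def intro!: mean_square_le\<close>)

lemma L2_norm2_nonneg:
  assumes "\<And>j. j \<in> \<Lambda> \<Longrightarrow> continuous_on {0..\<beta>} (\<omega> j)"
  shows "0 \<le> L2_norm2 \<omega>"
proof -
  have "0 \<le> \<beta> * (\<Sum>j\<in>\<Lambda>. (mean \<omega> j)\<^sup>2)" using beta by (simp add: sum_nonneg)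
  also have "\<dots> \<le> L2_norm2 \<omega>" by (rule mean_norm_le[OF assms])
  finally show ?thesis .
qed

lemma path_energy_lower:
  assumes w: "\<And>j. j \<in> \<Lambda> \<Longrightarrow> continuous_on {0..\<beta>} (\<omega> j)"
  shows "path_energy \<omega> \<ge> - \<kappa>0 / 2 * L2_norm2 \<omega> - \<beta> * b0"
proof -
  let ?f = "\<lambda>\<tau>. - \<kappa>0 / 2 * (\<Sum>j\<in>\<Lambda>. (\<omega> j \<tau>)\<^sup>2) - b0"
  have "((\<lambda>\<tau>. (\<omega> j \<tau>)\<^sup>2) has_integral integral {0..\<beta>} (\<lambda>\<tau>. (\<omega> j \<tau>)\<^sup>2)) {0..\<beta>}" if "j \<in> \<Lambda>" for j
    using w[OF that] by (intro integrable_integral integrable_continuous_real continuous_intros)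
  then have "((\<lambda>\<tau>. \<Sum>j\<in>\<Lambda>. (\<omega> j \<tau>)\<^sup>2) has_integral L2_norm2 \<omega>) {0..\<beta>}"
    unfolding L2_norm2_def using fin by (intro has_integral_sum) auto
  from has_integral_mult_right[OF this, of "- \<kappa>0 / 2"] has_integral_const_real[of b0 0 \<beta>]
  have f: "(?f has_integral (- \<kappa>0 / 2 * L2_norm2 \<omega> - \<beta> * b0)) {0..\<beta>}"
    using beta by (intro has_integral_diff) auto
  have "((\<lambda>\<tau>. V (\<lambda>j\<in>\<Lambda>. \<omega> j \<tau>)) has_integral path_energy \<omega>) {0..\<beta>}"
    unfolding path_energy_def using w by (intro integrable_integral integrable_continuous_real continuous_on_V_path)
  with f show ?thesis
  proof (rule has_integral_le)
    fix \<tau>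
    have "(\<Sum>j\<in>\<Lambda>. ((\<lambda>j\<in>\<Lambda>. \<omega> j \<tau>) j)\<^sup>2) = (\<Sum>j\<in>\<Lambda>. (\<omega> j \<tau>)\<^sup>2)" by (rule sum.cong) auto
    then show "?f \<tau> \<le> V (\<lambda>j\<in>\<Lambda>. \<omega> j \<tau>)" using V_lower[of "\<lambda>j\<in>\<Lambda>. \<omega> j \<tau>"] by simp
  qed
qed

lemma path_energy_close:
  assumes w: "\<And>j. j \<in> \<Lambda> \<Longrightarrow> continuous_on {0..\<beta>} (\<omega> j)"
    and "\<And>\<tau>. \<tau> \<in> {0..\<beta>} \<Longrightarrow> \<bar>V (\<lambda>j\<in>\<Lambda>. \<omega> j \<tau>) - y\<bar> \<le> e"
  shows "\<bar>path_energy \<omega> - \<beta> * y\<bar> \<le> \<beta> * e"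
proof -
  have "\<bar>avg 0 \<beta> (\<lambda>\<tau>. V (\<lambda>j\<in>\<Lambda>. \<omega> j \<tau>)) - y\<bar> \<le> e"
    by (rule avg_bound) (use beta assms continuous_on_V_path in auto)
  then have "\<beta> * \<bar>path_energy \<omega> / \<beta> - y\<bar> \<le> \<beta> * e"
    using beta by (intro mult_left_mono) (auto simp: avg_def path_energy_def)
  moreover have "\<beta> * \<bar>path_energy \<omega> / \<beta> - y\<bar> = \<bar>\<beta> * (path_energy \<omega> / \<beta> - y)\<bar>" using beta by (simp add: abs_mult)
  moreover have "\<beta> * (path_energy \<omega> / \<beta> - y) = path_energy \<omega> - \<beta> * y" using beta by (simp add: field_simps)
  ultimately show ?thesis by simp
qed

text \<open>One exponential of the squared L2 norm dominates both weights, because \<beta> times the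
  squared norm of the mean is at most \<open>L2_norm2\<close>. The growth rate \<alpha> of the
  observable adds to the exponent.\<close>

lemma weight_bounds:
  assumes w: "\<And>j. j \<in> \<Lambda> \<Longrightarrow> continuous_on {0..\<beta>} (\<omega> j)"
    and g: "\<And>x. \<bar>g x\<bar> \<le> Cg * exp (\<alpha> / 2 * (\<beta> * (\<Sum>j\<in>\<Lambda>. (x j)\<^sup>2)))" and "\<alpha> \<ge> 0" "Cg \<ge> 0"
  shows "\<bar>g (mean \<omega>) * exp (- path_energy \<omega>)\<bar> \<le> Cg * exp (\<beta> * b0) * exp ((\<kappa>0 + \<alpha>) / 2 * L2_norm2 \<omega>)"
    and "\<bar>g (mean \<omega>) * exp (- \<beta> * V (mean \<omega>))\<bar> \<le> Cg * exp (\<beta> * b0) * exp ((\<kappa>0 + \<alpha>) / 2 * L2_norm2 \<omega>)"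
proof -
  let ?S = "L2_norm2 \<omega>" and ?s = "\<Sum>j\<in>\<Lambda>. (mean \<omega> j)\<^sup>2"
  have s: "\<beta> * ?s \<le> ?S" by (rule mean_norm_le[OF w])
  have "\<alpha> / 2 * (\<beta> * ?s) \<le> \<alpha> / 2 * ?S" using s assms by (intro mult_left_mono) auto
  then have g': "\<bar>g (mean \<omega>)\<bar> \<le> Cg * exp (\<alpha> / 2 * ?S)"
    by (intro order_trans[OF g] mult_left_mono) (use assms in auto)
  have *: "\<bar>g (mean \<omega>) * exp (- u)\<bar> \<le> Cg * exp (\<beta> * b0) * exp ((\<kappa>0 + \<alpha>) / 2 * ?S)"
    if "u \<ge> - \<kappa>0 / 2 * ?S - \<beta> * b0" for u
  proof -
    have "\<bar>g (mean \<omega>)\<bar> * exp (- u) \<le> Cg * exp (\<alpha> / 2 * ?S) * exp (\<kappa>0 / 2 * ?S + \<beta> * b0)"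
      using g' that assms by (intro mult_mono) auto
    also have "\<dots> = Cg * (exp (\<beta> * b0) * exp ((\<kappa>0 + \<alpha>) / 2 * ?S))"
    proof -
      have "\<alpha> / 2 * ?S + (\<kappa>0 / 2 * ?S + \<beta> * b0) = \<beta> * b0 + (\<kappa>0 + \<alpha>) / 2 * ?S" by (simp add: field_simps)
      then show ?thesis by (simp only: mult.assoc exp_add[symmetric])
    qed
    finally show ?thesis by (simp add: abs_mult mult.assoc)
  qed
  show "\<bar>g (mean \<omega>) * exp (- path_energy \<omega>)\<bar> \<le> Cg * exp (\<beta> * b0) * exp ((\<kappa>0 + \<alpha>) / 2 * ?S)"
    by (rule *) (rule path_energy_lower[OF w])
  have "\<beta> * V (mean \<omega>) \<ge> \<beta> * (- \<kappa>0 / 2 * ?s - b0)"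
    using V_lower beta by (intro mult_left_mono) auto
  moreover have "\<kappa>0 / 2 * (\<beta> * ?s) \<le> \<kappa>0 / 2 * ?S" using s kappa0 by (intro mult_left_mono) auto
  ultimately have "\<beta> * V (mean \<omega>) \<ge> - \<kappa>0 / 2 * ?S - \<beta> * b0" by (simp add: algebra_simps)
  from *[OF this] show "\<bar>g (mean \<omega>) * exp (- \<beta> * V (mean \<omega>))\<bar> \<le> Cg * exp (\<beta> * b0) * exp ((\<kappa>0 + \<alpha>) / 2 * ?S)" by simp
qed

text \<open>Three regimes. For a large norm, the gap between \<open>\<kappa>0 + \<alpha>\<close> and
  \<kappa> absorbs the dominating bound into the first term. For a bounded norm and loops close to
  their means, uniform continuity of \<open>V\<close> makes the relative error small. Otherwise the
  crude bound \<open>K\<close> is paid. The choice of \<delta> and \<open>K\<close> involves no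
  mass, so concentration can be invoked afterwards.\<close>

lemma weight_difference_bound:
  assumes g: "\<And>x. \<bar>g x\<bar> \<le> Cg * exp (\<alpha> / 2 * (\<beta> * (\<Sum>j\<in>\<Lambda>. (x j)\<^sup>2)))" and "\<alpha> \<ge> 0" "Cg > 0"
    and \<kappa>: "\<kappa>0 + \<alpha> < \<kappa>" and "e > 0"
  obtains \<delta> K where "\<delta> > 0" "K > 0"
    and "\<And>\<omega>. (\<And>j. j \<in> \<Lambda> \<Longrightarrow> continuous_on {0..\<beta>} (\<omega> j)) \<Longrightarrow>
      \<bar>g (mean \<omega>) * exp (- path_energy \<omega>) - g (mean \<omega>) * exp (- \<beta> * V (mean \<omega>))\<bar> \<le>
      e * exp (\<kappa> / 2 * L2_norm2 \<omega>) +
      (if \<forall>j\<in>\<Lambda>. \<forall>t\<in>{0..\<beta>}. \<bar>\<omega> j t - avg 0 \<beta> (\<omega> j)\<bar> \<le> \<delta> then 0 else K)"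
proof -
  define \<kappa>1 where "\<kappa>1 = \<kappa>0 + \<alpha>"
  have \<kappa>1: "0 \<le> \<kappa>1" "\<kappa>1 < \<kappa>" using assms kappa0 by (auto simp: \<kappa>1_def)
  define A where "A = Cg * exp (\<beta> * b0)"
  have A: "A > 0" using assms by (simp add: A_def)
  \<comment> \<open>The threshold solves
    \<open>2 * A * exp (\<kappa>1 / 2 * s) = e * exp (\<kappa> / 2 * s)\<close> for
    \<open>s\<close>, cut off at 0.\<close>
  define s0 where "s0 = max 0 (2 / (\<kappa> - \<kappa>1) * ln (2 * A / e))"
  have s0: "2 * A * exp (\<kappa>1 / 2 * s) \<le> e * exp (\<kappa> / 2 * s)" if "s \<ge> s0" for s
  proof -
    have "2 / (\<kappa> - \<kappa>1) * ln (2 * A / e) \<le> s" using that by (simp add: s0_def)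
    then have "ln (2 * A / e) \<le> (\<kappa> - \<kappa>1) / 2 * s" using \<kappa>1 by (simp add: field_simps)
    then have "exp (ln (2 * A / e)) \<le> exp ((\<kappa> - \<kappa>1) / 2 * s)" by (simp only: exp_le_cancel_iff)
    then have "2 * A / e \<le> exp ((\<kappa> - \<kappa>1) / 2 * s)" using A \<open>e > 0\<close> by simp
    then have "2 * A \<le> e * exp ((\<kappa> - \<kappa>1) / 2 * s)" using \<open>e > 0\<close> by (simp add: field_simps)
    then have "2 * A * exp (\<kappa>1 / 2 * s) \<le> e * exp ((\<kappa> - \<kappa>1) / 2 * s) * exp (\<kappa>1 / 2 * s)" by (intro mult_right_mono) auto
    also have "\<dots> = e * exp (\<kappa> / 2 * s)"
    proof -
      have "(\<kappa> - \<kappa>1) / 2 * s + \<kappa>1 / 2 * s = \<kappa> / 2 * s" by (simp add: field_simps)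
      then show ?thesis by (simp only: mult.assoc exp_add[symmetric])
    qed
    finally show ?thesis .
  qed
  define K where "K = 2 * A * exp (\<kappa>1 / 2 * s0)"
  have K: "K > 0" using A by (simp add: K_def)
  \<comment> \<open>Energies that differ by at most \<open>\<beta> * e2\<close> give weights whose
    ratio is within \<open>e / K\<close> of 1; the weight of the mean is at most
    \<open>K / 2\<close>.\<close>
  define e2 where "e2 = ln (1 + e / K) / \<beta>"
  have "e2 > 0" "exp (\<beta> * e2) - 1 = e / K" using K \<open>e > 0\<close> beta by (auto simp: e2_def ln_gt_zero add_pos_pos)
  \<comment> \<open>If the norm stays below \<open>s0\<close>, each squared mean is below
    \<open>s0 / \<beta>\<close>.\<close>
  define R where "R = sqrt (s0 / \<beta>)"
  obtain \<delta> where \<delta>: "\<delta> > 0"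
    "\<And>x y. (\<And>j. j \<in> \<Lambda> \<Longrightarrow> \<bar>x j\<bar> \<le> R \<and> \<bar>y j - x j\<bar> \<le> \<delta>) \<Longrightarrow> \<bar>V y - V x\<bar> \<le> e2"
    using V_ucont[OF \<open>e2 > 0\<close>, of R] by metis
  show thesis
  proof (rule that[OF \<delta>(1) K])
    fix \<omega> :: "'i \<Rightarrow> real \<Rightarrow> real" assume w: "\<And>j. j \<in> \<Lambda> \<Longrightarrow> continuous_on {0..\<beta>} (\<omega> j)"
    let ?G = "g (mean \<omega>) * exp (- path_energy \<omega>)" and ?H = "g (mean \<omega>) * exp (- \<beta> * V (mean \<omega>))"
    let ?S = "L2_norm2 \<omega>"
    have Cg0: "Cg \<ge> 0" using assms by simp
    note b = weight_bounds[of \<omega> g Cg \<alpha>, OF w g \<open>\<alpha> \<ge> 0\<close> Cg0, folded A_def \<kappa>1_def]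
    then have d: "\<bar>?G - ?H\<bar> \<le> 2 * A * exp (\<kappa>1 / 2 * ?S)" by linarith
    have S0: "?S \<ge> 0" by (rule L2_norm2_nonneg[OF w])
    show "\<bar>?G - ?H\<bar> \<le> e * exp (\<kappa> / 2 * ?S) +
        (if \<forall>j\<in>\<Lambda>. \<forall>t\<in>{0..\<beta>}. \<bar>\<omega> j t - avg 0 \<beta> (\<omega> j)\<bar> \<le> \<delta> then 0 else K)"
    proof (cases "?S \<ge> s0")
      case True
      then show ?thesis using d s0[OF True] K by auto
    next
      case False
      then have dK: "A * exp (\<kappa>1 / 2 * ?S) \<le> K / 2"
        using \<kappa>1 A by (auto simp: K_def intro!: mult_left_mono)
      show ?thesis
      proof (cases "\<forall>j\<in>\<Lambda>. \<forall>t\<in>{0..\<beta>}. \<bar>\<omega> j t - avg 0 \<beta> (\<omega> j)\<bar> \<le> \<delta>")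
        case F: False
        have "0 \<le> e * exp (\<kappa> / 2 * ?S)" using \<open>e > 0\<close> by simp
        then show ?thesis unfolding if_not_P[OF F] using d dK by linarith
      next
        case T: True
        have xR: "\<bar>mean \<omega> j\<bar> \<le> R" if "j \<in> \<Lambda>" for j
        proof -
          have "(mean \<omega> j)\<^sup>2 \<le> (\<Sum>j\<in>\<Lambda>. (mean \<omega> j)\<^sup>2)" by (rule member_le_sum) (use fin that in auto)
          also have "\<dots> \<le> s0 / \<beta>" using mean_norm_le[of \<omega>, OF w] False beta by (simp add: field_simps)
          finally show ?thesis unfolding R_def by (simp add: real_le_rsqrt)
        qed
        have "\<bar>path_energy \<omega> - \<beta> * V (mean \<omega>)\<bar> \<le> \<beta> * e2"
        proof (rule path_energy_close[OF w])
          fix \<tau> assume "\<tau> \<in> {0..\<beta>}"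
          then show "\<bar>V (\<lambda>j\<in>\<Lambda>. \<omega> j \<tau>) - V (mean \<omega>)\<bar> \<le> e2"
            by (intro \<delta>(2)) (use T xR in \<open>auto simp: mean_def\<close>)
        qed
        then have u: "\<bar>exp (- (path_energy \<omega> - \<beta> * V (mean \<omega>))) - 1\<bar> \<le> e / K"
          using abs_exp_minus_one_le[of "- (path_energy \<omega> - \<beta> * V (mean \<omega>))"] \<open>exp (\<beta> * e2) - 1 = e / K\<close>
          by (smt (verit) abs_minus_cancel exp_le_cancel_iff)
        \<comment> \<open>Factoring out the weight of the mean leaves only the energy difference,
          which uniform continuity controls.\<close>
        have "?G - ?H = ?H * (exp (- (path_energy \<omega> - \<beta> * V (mean \<omega>))) - 1)"
        proof -
          have "exp (- \<beta> * V (mean \<omega>)) * exp (- (path_energy \<omega> - \<beta> * V (mean \<omega>))) = exp (- path_energy \<omega>)"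
            by (subst exp_add[symmetric]) simp
          then show ?thesis by (simp only: right_diff_distrib mult.assoc mult_1_right)
        qed
        then have "\<bar>?G - ?H\<bar> = \<bar>?H\<bar> * \<bar>exp (- (path_energy \<omega> - \<beta> * V (mean \<omega>))) - 1\<bar>"
          by (simp only: abs_mult)
        also have "\<dots> \<le> K / 2 * (e / K)"
          by (rule mult_mono) (use u b(2) dK K in auto)
        also have "\<dots> \<le> e * 1" using K \<open>e > 0\<close> by simp
        also have "\<dots> \<le> e * exp (\<kappa> / 2 * ?S)"
          using \<open>e > 0\<close> S0 \<kappa>1 by (intro mult_left_mono) auto
        finally show ?thesis using T by simp
      qed
    qed
  qed
qed

end

lemma distr_std_normal_scaled:
  assumes "\<beta> > 0"
  shows "distr std_normal_distribution borel (\<lambda>z. sqrt (1 / \<beta>) * z) =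
    density lborel (\<lambda>x. ennreal (sqrt (\<beta> / (2 * pi)) * exp (- \<beta> * x\<^sup>2 / 2)))"
proof -
  interpret prob_space std_normal_distribution by (rule prob_space_normal_density) simp
  have "distributed std_normal_distribution lborel (\<lambda>x. x) std_normal_density"
    by (auto simp: distributed_def distr_id2)
  from normal_density_affine[OF this, of "sqrt (1 / \<beta>)" 0]
  have "distr std_normal_distribution lborel (\<lambda>z. sqrt (1 / \<beta>) * z) = density lborel (normal_density 0 (sqrt (1 / \<beta>)))"
    using assms by (simp add: distributed_def)
  moreover have "normal_density 0 (sqrt (1 / \<beta>)) x = sqrt (\<beta> / (2 * pi)) * exp (- \<beta> * x\<^sup>2 / 2)" for x
    using assms by (simp add: normal_density_def real_sqrt_divide real_sqrt_mult field_simps)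
  moreover have "distr std_normal_distribution borel (\<lambda>z. sqrt (1 / \<beta>) * z) = distr std_normal_distribution lborel (\<lambda>z. sqrt (1 / \<beta>) * z)"
    by (rule distr_cong) auto
  ultimately show ?thesis by simp
qed

section \<open>Integration over the product of loop measures\<close>

context local_energy
begin

abbreviation classical_ref :: "('i \<Rightarrow> real) measure" where
  "classical_ref \<equiv> PiM \<Lambda> (\<lambda>_. density lborel (\<lambda>x. ennreal (sqrt (\<beta> / (2 * pi)) * exp (- \<beta> * x\<^sup>2 / 2))))"

context
  fixes m :: real and \<gamma> :: "(real \<Rightarrow> real) measure"
  assumes m: "m > 0" and G: "gaussian_loop_measure \<beta> m \<gamma>"
begin

lemma prob_space_gamma: "prob_space \<gamma>" and sets_gamma: "sets \<gamma> = sets (loop_borel \<beta>)"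
  using G by (auto simp: gaussian_loop_measure_def)

lemma space_gamma: "space \<gamma> = mspace (loop_metric \<beta>)"
  using sets_eq_imp_space_eq[OF sets_gamma] by (simp add: space_loop_borel)

lemma path_continuous:
  assumes "\<omega> \<in> space (PiM \<Lambda> (\<lambda>_. \<gamma>))" "j \<in> \<Lambda>"
  shows "continuous_on {0..\<beta>} (\<omega> j)"
  using assms by (auto simp: space_PiM space_gamma intro: mspace_loop_metricD)

lemma path_eval_measurable:
  assumes "t \<in> {0..\<beta>}" "j \<in> \<Lambda>"
  shows "(\<lambda>\<omega>. \<omega> j t) \<in> borel_measurable (PiM \<Lambda> (\<lambda>_. \<gamma>))"
proof -
  have "(\<lambda>\<eta>. \<eta> t) \<in> borel_measurable \<gamma>"
    unfolding measurable_cong_sets[OF sets_gamma refl] by (rule loop_eval_measurable[OF assms(1)])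
  then show ?thesis using measurable_compose[OF measurable_component_singleton[OF assms(2)]] by fast
qed

lemma mean_measurable: "mean \<in> measurable (PiM \<Lambda> (\<lambda>_. \<gamma>)) (PiM \<Lambda> (\<lambda>_. borel))"
  unfolding mean_def avg_def
  using beta path_continuous path_eval_measurable
  by (intro measurable_restrict borel_measurable_divide borel_measurable_const borel_measurable_integral_eval) auto

lemma path_energy_measurable: "path_energy \<in> borel_measurable (PiM \<Lambda> (\<lambda>_. \<gamma>))"
  unfolding path_energy_def[abs_def]
proof (rule borel_measurable_integral_eval[OF beta])
  fix t assume "t \<in> {0..\<beta>}"
  then have "(\<lambda>\<omega>. \<lambda>j\<in>\<Lambda>. \<omega> j t) \<in> measurable (PiM \<Lambda> (\<lambda>_. \<gamma>)) (PiM \<Lambda> (\<lambda>_. borel))"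
    by (intro measurable_restrict path_eval_measurable)
  then show "(\<lambda>\<omega>. V (\<lambda>j\<in>\<Lambda>. \<omega> j t)) \<in> borel_measurable (PiM \<Lambda> (\<lambda>_. \<gamma>))"
    using V_measurable by (rule measurable_compose)
qed (intro continuous_on_V_path path_continuous)

lemma square_integral_measurable: "(\<lambda>\<eta>. integral {0..\<beta>} (\<lambda>\<tau>. (\<eta> \<tau>)\<^sup>2)) \<in> borel_measurable \<gamma>"
proof (rule borel_measurable_integral_eval[OF beta])
  fix t assume "t \<in> {0..\<beta>}"
  then show "(\<lambda>\<eta>. (\<eta> t)\<^sup>2) \<in> borel_measurable \<gamma>"
    unfolding measurable_cong_sets[OF sets_gamma refl]
    by (intro borel_measurable_power loop_eval_measurable)
qed (rule continuous_on_power, rule mspace_loop_metricD, simp add: space_gamma)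

text \<open>The means of independent loops are independent with the one-site reference law. The
  identity is exact for every \<open>m\<close>, so classical integrals can be written on the loop
  space without an error term.\<close>

lemma distr_path_mean: "distr (PiM \<Lambda> (\<lambda>_. \<gamma>)) (PiM \<Lambda> (\<lambda>_. borel)) mean = classical_ref"
proof -
  let ?N = "distr \<gamma> borel (avg 0 \<beta>)"
  have mean: "mean = compose \<Lambda> (avg 0 \<beta>)" by (rule ext) (simp add: mean_def compose_def)
  have a: "avg 0 \<beta> \<in> borel_measurable \<gamma>"
    unfolding measurable_cong_sets[OF sets_gamma refl] using beta by (intro avg_measurable) auto
  \<comment> \<open>The target is replaced by a product with the same \<sigma>-algebra, the form in
    which image measures of products factorise.\<close>
  have "distr (PiM \<Lambda> (\<lambda>_. \<gamma>)) (PiM \<Lambda> (\<lambda>_. borel)) mean = distr (PiM \<Lambda> (\<lambda>_. \<gamma>)) (PiM \<Lambda> (\<lambda>_. ?N)) mean"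
    by (intro distr_cong sets_PiM_cong) auto
  also have "\<dots> = PiM \<Lambda> (\<lambda>_. distr \<gamma> ?N (avg 0 \<beta>))"
    unfolding mean using a prob_space_gamma
    by (intro distr_PiM_finite_prob_space' fin prob_space.prob_space_distr) auto
  also have "distr \<gamma> ?N (avg 0 \<beta>) = ?N" by (rule distr_cong) auto
  finally have "distr (PiM \<Lambda> (\<lambda>_. \<gamma>)) (PiM \<Lambda> (\<lambda>_. borel)) mean = PiM \<Lambda> (\<lambda>_. ?N)" .
  then show ?thesis by (simp only: distr_mean[OF G beta m] distr_std_normal_scaled[OF beta])
qed

text \<open>The norm is a sum over sites, so its exponential factorises under the product measure.
  The absolute value makes the power monotone for a bound \<open>K\<close> of unknown sign.\<close>

lemma exp_L2_norm2_moment: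
  assumes "(\<integral>\<^sup>+\<eta>. ennreal (exp (\<kappa> / 2 * integral {0..\<beta>} (\<lambda>\<tau>. (\<eta> \<tau>)\<^sup>2))) \<partial>\<gamma>) \<le> ennreal K"
  shows "(\<integral>\<^sup>+\<omega>. ennreal (exp (\<kappa> / 2 * L2_norm2 \<omega>)) \<partial>PiM \<Lambda> (\<lambda>_. \<gamma>)) \<le> ennreal (\<bar>K\<bar> ^ card \<Lambda>)"
proof -
  interpret product_prob_space "\<lambda>_. \<gamma>" \<Lambda>
    by (intro product_prob_spaceI prob_space_gamma)
  let ?h = "\<lambda>\<eta>. exp (\<kappa> / 2 * integral {0..\<beta>} (\<lambda>\<tau>. (\<eta> \<tau> :: real)\<^sup>2))"
  have "(\<integral>\<^sup>+\<omega>. ennreal (exp (\<kappa> / 2 * L2_norm2 \<omega>)) \<partial>PiM \<Lambda> (\<lambda>_. \<gamma>)) = (\<integral>\<^sup>+\<omega>. (\<Prod>j\<in>\<Lambda>. ennreal (?h (\<omega> j))) \<partial>PiM \<Lambda> (\<lambda>_. \<gamma>))"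
    by (intro nn_integral_cong) (simp add: L2_norm2_def sum_distrib_left exp_sum fin prod_ennreal)
  also have "\<dots> = (\<Prod>j\<in>\<Lambda>. \<integral>\<^sup>+\<eta>. ennreal (?h \<eta>) \<partial>\<gamma>)"
    using square_integral_measurable by (intro product_nn_integral_prod fin) auto
  also have "\<dots> \<le> (\<Prod>j\<in>\<Lambda>. ennreal \<bar>K\<bar>)"
    by (intro prod_mono_ennreal order_trans[OF assms] ennreal_leI) auto
  also have "\<dots> = ennreal (\<bar>K\<bar> ^ card \<Lambda>)" by (simp add: ennreal_power)
  finally show ?thesis .
qed

end

text \<open>Integrates the deterministic comparison: the first term costs the exponential moment,
  the second a union bound over the sites. Integrability comes from domination by the same moment,
  and passes to the classical side along the mean.\<close>

lemma weight_integrals_close: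
  assumes m: "m > 0" and G: "gaussian_loop_measure \<beta> m \<gamma>"
    and gm: "g \<in> borel_measurable (PiM \<Lambda> (\<lambda>_. borel))"
    and g: "\<And>x. \<bar>g x\<bar> \<le> Cg * exp (\<alpha> / 2 * (\<beta> * (\<Sum>j\<in>\<Lambda>. (x j)\<^sup>2)))" and "\<alpha> \<ge> 0" "Cg > 0"
    and \<kappa>: "\<kappa>0 + \<alpha> < \<kappa>" and "e > 0" "K > 0"
    and H: "(\<integral>\<^sup>+\<eta>. ennreal (exp (\<kappa> / 2 * integral {0..\<beta>} (\<lambda>\<tau>. (\<eta> \<tau>)\<^sup>2))) \<partial>\<gamma>) \<le> ennreal L"
  shows "integrable (PiM \<Lambda> (\<lambda>_. \<gamma>)) (\<lambda>\<omega>. g (mean \<omega>) * exp (- path_energy \<omega>))"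
    and "integrable classical_ref (\<lambda>x. g x * exp (- \<beta> * V x))"
    and "B \<in> sets \<gamma> \<Longrightarrow> measure \<gamma> B \<le> p \<Longrightarrow> (\<And>\<eta> t. \<eta> \<in> space \<gamma> - B \<Longrightarrow> t \<in> {0..\<beta>} \<Longrightarrow> \<bar>\<eta> t - avg 0 \<beta> \<eta>\<bar> \<le> \<delta>) \<Longrightarrow>
      (\<And>\<omega>. (\<And>j. j \<in> \<Lambda> \<Longrightarrow> continuous_on {0..\<beta>} (\<omega> j)) \<Longrightarrow>
      \<bar>g (mean \<omega>) * exp (- path_energy \<omega>) - g (mean \<omega>) * exp (- \<beta> * V (mean \<omega>))\<bar> \<le>
      e * exp (\<kappa> / 2 * L2_norm2 \<omega>) +
      (if \<forall>j\<in>\<Lambda>. \<forall>t\<in>{0..\<beta>}. \<bar>\<omega> j t - avg 0 \<beta> (\<omega> j)\<bar> \<le> \<delta> then 0 else K)) \<Longrightarrow>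
      \<bar>(\<integral>\<omega>. g (mean \<omega>) * exp (- path_energy \<omega>) \<partial>PiM \<Lambda> (\<lambda>_. \<gamma>)) - (\<integral>x. g x * exp (- \<beta> * V x) \<partial>classical_ref)\<bar>
        \<le> e * \<bar>L\<bar> ^ card \<Lambda> + K * (real (card \<Lambda>) * p)"
proof -
  let ?M = "PiM \<Lambda> (\<lambda>_. \<gamma>)"
  let ?F = "\<lambda>\<omega>. g (mean \<omega>) * exp (- path_energy \<omega>)" and ?F' = "\<lambda>\<omega>. g (mean \<omega>) * exp (- \<beta> * V (mean \<omega>))"
    and ?H = "\<lambda>\<omega>. exp (\<kappa> / 2 * L2_norm2 \<omega>)"
  interpret product_prob_space "\<lambda>_. \<gamma>" \<Lambda>
    by (intro product_prob_spaceI prob_space_gamma[OF m G])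
  note [measurable] = path_energy_measurable[OF m G] mean_measurable[OF m G] gm V_measurable square_integral_measurable[OF m G]
  have [measurable]: "L2_norm2 \<in> borel_measurable ?M" unfolding L2_norm2_def[abs_def] by measurable
  have cont: "continuous_on {0..\<beta>} (\<omega> j)" if "\<omega> \<in> space ?M" "j \<in> \<Lambda>" for \<omega> j
    by (rule path_continuous[OF m G that])
  have Hnn: "(\<integral>\<^sup>+\<omega>. ennreal (?H \<omega>) \<partial>?M) \<le> ennreal (\<bar>L\<bar> ^ card \<Lambda>)" by (rule exp_L2_norm2_moment[OF m G H])
  have Hint: "integrable ?M ?H"
    by (rule integrableI_bounded) (use Hnn in \<open>auto intro: le_less_trans\<close>)
  have HL: "(\<integral>\<omega>. ?H \<omega> \<partial>?M) \<le> \<bar>L\<bar> ^ card \<Lambda>"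
    using Hnn by (subst (asm) nn_integral_eq_integral[OF Hint]) (auto simp: ennreal_le_iff)
  define A where "A = Cg * exp (\<beta> * b0)"
  have A: "A > 0" using assms by (simp add: A_def)
  have le: "\<bar>?F \<omega>\<bar> \<le> A * ?H \<omega>" "\<bar>?F' \<omega>\<bar> \<le> A * ?H \<omega>" if w: "\<omega> \<in> space ?M" for \<omega>
  proof -
    have Cg0: "Cg \<ge> 0" using assms by simp
    have "0 \<le> L2_norm2 \<omega>" using cont[OF w] by (rule L2_norm2_nonneg)
    then have "(\<kappa>0 + \<alpha>) / 2 * L2_norm2 \<omega> \<le> \<kappa> / 2 * L2_norm2 \<omega>" using \<kappa> by (intro mult_right_mono) auto
    then have "A * exp ((\<kappa>0 + \<alpha>) / 2 * L2_norm2 \<omega>) \<le> A * ?H \<omega>" using A by (intro mult_left_mono) auto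
    with weight_bounds[of \<omega> g Cg \<alpha>, OF cont[OF w] g \<open>\<alpha> \<ge> 0\<close> Cg0, folded A_def]
    show "\<bar>?F \<omega>\<bar> \<le> A * ?H \<omega>" "\<bar>?F' \<omega>\<bar> \<le> A * ?H \<omega>" by linarith+
  qed
  have AH: "integrable ?M (\<lambda>\<omega>. A * ?H \<omega>)" using Hint by simp
  show F: "integrable ?M ?F"
    by (rule Bochner_Integration.integrable_bound[OF AH]) (use le(1) A in \<open>auto intro!: AE_I2\<close>)
  have F': "integrable ?M ?F'"
    by (rule Bochner_Integration.integrable_bound[OF AH]) (use le(2) A in \<open>auto intro!: AE_I2\<close>)
  let ?k = "\<lambda>x. g x * exp (- \<beta> * V x)"
  have km: "?k \<in> borel_measurable (PiM \<Lambda> (\<lambda>_. borel))" by measurable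
  show "integrable classical_ref ?k"
    unfolding distr_path_mean[OF m G, symmetric]
    using F' integrable_distr_eq[OF mean_measurable[OF m G] km] by simp
  have k: "(\<integral>x. ?k x \<partial>classical_ref) = (\<integral>\<omega>. ?F' \<omega> \<partial>?M)"
    unfolding distr_path_mean[OF m G, symmetric] by (rule integral_distr[OF mean_measurable[OF m G] km])
  assume B: "B \<in> sets \<gamma>" "measure \<gamma> B \<le> p"
    and B': "\<And>\<eta> t. \<eta> \<in> space \<gamma> - B \<Longrightarrow> t \<in> {0..\<beta>} \<Longrightarrow> \<bar>\<eta> t - avg 0 \<beta> \<eta>\<bar> \<le> \<delta>"
    and bound: "\<And>\<omega>. (\<And>j. j \<in> \<Lambda> \<Longrightarrow> continuous_on {0..\<beta>} (\<omega> j)) \<Longrightarrow>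
      \<bar>?F \<omega> - ?F' \<omega>\<bar> \<le> e * ?H \<omega> +
      (if \<forall>j\<in>\<Lambda>. \<forall>t\<in>{0..\<beta>}. \<bar>\<omega> j t - avg 0 \<beta> (\<omega> j)\<bar> \<le> \<delta> then 0 else K)"
  \<comment> \<open>Number of sites with a bad loop; it dominates the indicator that some site is
    bad and is integrated site by site.\<close>
  let ?I = "\<lambda>\<omega>. \<Sum>j\<in>\<Lambda>. indicator B (\<omega> j) :: real"
  have Bint: "integrable ?M (\<lambda>\<omega>. indicator B (\<omega> j) :: real)" "(\<integral>\<omega>. indicator B (\<omega> j) \<partial>?M) = measure \<gamma> B" if "j \<in> \<Lambda>" for j
  proof -
    have D: "distr ?M \<gamma> (\<lambda>\<omega>. \<omega> j) = \<gamma>" using that by (rule PiM_component)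
    have i: "integrable \<gamma> (indicator B :: _ \<Rightarrow> real)" using B by (simp add: emeasure_eq_measure M.emeasure_eq_measure)
    then show "integrable ?M (\<lambda>\<omega>. indicator B (\<omega> j) :: real)"
      by (subst (asm) D[symmetric], subst (asm) integrable_distr_eq) (use that B in auto)
    have "(\<integral>\<omega>. indicator B (\<omega> j) \<partial>?M) = (\<integral>\<eta>. indicator B \<eta> \<partial>distr ?M \<gamma> (\<lambda>\<omega>. \<omega> j) :: real)"
      by (rule integral_distr[symmetric]) (use that B in auto)
    then show "(\<integral>\<omega>. indicator B (\<omega> j) \<partial>?M) = measure \<gamma> B" unfolding D using B sets.sets_into_space[OF B(1)] by (simp add: Int_absorb2)
  qed
  have Iint: "integrable ?M ?I" using Bint(1) by (rule Bochner_Integration.integrable_sum)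
  have "(\<integral>\<omega>. ?I \<omega> \<partial>?M) = (\<Sum>j\<in>\<Lambda>. measure \<gamma> B)"
    by (subst Bochner_Integration.integral_sum) (use Bint in auto)
  also have "\<dots> \<le> real (card \<Lambda>) * p" using B(2) by (simp add: mult_left_mono)
  finally have Ip: "(\<integral>\<omega>. ?I \<omega> \<partial>?M) \<le> real (card \<Lambda>) * p" .
  have point: "\<bar>?F \<omega> - ?F' \<omega>\<bar> \<le> e * ?H \<omega> + K * ?I \<omega>" if w: "\<omega> \<in> space ?M" for \<omega>
  proof -
    have I0: "?I \<omega> \<ge> 0" by (intro sum_nonneg) simp
    have "(if \<forall>j\<in>\<Lambda>. \<forall>t\<in>{0..\<beta>}. \<bar>\<omega> j t - avg 0 \<beta> (\<omega> j)\<bar> \<le> \<delta> then 0 else K) \<le> K * ?I \<omega>"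
    proof (cases "\<exists>j\<in>\<Lambda>. \<omega> j \<in> B")
      case True
      then obtain j where j: "j \<in> \<Lambda>" "\<omega> j \<in> B" by blast
      have "indicator B (\<omega> j) \<le> ?I \<omega>" by (rule member_le_sum) (use j fin in auto)
      then have "K * 1 \<le> K * ?I \<omega>" using j \<open>K > 0\<close> by (intro mult_left_mono) auto
      then show ?thesis using \<open>K > 0\<close> by auto
    next
      case False
      then have "\<forall>j\<in>\<Lambda>. \<forall>t\<in>{0..\<beta>}. \<bar>\<omega> j t - avg 0 \<beta> (\<omega> j)\<bar> \<le> \<delta>"
        using w by (intro ballI B') (auto simp: space_PiM)
      then show ?thesis using I0 \<open>K > 0\<close> by simp
    qed
    with bound[of \<omega>, OF cont[OF w]] show ?thesis by linarith
  qed
  have "\<bar>(\<integral>\<omega>. ?F \<omega> \<partial>?M) - (\<integral>x. ?k x \<partial>classical_ref)\<bar> = \<bar>\<integral>\<omega>. ?F \<omega> - ?F' \<omega> \<partial>?M\<bar>"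
    unfolding k using F F' by simp
  also have "\<dots> \<le> (\<integral>\<omega>. \<bar>?F \<omega> - ?F' \<omega>\<bar> \<partial>?M)" by (rule integral_abs_bound)
  also have "\<dots> \<le> (\<integral>\<omega>. e * ?H \<omega> + K * ?I \<omega> \<partial>?M)"
    using F F' Hint Iint
    by (intro integral_mono integrable_abs Bochner_Integration.integrable_diff Bochner_Integration.integrable_add integrable_mult_right point)
  also have "\<dots> = e * (\<integral>\<omega>. ?H \<omega> \<partial>?M) + K * (\<integral>\<omega>. ?I \<omega> \<partial>?M)"
    using Hint Iint by (subst Bochner_Integration.integral_add) auto
  also have "\<dots> \<le> e * \<bar>L\<bar> ^ card \<Lambda> + K * (real (card \<Lambda>) * p)"
    using HL Ip \<open>e > 0\<close> \<open>K > 0\<close> by (intro add_mono mult_left_mono) auto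
  finally show "\<bar>(\<integral>\<omega>. ?F \<omega> \<partial>?M) - (\<integral>x. ?k x \<partial>classical_ref)\<bar> \<le> e * \<bar>L\<bar> ^ card \<Lambda> + K * (real (card \<Lambda>) * p)" .
qed

text \<open>The order of choices matters: the moment bound \<open>L\<close> is fixed before the
  accuracy, then \<open>e'\<close> from \<open>L\<close>, then \<delta> and \<open>K\<close> from
  \<open>e'\<close>, then the admissible probability \<open>p\<close> from \<open>K\<close>, and
  only then is \<open>m\<close> taken large. Each of the two error terms gets a quarter of
  \<open>e\<close>.\<close>

theorem path_integral_tendsto:
  assumes G: "\<And>m. m > 0 \<Longrightarrow> gaussian_loop_measure \<beta> m (\<gamma> m)"
    and gm: "g \<in> borel_measurable (PiM \<Lambda> (\<lambda>_. borel))"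
    and g: "\<And>x. \<bar>g x\<bar> \<le> Cg * exp (\<alpha> / 2 * (\<beta> * (\<Sum>j\<in>\<Lambda>. (x j)\<^sup>2)))" and "\<alpha> \<ge> 0" "Cg > 0" "\<kappa>0 + \<alpha> < 1"
  shows "((\<lambda>m. \<integral>\<omega>. g (mean \<omega>) * exp (- path_energy \<omega>) \<partial>PiM \<Lambda> (\<lambda>_. \<gamma> m)) \<longlongrightarrow>
      (\<integral>x. g x * exp (- \<beta> * V x) \<partial>classical_ref)) at_top"
    and "integrable classical_ref (\<lambda>x. g x * exp (- \<beta> * V x))"
proof -
  \<comment> \<open>Midpoint between the exponent of the dominating bound and the critical exponent
    1 of the moments.\<close>
  define \<kappa> where "\<kappa> = (\<kappa>0 + \<alpha> + 1) / 2"
  have \<kappa>: "0 < \<kappa>" "\<kappa> < 1" "\<kappa>0 + \<alpha> < \<kappa>" using assms kappa0 by (auto simp: \<kappa>_def)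
  obtain L where L: "\<forall>\<^sub>F m in at_top. \<forall>\<gamma>. gaussian_loop_measure \<beta> m \<gamma> \<longrightarrow>
    (\<integral>\<^sup>+\<omega>. ennreal (exp (\<kappa> / 2 * integral {0..\<beta>} (\<lambda>\<tau>. (\<omega> \<tau>)\<^sup>2))) \<partial>\<gamma>) \<le> ennreal L"
    using exp_square_moment[OF beta \<kappa>(1,2)] by blast
  note close = weight_integrals_close[OF _ G gm g \<open>\<alpha> \<ge> 0\<close> \<open>Cg > 0\<close> \<kappa>(3)]
  \<comment> \<open>The classical integrand does not involve the mass, so a single \<open>m\<close>
    with the moment bound yields its integrability.\<close>
  obtain m where m: "\<forall>\<gamma>. gaussian_loop_measure \<beta> m \<gamma> \<longrightarrow>
    (\<integral>\<^sup>+\<omega>. ennreal (exp (\<kappa> / 2 * integral {0..\<beta>} (\<lambda>\<tau>. (\<omega> \<tau>)\<^sup>2))) \<partial>\<gamma>) \<le> ennreal L" "m > 0"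
    using eventually_happens'[OF _ eventually_conj[OF L eventually_gt_at_top[of 0]]] by auto
  show "integrable classical_ref (\<lambda>x. g x * exp (- \<beta> * V x))"
    by (rule close(2)[of m 1 1 L]) (use m G in auto)
  show "((\<lambda>m. \<integral>\<omega>. g (mean \<omega>) * exp (- path_energy \<omega>) \<partial>PiM \<Lambda> (\<lambda>_. \<gamma> m)) \<longlongrightarrow>
      (\<integral>x. g x * exp (- \<beta> * V x) \<partial>classical_ref)) at_top"
  proof (rule tendstoI)
    fix e :: real assume "e > 0"
    define N where "N = real (card \<Lambda>)"
    define T where "T = \<bar>L\<bar> ^ card \<Lambda>"
    define e' where "e' = e / (4 * (T + 1))"
    have T: "T \<ge> 0" and N: "N \<ge> 0" by (auto simp: T_def N_def)
    then have e': "e' > 0" using \<open>e > 0\<close> by (auto simp: e'_def)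
    have e'T: "e' * T \<le> e / 4"
    proof -
      have "e' * T \<le> e' * (T + 1)" using e' by (intro mult_left_mono) auto
      also have "\<dots> = e / 4" using T by (simp add: e'_def field_simps)
      finally show ?thesis .
    qed
    obtain \<delta> K where \<delta>: "\<delta> > 0" "K > 0"
      and bound: "\<And>\<omega>. (\<And>j. j \<in> \<Lambda> \<Longrightarrow> continuous_on {0..\<beta>} (\<omega> j)) \<Longrightarrow>
      \<bar>g (mean \<omega>) * exp (- path_energy \<omega>) - g (mean \<omega>) * exp (- \<beta> * V (mean \<omega>))\<bar> \<le>
      e' * exp (\<kappa> / 2 * L2_norm2 \<omega>) +
      (if \<forall>j\<in>\<Lambda>. \<forall>t\<in>{0..\<beta>}. \<bar>\<omega> j t - avg 0 \<beta> (\<omega> j)\<bar> \<le> \<delta> then 0 else K)"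
      using weight_difference_bound[of g Cg \<alpha> \<kappa> e', OF g \<open>\<alpha> \<ge> 0\<close> \<open>Cg > 0\<close> \<kappa>(3) e'] by blast
    define p where "p = e / (4 * K * (N + 1))"
    have p: "p > 0" using \<open>e > 0\<close> \<delta> N by (auto simp: p_def)
    have pK: "K * (N * p) \<le> e / 4"
    proof -
      have "K * (N * p) \<le> K * ((N + 1) * p)" using p \<delta> by (intro mult_left_mono mult_right_mono) auto
      also have "\<dots> = e / 4"
      proof -
        have "N + 1 \<noteq> 0" using N by linarith
        then show ?thesis using \<delta>(2) by (simp add: p_def)
      qed
      finally show ?thesis .
    qed
    show "\<forall>\<^sub>F m in at_top. dist (\<integral>\<omega>. g (mean \<omega>) * exp (- path_energy \<omega>) \<partial>PiM \<Lambda> (\<lambda>_. \<gamma> m))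
        (\<integral>x. g x * exp (- \<beta> * V x) \<partial>classical_ref) < e"
      using L eventually_gt_at_top[of 0] loop_close_to_mean[OF beta \<delta>(1) p]
    proof eventually_elim
      case (elim m)
      obtain B where B: "B \<in> sets (\<gamma> m)" "measure (\<gamma> m) B \<le> p"
        and B': "\<forall>\<eta>\<in>space (\<gamma> m) - B. \<forall>t\<in>{0..\<beta>}. \<bar>\<eta> t - avg 0 \<beta> \<eta>\<bar> \<le> \<delta>"
        using mp[OF spec[OF elim(3)] G[OF elim(2)]] by (elim bexE conjE) (rule that)
      note Lm = mp[OF spec[OF elim(1)] G[OF elim(2)]]
      have "\<bar>(\<integral>\<omega>. g (mean \<omega>) * exp (- path_energy \<omega>) \<partial>PiM \<Lambda> (\<lambda>_. \<gamma> m)) - (\<integral>x. g x * exp (- \<beta> * V x) \<partial>classical_ref)\<bar>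
        \<le> e' * \<bar>L\<bar> ^ card \<Lambda> + K * (real (card \<Lambda>) * p)"
        by (rule close(3)[OF elim(2) elim(2) e' \<delta>(2) Lm B B'[THEN bspec, THEN bspec] bound])
      then show ?case using e'T pK \<open>e > 0\<close> by (simp add: dist_real_def T_def N_def)
    qed
  qed
qed

end

subsection \<open>The periodic lattice model\<close>

lemma finite_box_lattice: "finite (box_lattice k0 k1)"
proof -
  have "box_lattice k0 k1 \<subseteq> vec_lambda ` (PiE UNIV (\<lambda>l. {k0 $ l..k1 $ l}))"
  proof
    fix k assume "k \<in> box_lattice k0 k1"
    then have "vec_nth k \<in> PiE UNIV (\<lambda>l. {k0 $ l..k1 $ l})" by (auto simp: box_lattice_def)
    then show "k \<in> vec_lambda ` (PiE UNIV (\<lambda>l. {k0 $ l..k1 $ l}))" by (metis image_eqI vec_lambda_eta)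
  qed
  then show ?thesis by (rule finite_subset) (intro finite_imageI finite_PiE, auto)
qed

lemma periodic_dist_commute: "periodic_dist k0 k1 j k = periodic_dist k0 k1 k j"
  by (simp add: periodic_dist_def abs_minus_commute)

text \<open>Each \<open>k\<close> in the box is moved to the representative modulo the box that is closest to \<open>j\<close>.\<close>

lemma periodic_coupling_sum_le:
  fixes J :: "real \<Rightarrow> real" and j k0 k1 :: "int ^ 'd"
  assumes J: "((\<lambda>k. \<bar>J (lattice_dist j k)\<bar>) has_sum c) UNIV" and j: "j \<in> box_lattice k0 k1"
  shows "(\<Sum>k\<in>box_lattice k0 k1. \<bar>J (periodic_dist k0 k1 j k)\<bar>) \<le> c"
proof -
  define L where "L l = k1 $ l - k0 $ l + 1" for l
  define \<phi> :: "int ^ 'd \<Rightarrow> int ^ 'd" where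
    "\<phi> k = (\<chi> l. if \<bar>j $ l - k $ l\<bar> \<le> L l - \<bar>j $ l - k $ l\<bar> then k $ l
               else if k $ l < j $ l then k $ l + L l else k $ l - L l)" for k
  have in_box: "k0 $ l \<le> k $ l" "k $ l \<le> k1 $ l" if "k \<in> box_lattice k0 k1" for k l
    using that by (auto simp: box_lattice_def)
  have dist: "lattice_dist j (\<phi> k) = periodic_dist k0 k1 j k" if "k \<in> box_lattice k0 k1" for k
  proof -
    \<comment> \<open>Where the direct distance exceeds its complement, the shift carries
      \<open>k\<close> across \<open>j\<close> by one period and leaves exactly the complementary
      distance.\<close>
    have "\<bar>j $ l - \<phi> k $ l\<bar> = min \<bar>j $ l - k $ l\<bar> (k1 $ l - k0 $ l + 1 - \<bar>j $ l - k $ l\<bar>)" for l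
      using in_box[OF that, of l] in_box[OF j, of l] by (auto simp: \<phi>_def L_def min_def abs_if)
    then show ?thesis by (simp add: lattice_dist_def periodic_dist_def)
  qed
  \<comment> \<open>Images differ from the original coordinates by a multiple of the side length,
    and box coordinates congruent modulo that length are equal.\<close>
  have inj: "inj_on \<phi> (box_lattice k0 k1)"
  proof (rule inj_onI)
    fix k k' assume k: "k \<in> box_lattice k0 k1" "k' \<in> box_lattice k0 k1" and eq: "\<phi> k = \<phi> k'"
    have "k $ l = k' $ l" for l
    proof -
      have "\<phi> k $ l = \<phi> k' $ l" using eq by simp
      then show ?thesis
        using in_box[OF k(1), of l] in_box[OF k(2), of l] by (simp add: \<phi>_def L_def split: if_splits)
    qed
    then show "k = k'" by (simp add: vec_eq_iff)
  qed
  have "(\<Sum>k\<in>box_lattice k0 k1. \<bar>J (periodic_dist k0 k1 j k)\<bar>) = (\<Sum>k\<in>\<phi> ` box_lattice k0 k1. \<bar>J (lattice_dist j k)\<bar>)"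
    by (simp add: sum.reindex[OF inj] dist)
  also have "\<dots> \<le> c"
    by (rule finite_sum_le_has_sum[OF J]) (auto intro: finite_box_lattice)
  finally show ?thesis .
qed

text \<open>Schur's test: a product is at most half the sum of the squares, and symmetry of the
  kernel makes both halves controlled by the same row sums.\<close>

lemma symmetric_form_le:
  fixes w :: "'i \<Rightarrow> 'i \<Rightarrow> real" and x :: "'i \<Rightarrow> real"
  assumes "\<And>j k. w j k = w k j" and "\<And>j. j \<in> \<Lambda> \<Longrightarrow> (\<Sum>k\<in>\<Lambda>. \<bar>w j k\<bar>) \<le> c"
  shows "\<bar>\<Sum>j\<in>\<Lambda>. \<Sum>k\<in>\<Lambda>. w j k * x j * x k\<bar> \<le> c * (\<Sum>j\<in>\<Lambda>. (x j)\<^sup>2)"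
proof -
  have "\<bar>\<Sum>j\<in>\<Lambda>. \<Sum>k\<in>\<Lambda>. w j k * x j * x k\<bar> \<le> (\<Sum>j\<in>\<Lambda>. \<Sum>k\<in>\<Lambda>. \<bar>w j k\<bar> * ((x j)\<^sup>2 / 2) + \<bar>w j k\<bar> * ((x k)\<^sup>2 / 2))"
  proof (intro order_trans[OF sum_abs] sum_mono)
    fix j k
    have "\<bar>x j * x k\<bar> \<le> (x j)\<^sup>2 / 2 + (x k)\<^sup>2 / 2"
      using sum_squares_bound[of "\<bar>x j\<bar>" "\<bar>x k\<bar>"] by (simp add: abs_mult)
    then have "\<bar>w j k\<bar> * \<bar>x j * x k\<bar> \<le> \<bar>w j k\<bar> * ((x j)\<^sup>2 / 2 + (x k)\<^sup>2 / 2)" by (intro mult_left_mono) auto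
    then show "\<bar>w j k * x j * x k\<bar> \<le> \<bar>w j k\<bar> * ((x j)\<^sup>2 / 2) + \<bar>w j k\<bar> * ((x k)\<^sup>2 / 2)"
      by (simp only: abs_mult mult.assoc distrib_left)
  qed
  also have "\<dots> = (\<Sum>j\<in>\<Lambda>. \<Sum>k\<in>\<Lambda>. \<bar>w j k\<bar> * ((x j)\<^sup>2 / 2)) + (\<Sum>j\<in>\<Lambda>. \<Sum>k\<in>\<Lambda>. \<bar>w j k\<bar> * ((x k)\<^sup>2 / 2))"
    by (simp only: sum.distrib)
  also have "(\<Sum>j\<in>\<Lambda>. \<Sum>k\<in>\<Lambda>. \<bar>w j k\<bar> * ((x k)\<^sup>2 / 2)) = (\<Sum>j\<in>\<Lambda>. \<Sum>k\<in>\<Lambda>. \<bar>w j k\<bar> * ((x j)\<^sup>2 / 2))"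
    by (subst sum.swap) (simp only: assms(1))
  also have "(\<Sum>j\<in>\<Lambda>. \<Sum>k\<in>\<Lambda>. \<bar>w j k\<bar> * ((x j)\<^sup>2 / 2)) + (\<Sum>j\<in>\<Lambda>. \<Sum>k\<in>\<Lambda>. \<bar>w j k\<bar> * ((x j)\<^sup>2 / 2))
      = (\<Sum>j\<in>\<Lambda>. (\<Sum>k\<in>\<Lambda>. \<bar>w j k\<bar>) * (x j)\<^sup>2)"
    by (simp only: sum.distrib[symmetric] sum_distrib_right) (simp only: distrib_left[symmetric] field_sum_of_halves)
  also have "\<dots> \<le> (\<Sum>j\<in>\<Lambda>. c * (x j)\<^sup>2)" by (intro sum_mono mult_right_mono assms) auto
  finally show ?thesis by (simp add: sum_distrib_left)
qed

lemma uniformly_continuous_energy: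
  fixes U :: "real \<Rightarrow> real" and w :: "'i \<Rightarrow> 'i \<Rightarrow> real"
  assumes fin: "finite \<Lambda>" and U: "continuous_on UNIV U" and "e > 0"
  shows "\<exists>\<delta>>0. \<forall>x y. (\<forall>j\<in>\<Lambda>. \<bar>x j\<bar> \<le> R \<and> \<bar>y j - x j\<bar> \<le> \<delta>) \<longrightarrow>
    \<bar>((\<Sum>j\<in>\<Lambda>. U (y j)) + 1/2 * (\<Sum>j\<in>\<Lambda>. \<Sum>k\<in>\<Lambda>. w j k * y j * y k)) -
     ((\<Sum>j\<in>\<Lambda>. U (x j)) + 1/2 * (\<Sum>j\<in>\<Lambda>. \<Sum>k\<in>\<Lambda>. w j k * x j * x k))\<bar> \<le> e"
proof -
  define R' where "R' = max R 0"
  define D where "D = (\<Sum>j\<in>\<Lambda>. \<Sum>k\<in>\<Lambda>. \<bar>w j k\<bar>)"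
  define N where "N = real (card \<Lambda>)"
  have D: "D \<ge> 0" and N: "N \<ge> 0" and R': "R' \<ge> 0" "R \<le> R'" by (auto simp: D_def N_def R'_def intro!: sum_nonneg)
  \<comment> \<open>One extra unit in the denominator avoids division by zero for an empty index
    set.\<close>
  define e1 where "e1 = e / (N + 1) / 2"
  have e1: "e1 > 0" using \<open>e > 0\<close> N by (auto simp: e1_def)
  have "uniformly_continuous_on {- R' - 1..R' + 1} U"
    by (intro compact_uniformly_continuous continuous_on_subset[OF U]) auto
  then obtain d where d: "d > 0" "\<And>s t. s \<in> {- R' - 1..R' + 1} \<Longrightarrow> t \<in> {- R' - 1..R' + 1} \<Longrightarrow> dist t s < d \<Longrightarrow> dist (U t) (U s) < e1"
    using e1 unfolding uniformly_continuous_on_def by metis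
  \<comment> \<open>The bound 1 keeps \<open>y\<close> in the compact interval on which
    \<open>U\<close> is uniformly continuous, \<open>d / 2\<close> is strictly below the modulus
    \<open>d\<close>, and the last term controls the quadratic form of total weight
    \<open>D\<close>.\<close>
  define \<delta> where "\<delta> = min (min 1 (d / 2)) (e / ((2 * R' + 1) * D + 1))"
  have pos: "(2 * R' + 1) * D + 1 > 0" using D R' by (intro add_nonneg_pos mult_nonneg_nonneg) auto
  then have \<delta>: "\<delta> > 0" "\<delta> \<le> 1" "\<delta> < d" "\<delta> \<le> e / ((2 * R' + 1) * D + 1)" using d(1) \<open>e > 0\<close> by (auto simp: \<delta>_def)
  show ?thesis
  proof (intro exI[of _ \<delta>] conjI allI impI \<delta>(1))
    fix x y :: "'i \<Rightarrow> real" assume xy: "\<forall>j\<in>\<Lambda>. \<bar>x j\<bar> \<le> R \<and> \<bar>y j - x j\<bar> \<le> \<delta>"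
    have x: "\<bar>x j\<bar> \<le> R'" "\<bar>y j\<bar> \<le> R' + 1" "\<bar>y j - x j\<bar> \<le> \<delta>" if "j \<in> \<Lambda>" for j
      using xy that \<delta> R' by (fastforce simp: abs_le_iff)+
    have "\<bar>(\<Sum>j\<in>\<Lambda>. U (y j)) - (\<Sum>j\<in>\<Lambda>. U (x j))\<bar> \<le> (\<Sum>j\<in>\<Lambda>. e1)"
      unfolding sum_subtractf[symmetric]
    proof (intro order_trans[OF sum_abs] sum_mono)
      fix j assume "j \<in> \<Lambda>"
      note xj = x[OF this]
      have "dist (U (y j)) (U (x j)) < e1"
        by (rule d(2)) (use xj \<delta> in \<open>auto simp: dist_real_def abs_le_iff\<close>)
      then show "\<bar>U (y j) - U (x j)\<bar> \<le> e1" by (simp add: dist_real_def)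
    qed
    also have "\<dots> = N * e1" by (simp add: N_def)
    also have "\<dots> \<le> (N + 1) * e1" using e1 by (intro mult_right_mono) auto
    also have "\<dots> = e / 2"
    proof -
      have "N + 1 \<noteq> 0" using N by linarith
      from nonzero_mult_div_cancel_left[OF this, of e] show ?thesis by (simp only: e1_def times_divide_eq_right)
    qed
    finally have 1: "\<bar>(\<Sum>j\<in>\<Lambda>. U (y j)) - (\<Sum>j\<in>\<Lambda>. U (x j))\<bar> \<le> e / 2" .
    have "\<bar>(\<Sum>j\<in>\<Lambda>. \<Sum>k\<in>\<Lambda>. w j k * y j * y k) - (\<Sum>j\<in>\<Lambda>. \<Sum>k\<in>\<Lambda>. w j k * x j * x k)\<bar>
        \<le> (\<Sum>j\<in>\<Lambda>. \<Sum>k\<in>\<Lambda>. \<bar>w j k\<bar> * ((2 * R' + 1) * \<delta>))"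
      unfolding sum_subtractf[symmetric]
    proof (intro order_trans[OF sum_abs] sum_mono)
      fix j k assume "j \<in> \<Lambda>" "k \<in> \<Lambda>"
      note xj = x[OF \<open>j \<in> \<Lambda>\<close>] and xk = x[OF \<open>k \<in> \<Lambda>\<close>]
      have "w j k * y j * y k - w j k * x j * x k = w j k * (y j * (y k - x k) + (y j - x j) * x k)" by (simp add: algebra_simps)
      then have "\<bar>w j k * y j * y k - w j k * x j * x k\<bar> = \<bar>w j k\<bar> * \<bar>y j * (y k - x k) + (y j - x j) * x k\<bar>"
        by (simp only: abs_mult)
      also have "\<dots> \<le> \<bar>w j k\<bar> * ((R' + 1) * \<delta> + \<delta> * R')"
        using xj xk R' \<delta>
        by (intro mult_left_mono order_trans[OF abs_triangle_ineq] add_mono) (auto simp: abs_mult intro!: mult_mono)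
      also have "(R' + 1) * \<delta> + \<delta> * R' = (2 * R' + 1) * \<delta>" by (simp add: algebra_simps)
      finally show "\<bar>w j k * y j * y k - w j k * x j * x k\<bar> \<le> \<bar>w j k\<bar> * ((2 * R' + 1) * \<delta>)" .
    qed
    also have "\<dots> = D * ((2 * R' + 1) * \<delta>)" by (simp add: D_def sum_distrib_right)
    also have "\<dots> = ((2 * R' + 1) * D) * \<delta>" by (simp add: mult_ac)
    also have "\<dots> \<le> ((2 * R' + 1) * D + 1) * \<delta>" using \<delta> by (intro mult_right_mono) auto
    also have "\<dots> \<le> e" using \<delta>(4) pos by (simp add: pos_le_divide_eq mult.commute)
    \<comment> \<open>An error of \<open>e\<close> is affordable here, since the form enters the
      energy with the factor 1/2.\<close>
    finally have 2: "\<bar>(\<Sum>j\<in>\<Lambda>. \<Sum>k\<in>\<Lambda>. w j k * y j * y k) - (\<Sum>j\<in>\<Lambda>. \<Sum>k\<in>\<Lambda>. w j k * x j * x k)\<bar> \<le> e" .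
    from 1 2 show "\<bar>((\<Sum>j\<in>\<Lambda>. U (y j)) + 1/2 * (\<Sum>j\<in>\<Lambda>. \<Sum>k\<in>\<Lambda>. w j k * y j * y k)) -
     ((\<Sum>j\<in>\<Lambda>. U (x j)) + 1/2 * (\<Sum>j\<in>\<Lambda>. \<Sum>k\<in>\<Lambda>. w j k * x j * x k))\<bar> \<le> e" by linarith
  qed
qed

section \<open>Reduction of both order parameters to path and classical integrals\<close>

lemma quantum_energy_eq_integral:
  assumes U: "continuous_on UNIV U" and w: "\<And>j. j \<in> box_lattice k0 k1 \<Longrightarrow> continuous_on {0..\<beta>} (\<omega> j)"
  shows "quantum_energy J U k0 k1 \<beta> \<omega> =
    integral {0..\<beta>} (\<lambda>\<tau>. classical_energy J U k0 k1 (\<lambda>j\<in>box_lattice k0 k1. \<omega> j \<tau>))"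
proof -
  let ?\<Lambda> = "box_lattice k0 k1"
  have I: "(LBINT \<tau>:{0..\<beta>}. F \<tau>) = integral {0..\<beta>} F" "(F has_integral integral {0..\<beta>} F) {0..\<beta>}"
    if "continuous_on {0..\<beta>} F" for F :: "real \<Rightarrow> real"
    using that by (auto intro!: set_borel_integral_eq_integral(2) borel_integrable_atLeastAtMost' integrable_integral integrable_continuous_real)
  have Uc: "continuous_on {0..\<beta>} (\<lambda>\<tau>. U (\<omega> j \<tau>))" if "j \<in> ?\<Lambda>" for j
    by (rule continuous_on_compose2[OF U w[OF that]]) auto
  have wc: "continuous_on {0..\<beta>} (\<lambda>\<tau>. \<omega> j \<tau> * \<omega> k \<tau>)" if "j \<in> ?\<Lambda>" "k \<in> ?\<Lambda>" for j k
    by (intro continuous_intros w that)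
  have "((\<lambda>\<tau>. (\<Sum>j\<in>?\<Lambda>. U (\<omega> j \<tau>)) + 1/2 * (\<Sum>j\<in>?\<Lambda>. \<Sum>k\<in>?\<Lambda>. J (periodic_dist k0 k1 j k) * (\<omega> j \<tau> * \<omega> k \<tau>))) has_integral
      ((\<Sum>j\<in>?\<Lambda>. integral {0..\<beta>} (\<lambda>\<tau>. U (\<omega> j \<tau>))) +
       1/2 * (\<Sum>j\<in>?\<Lambda>. \<Sum>k\<in>?\<Lambda>. J (periodic_dist k0 k1 j k) * integral {0..\<beta>} (\<lambda>\<tau>. \<omega> j \<tau> * \<omega> k \<tau>)))) {0..\<beta>}"
    by (intro has_integral_add has_integral_sum has_integral_mult_right finite_box_lattice I(2) Uc wc)
  moreover have "(\<lambda>\<tau>. (\<Sum>j\<in>?\<Lambda>. U (\<omega> j \<tau>)) + 1/2 * (\<Sum>j\<in>?\<Lambda>. \<Sum>k\<in>?\<Lambda>. J (periodic_dist k0 k1 j k) * (\<omega> j \<tau> * \<omega> k \<tau>)))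
      = (\<lambda>\<tau>. classical_energy J U k0 k1 (\<lambda>j\<in>?\<Lambda>. \<omega> j \<tau>))"
    by (rule ext) (simp add: classical_energy_def mult.assoc cong: sum.cong)
  moreover have "quantum_energy J U k0 k1 \<beta> \<omega> = (\<Sum>j\<in>?\<Lambda>. integral {0..\<beta>} (\<lambda>\<tau>. U (\<omega> j \<tau>))) +
       1/2 * (\<Sum>j\<in>?\<Lambda>. \<Sum>k\<in>?\<Lambda>. J (periodic_dist k0 k1 j k) * integral {0..\<beta>} (\<lambda>\<tau>. \<omega> j \<tau> * \<omega> k \<tau>))"
    by (simp add: quantum_energy_def I(1) Uc wc cong: sum.cong)
  ultimately show ?thesis by (simp add: integral_unique)
qed

lemma path_mean_eq:
  assumes "\<beta> > 0" and w: "\<And>j. j \<in> \<Lambda> \<Longrightarrow> continuous_on {0..\<beta>} (\<omega> j)" and "finite \<Lambda>"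
  shows "(1 / (\<beta> * N) * (LBINT \<tau>:{0..\<beta>}. \<Sum>j\<in>\<Lambda>. \<omega> j \<tau>)) = 1 / N * (\<Sum>j\<in>\<Lambda>. avg 0 \<beta> (\<omega> j))"
proof -
  have "continuous_on {0..\<beta>} (\<lambda>\<tau>. \<Sum>j\<in>\<Lambda>. \<omega> j \<tau>)" by (intro continuous_intros w)
  then have "(LBINT \<tau>:{0..\<beta>}. \<Sum>j\<in>\<Lambda>. \<omega> j \<tau>) = integral {0..\<beta>} (\<lambda>\<tau>. \<Sum>j\<in>\<Lambda>. \<omega> j \<tau>)"
    by (intro set_borel_integral_eq_integral(2) borel_integrable_atLeastAtMost')
  also have "\<dots> = (\<Sum>j\<in>\<Lambda>. integral {0..\<beta>} (\<omega> j))"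
    by (intro integral_unique has_integral_sum integrable_integral integrable_continuous_real w assms(3))
  finally show ?thesis using assms(1) by (simp add: avg_def sum_divide_distrib[symmetric])
qed

text \<open>Nonnegativity of \<open>Z\<close> ensures that \<open>ennreal\<close> does not truncate
  the density. If \<open>Z = 0\<close>, both sides are 0 by the convention for division, so the
  formula covers that case too.\<close>

lemma integral_density_normalized:
  fixes f E :: "'w \<Rightarrow> real"
  assumes "f \<in> borel_measurable M" "E \<in> borel_measurable M" "Z \<ge> 0"
  shows "(LINT w|density M (\<lambda>w. ennreal (1 / Z * exp (- E w))). f w) = (LINT w|M. f w * exp (- E w)) / Z"
proof -
  have "(LINT w|density M (\<lambda>w. ennreal (1 / Z * exp (- E w))). f w) = (LINT w|M. (1 / Z * exp (- E w)) *\<^sub>R f w)"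
    by (rule integral_density) (use assms in auto)
  also have "\<dots> = (LINT w|M. (1 / Z) * (f w * exp (- E w)))" by (intro Bochner_Integration.integral_cong) auto
  finally show ?thesis by simp
qed

theorem corollary4p1:
  fixes J U :: "real \<Rightarrow> real"
    and r c ct b \<beta> :: real
    and k0 k1 :: "int ^ 'd"
    and \<gamma> :: "real \<Rightarrow> (real \<Rightarrow> real) measure"
  assumes "r > 0" and "\<And>t. t > r \<Longrightarrow> J t = 0"
    and "\<And>j :: int ^ 'd. ((\<lambda>k. \<bar>J (lattice_dist j k)\<bar>) has_sum c) UNIV"
    and "continuous_on UNIV U" and "\<And>x. U (- x) = U x"
    and "ct > max (c - 1) 0" and "\<And>x. U x \<ge> 1/2 * ct * x\<^sup>2 + b"
    and "\<beta> > 0"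
    and "\<And>l. k0 $ l < k1 $ l"
    and "\<And>m. m > 0 \<Longrightarrow> gaussian_loop_measure \<beta> m (\<gamma> m)"
  shows "((\<lambda>m. quantum_order J U k0 k1 \<beta> (\<gamma> m)) \<longlongrightarrow> classical_order J U k0 k1 \<beta>) at_top"
proof -
  let ?\<Lambda> = "box_lattice k0 k1" and ?V = "classical_energy J U k0 k1"
  define N where "N = real (card ?\<Lambda>)"
  have fin: "finite ?\<Lambda>" by (rule finite_box_lattice)
  have "k0 \<in> ?\<Lambda>" using assms(9) by (auto simp: box_lattice_def less_imp_le)
  then have N: "N > 0" using fin by (auto simp: N_def card_gt_0_iff)
  \<comment> \<open>The interaction costs at most c / 2 times the sum of squares and
    \<open>U\<close> returns ct / 2 times it; \<open>ct > c - 1\<close> leaves a deficit below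
    1.\<close>
  define \<kappa>0 where "\<kappa>0 = max 0 (c - ct)"
  have \<kappa>0: "0 \<le> \<kappa>0" "\<kappa>0 < 1" using assms(6) by (auto simp: \<kappa>0_def)
  have UM [measurable]: "U \<in> borel_measurable borel" by (rule borel_measurable_continuous_onI[OF assms(4)])
  have V_meas: "?V \<in> borel_measurable (PiM ?\<Lambda> (\<lambda>_. borel))"
    unfolding classical_energy_def[abs_def] by measurable
  have V_lower: "?V x \<ge> - \<kappa>0 / 2 * (\<Sum>j\<in>?\<Lambda>. (x j)\<^sup>2) - (- N * b)" for x
  proof -
    have "\<bar>\<Sum>j\<in>?\<Lambda>. \<Sum>k\<in>?\<Lambda>. J (periodic_dist k0 k1 j k) * x j * x k\<bar> \<le> c * (\<Sum>j\<in>?\<Lambda>. (x j)\<^sup>2)"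
      by (intro symmetric_form_le periodic_coupling_sum_le assms(3)) (simp add: periodic_dist_commute)
    moreover have "(\<Sum>j\<in>?\<Lambda>. 1/2 * ct * (x j)\<^sup>2 + b) \<le> (\<Sum>j\<in>?\<Lambda>. U (x j))"
      by (intro sum_mono assms(7))
    moreover have "(\<Sum>j\<in>?\<Lambda>. 1/2 * ct * (x j)\<^sup>2 + b) = 1/2 * (ct * (\<Sum>j\<in>?\<Lambda>. (x j)\<^sup>2)) + N * b"
      by (simp add: sum.distrib sum_distrib_left N_def mult.assoc)
    moreover have "(c - ct) * (\<Sum>j\<in>?\<Lambda>. (x j)\<^sup>2) \<le> \<kappa>0 * (\<Sum>j\<in>?\<Lambda>. (x j)\<^sup>2)"
      by (intro mult_right_mono sum_nonneg) (auto simp: \<kappa>0_def)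
    ultimately show ?thesis unfolding classical_energy_def left_diff_distrib by linarith
  qed
  interpret local_energy ?\<Lambda> ?V \<beta> \<kappa>0 "- N * b"
  proof
    show "\<exists>\<delta>>0. \<forall>x y. (\<forall>j\<in>?\<Lambda>. \<bar>x j\<bar> \<le> R \<and> \<bar>y j - x j\<bar> \<le> \<delta>) \<longrightarrow> \<bar>?V y - ?V x\<bar> \<le> e" if "e > 0" for R e
      unfolding classical_energy_def by (rule uniformly_continuous_energy[OF fin assms(4) that])
  qed (use fin \<open>\<beta> > 0\<close> \<kappa>0 V_meas V_lower in auto)
  define g where "g x = (1 / N * (\<Sum>j\<in>?\<Lambda>. x j))\<^sup>2" for x :: "int ^ 'd \<Rightarrow> real"
  have g_meas [measurable]: "g \<in> borel_measurable (PiM ?\<Lambda> (\<lambda>_. borel))" unfolding g_def[abs_def] by measurable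
  \<comment> \<open>Half of the remaining margin is spent on the quadratic growth of the
    observable.\<close>
  define \<alpha> where "\<alpha> = (1 - \<kappa>0) / 2"
  have \<alpha>: "\<alpha> > 0" "\<kappa>0 + \<alpha> < 1" using \<kappa>0 by (auto simp: \<alpha>_def field_simps)
  \<comment> \<open>By Cauchy-Schwarz the squared average is at most the sum of squares, and y <=
    exp y with y = \<alpha> \<beta> / 2 times that sum gives the constant
    \<open>2 / (\<alpha> * \<beta>)\<close>.\<close>
  have g_le: "\<bar>g x\<bar> \<le> 2 / (\<alpha> * \<beta>) * exp (\<alpha> / 2 * (\<beta> * (\<Sum>j\<in>?\<Lambda>. (x j)\<^sup>2)))" for x
  proof -
    let ?s = "\<Sum>j\<in>?\<Lambda>. (x j)\<^sup>2"
    have "N \<ge> 1" using N by (simp add: N_def)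
    have "(\<Sum>j\<in>?\<Lambda>. x j)\<^sup>2 \<le> ?s * N" unfolding N_def by (rule sum_squared_le_sum_of_squares)
    also have "\<dots> \<le> ?s * N\<^sup>2" using \<open>N \<ge> 1\<close> by (intro mult_left_mono sum_nonneg) (auto simp: power2_eq_square)
    finally have "g x \<le> ?s" using N by (simp add: g_def power_mult_distrib power_divide divide_le_eq)
    also have "?s = 2 / (\<alpha> * \<beta>) * (\<alpha> / 2 * (\<beta> * ?s))" using \<alpha> \<open>\<beta> > 0\<close> by simp
    also have "\<dots> \<le> 2 / (\<alpha> * \<beta>) * exp (\<alpha> / 2 * (\<beta> * ?s))"
    proof (rule mult_left_mono)
      show "\<alpha> / 2 * (\<beta> * ?s) \<le> exp (\<alpha> / 2 * (\<beta> * ?s))"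
        using exp_ge_add_one_self[of "\<alpha> / 2 * (\<beta> * ?s)"] by linarith
    qed (use \<alpha> \<open>\<beta> > 0\<close> in simp)
    finally show ?thesis by (simp add: g_def)
  qed
  define W where "W = classical_ref"
  define Y where "Y = (\<integral>x. exp (- \<beta> * ?V x) \<partial>W)"
  have "2 / (\<alpha> * \<beta>) > 0" using \<alpha> \<open>\<beta> > 0\<close> by simp
  note num = path_integral_tendsto[OF assms(10) g_meas g_le _ this \<alpha>(2), folded W_def]
  \<comment> \<open>The constant observable 1, with growth rate 0, yields the partition
    functions.\<close>
  have one: "\<bar>1\<bar> \<le> 1 * exp (0 / 2 * (\<beta> * (\<Sum>j\<in>?\<Lambda>. (x j)\<^sup>2)))" for x :: "int ^ 'd \<Rightarrow> real" by simp
  have den: "((\<lambda>m. \<integral>\<omega>. exp (- path_energy \<omega>) \<partial>PiM ?\<Lambda> (\<lambda>_. \<gamma> m)) \<longlongrightarrow> Y) at_top"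
    "integrable W (\<lambda>x. exp (- \<beta> * ?V x))"
    using path_integral_tendsto[where g = "\<lambda>_. 1" and \<alpha> = 0 and Cg = 1 and \<gamma> = \<gamma>, OF assms(10) _ one] \<kappa>0
    by (simp_all add: Y_def W_def)
  have W_prob: "prob_space W"
    unfolding W_def distr_std_normal_scaled[OF \<open>\<beta> > 0\<close>, symmetric]
    by (intro prob_space_PiM prob_space.prob_space_distr prob_space_normal_density) auto
  have W_sets: "sets W = sets (PiM ?\<Lambda> (\<lambda>_. borel))" unfolding W_def by (intro sets_PiM_cong) auto
  have V_W: "?V \<in> borel_measurable W" and g_W: "g \<in> borel_measurable W"
    using V_meas g_meas unfolding measurable_cong_sets[OF W_sets refl] .
  \<comment> \<open>The limit of the quotients requires a nonzero denominator; a positive integrand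
    over a probability measure cannot vanish almost everywhere.\<close>
  have "Y \<noteq> 0"
  proof
    assume "Y = 0"
    then have "AE x in W. exp (- \<beta> * ?V x) = 0"
      unfolding Y_def by (subst (asm) integral_nonneg_eq_0_iff_AE) (use den(2) \<kappa>0 in auto)
    then have "AE x in W. False" by simp
    then show False using prob_space.AE_False[OF W_prob] by simp
  qed
  have "Y \<ge> 0" unfolding Y_def by (intro Bochner_Integration.integral_nonneg) auto
  have classical: "classical_order J U k0 k1 \<beta> = (\<integral>x. g x * exp (- \<beta> * ?V x) \<partial>W) / Y"
  proof -
    have "(\<lambda>x. \<beta> * ?V x) \<in> borel_measurable W" using V_W by measurable
    from integral_density_normalized[OF g_W this \<open>Y \<ge> 0\<close>]
    show ?thesis
      by (simp add: classical_order_def classical_gibbs_def classical_reference_def Let_def g_def N_def W_def Y_def)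
  qed
  have quantum: "quantum_order J U k0 k1 \<beta> (\<gamma> m) =
      (\<integral>\<omega>. g (mean \<omega>) * exp (- path_energy \<omega>) \<partial>PiM ?\<Lambda> (\<lambda>_. \<gamma> m)) / (\<integral>\<omega>. exp (- path_energy \<omega>) \<partial>PiM ?\<Lambda> (\<lambda>_. \<gamma> m))"
    if "m > 0" for m
  proof -
    let ?M = "PiM ?\<Lambda> (\<lambda>_. \<gamma> m)"
    let ?f = "\<lambda>\<omega>. (1 / (\<beta> * N) * (LBINT \<tau>:{0..\<beta>}. \<Sum>j\<in>?\<Lambda>. \<omega> j \<tau>))\<^sup>2"
    note G = assms(10)[OF that]
    note [measurable] = path_energy_measurable[OF that G] mean_measurable[OF that G]
    have cont: "continuous_on {0..\<beta>} (\<omega> j)" if "\<omega> \<in> space ?M" "j \<in> ?\<Lambda>" for \<omega> j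
      by (rule path_continuous[OF \<open>m > 0\<close> G that])
    \<comment> \<open>The energy identity and the next one rest on continuity of the paths, so they
      hold on the space of \<open>?M\<close>; integrals and measurability are rewritten
      there.\<close>
    have E: "quantum_energy J U k0 k1 \<beta> \<omega> = path_energy \<omega>" if "\<omega> \<in> space ?M" for \<omega>
      unfolding path_energy_def by (rule quantum_energy_eq_integral[OF assms(4) cont[OF that]])
    have f: "?f \<omega> = g (mean \<omega>)" if "\<omega> \<in> space ?M" for \<omega>
      using path_mean_eq[where N = N, OF \<open>\<beta> > 0\<close> cont[OF that] fin] by (simp add: g_def mean_def)
    define Z where "Z = (LINT \<omega>|?M. exp (- quantum_energy J U k0 k1 \<beta> \<omega>))"
    have Z: "Z = (\<integral>\<omega>. exp (- path_energy \<omega>) \<partial>?M)"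
      unfolding Z_def by (intro Bochner_Integration.integral_cong) (auto simp: E)
    have "Z \<ge> 0" unfolding Z by (intro Bochner_Integration.integral_nonneg) auto
    have "quantum_order J U k0 k1 \<beta> (\<gamma> m) =
        (LINT \<omega>|density ?M (\<lambda>\<omega>. ennreal (1 / Z * exp (- quantum_energy J U k0 k1 \<beta> \<omega>))). ?f \<omega>)"
      by (simp add: quantum_order_def quantum_gibbs_def Let_def N_def Z_def)
    also have "\<dots> = (LINT \<omega>|?M. ?f \<omega> * exp (- quantum_energy J U k0 k1 \<beta> \<omega>)) / Z"
    proof (rule integral_density_normalized[OF _ _ \<open>Z \<ge> 0\<close>])
      have "(\<lambda>\<omega>. g (mean \<omega>)) \<in> borel_measurable ?M" by measurable
      then show "?f \<in> borel_measurable ?M" by (subst measurable_cong[OF f])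
      show "quantum_energy J U k0 k1 \<beta> \<in> borel_measurable ?M"
        by (subst measurable_cong[OF E]) measurable
    qed
    also have "(LINT \<omega>|?M. ?f \<omega> * exp (- quantum_energy J U k0 k1 \<beta> \<omega>)) = (\<integral>\<omega>. g (mean \<omega>) * exp (- path_energy \<omega>) \<partial>?M)"
      by (intro Bochner_Integration.integral_cong refl) (simp only: E f)
    finally show ?thesis by (simp only: Z)
  qed
  have "((\<lambda>m. (\<integral>\<omega>. g (mean \<omega>) * exp (- path_energy \<omega>) \<partial>PiM ?\<Lambda> (\<lambda>_. \<gamma> m)) /
      (\<integral>\<omega>. exp (- path_energy \<omega>) \<partial>PiM ?\<Lambda> (\<lambda>_. \<gamma> m))) \<longlongrightarrow> classical_order J U k0 k1 \<beta>) at_top"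
    unfolding classical by (intro tendsto_divide num(1) den(1) \<open>Y \<noteq> 0\<close>) (use \<alpha> \<kappa>0 in auto)
  then show ?thesis
    by (rule Lim_transform_eventually)
       (use eventually_gt_at_top[of 0] in eventually_elim, simp add: quantum)
qed

end
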